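(* There exists a sequence $\{M_j\}$ of compact arithmetic hyperbolic $3$-manifolds with $\mathrm{vol}(M_j)\to\infty$ such that \[\mathrm{Kiss}(M_j) \geq C\, \frac{\mathrm{vol}(M_j)^{4/3}}{\log(\mathrm{vol}(M_j))}\] for all $j$, where $C>0$ is a universal constant.
   Context: For a finite volume hyperbolic 3-manifold $M$, $\mathrm{Kiss}(M)$ is the number of free homotopy classes of oriented closed geodesics in $M$ whose length equals the minimal length of a closed geodesic of $M$. An arithmetic hyperbolic $3$-manifold is $\Gamma\backslash\mathbb{H}^3$ with $\Gamma<\mathrm{PSL}(2,\mathbb{C})$ a torsion-free arithmetic Kleinian group, i.e. commensurable with the image in $\mathrm{PSL}(2,\mathbb{C})$ of $\rho(\mathcal{O}^1)$, where $\mathcal{O}^1$ is the group of reduced-norm-one elements of an order $\mathcal{O}$ in a quaternion algebra $\mathcal{A}$ over a number field $k$ with exactly one complex place, $\mathcal{A}$ ramified at all real places, and $\rho$ a $k$-embedding of $\mathcal{A}$ into $M_2(\mathbb{C})$. *)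

theory Defs
  imports "HOL-Analysis.Analysis"
begin

type_synonym cmat = "complex^2^2"
type_synonym hpoint = "complex \<times> real"   (* z + t j in the upper half-space model, t > 0 *)

definition H3 :: "hpoint set" where
  "H3 = {p. snd p > 0}"

text \<open>Action of SL(2,C) on the upper half-space (Poincare extension of Moebius maps):
  g(z + t j) = ((az+b) conj(cz+d) + a conj(c) t^2)/D + (t/D) j, D = |cz+d|^2 + |c|^2 t^2.\<close>
definition act :: "cmat \<Rightarrow> hpoint \<Rightarrow> hpoint" where
  "act g p = (let z = fst p; t = snd p;
                  a = g$1$1; b = g$1$2; c = g$2$1; d = g$2$2;
                  D = (cmod (c*z+d))^2 + (cmod c)^2 * t^2
              in (((a*z+b) * cnj (c*z+d) + a * cnj c * complex_of_real (t^2)) / complex_of_real D,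
                  t / D))"

definition hdist :: "hpoint \<Rightarrow> hpoint \<Rightarrow> real" where
  "hdist p q = arcosh (1 + ((cmod (fst p - fst q))^2 + (snd p - snd q)^2)
                          / (2 * snd p * snd q))"

definition hypvol :: "hpoint set \<Rightarrow> ennreal" where
  "hypvol F = set_nn_integral lborel F (\<lambda>p. ennreal (1 / (snd p)^3))"

text \<open>A subgroup of PSL(2,C) is represented by its full preimage G in SL(2,C),
  a subgroup of SL(2,C) containing -I.\<close>
definition SL2_preimage_group :: "cmat set \<Rightarrow> bool" where
  "SL2_preimage_group G \<longleftrightarrow>
     (\<forall>g\<in>G. det g = 1) \<and> mat 1 \<in> G \<and> - mat 1 \<in> G \<and>
     (\<forall>g\<in>G. \<forall>h\<in>G. g ** h \<in> G) \<and> (\<forall>g\<in>G. matrix_inv g \<in> G)"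

definition nontrivial_elt :: "cmat \<Rightarrow> bool" where
  "nontrivial_elt g \<longleftrightarrow> g \<noteq> mat 1 \<and> g \<noteq> - mat 1"

definition discrete_group :: "cmat set \<Rightarrow> bool" where
  "discrete_group G \<longleftrightarrow> (\<forall>r::real. finite {g\<in>G. norm g \<le> r})"

definition torsion_free :: "cmat set \<Rightarrow> bool" where
  "torsion_free G \<longleftrightarrow>
     (\<forall>g\<in>G. \<forall>n::nat. n \<ge> 1 \<longrightarrow> \<not> nontrivial_elt (((\<lambda>x. g ** x) ^^ n) (mat 1)) \<longrightarrow> \<not> nontrivial_elt g)"

definition cocompact :: "cmat set \<Rightarrow> bool" where
  "cocompact G \<longleftrightarrow> (\<exists>K. compact K \<and> K \<subseteq> H3 \<and> (\<Union>g\<in>G. act g ` K) = H3)"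

definition fund_domain :: "cmat set \<Rightarrow> hpoint set \<Rightarrow> bool" where
  "fund_domain G F \<longleftrightarrow> F \<in> sets lborel \<and> F \<subseteq> H3 \<and> (\<Union>g\<in>G. act g ` F) = H3 \<and>
     (\<forall>g\<in>G. \<forall>h\<in>G. h \<noteq> g \<and> h \<noteq> - g \<longrightarrow> act g ` F \<inter> act h ` F \<in> null_sets lborel)"

definition vol :: "cmat set \<Rightarrow> real" where
  "vol G = enn2real (SOME v. \<exists>F. fund_domain G F \<and> v = hypvol F)"

text \<open>Length of the closed geodesic in the free homotopy class determined by g
  (translation length of g).\<close>
definition geod_len :: "cmat \<Rightarrow> real" where
  "geod_len g = Inf {hdist p (act g p) | p. p \<in> H3}"

definition systole :: "cmat set \<Rightarrow> real" where
  "systole G = Inf {geod_len g | g. g \<in> G \<and> nontrivial_elt g}"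

text \<open>Conjugacy class in the PSL(2,C)-group (i.e. up to sign); these correspond to
  free homotopy classes of oriented closed curves in G\H3.\<close>
definition conj_class :: "cmat set \<Rightarrow> cmat \<Rightarrow> cmat set" where
  "conj_class G g = {s *\<^sub>R (d ** g ** matrix_inv d) | d s. d \<in> G \<and> (s = 1 \<or> s = -1)}"

definition Kiss :: "cmat set \<Rightarrow> nat" where
  "Kiss G = card {conj_class G g | g. g \<in> G \<and> nontrivial_elt g \<and> geod_len g = systole G}"

definition subfield_C :: "complex set \<Rightarrow> bool" where
  "subfield_C k \<longleftrightarrow> 0 \<in> k \<and> 1 \<in> k \<and> (\<forall>x\<in>k. \<forall>y\<in>k. x + y \<in> k \<and> x * y \<in> k) \<and>
     (\<forall>x\<in>k. - x \<in> k) \<and> (\<forall>x\<in>k. x \<noteq> 0 \<longrightarrow> inverse x \<in> k)"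

definition number_field :: "complex set \<Rightarrow> bool" where
  "number_field k \<longleftrightarrow> subfield_C k \<and>
     (\<exists>B. finite B \<and> B \<subseteq> k \<and> k = {\<Sum>b\<in>B. of_rat (c b) * b | c. True})"

definition field_emb :: "complex set \<Rightarrow> (complex \<Rightarrow> complex) \<Rightarrow> bool" where
  "field_emb k \<sigma> \<longleftrightarrow> \<sigma> 1 = 1 \<and> (\<forall>x\<in>k. \<forall>y\<in>k. \<sigma> (x + y) = \<sigma> x + \<sigma> y \<and> \<sigma> (x * y) = \<sigma> x * \<sigma> y)"

definition real_emb :: "complex set \<Rightarrow> (complex \<Rightarrow> complex) \<Rightarrow> bool" where
  "real_emb k \<sigma> \<longleftrightarrow> field_emb k \<sigma> \<and> (\<forall>x\<in>k. \<sigma> x \<in> \<real>)"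

text \<open>k (a subfield of C, i.e. viewed via its complex place) has exactly one complex place:
  it is not real, and every embedding other than the inclusion and its conjugate is real.\<close>
definition one_complex_place :: "complex set \<Rightarrow> bool" where
  "one_complex_place k \<longleftrightarrow> number_field k \<and> \<not> k \<subseteq> \<real> \<and>
     (\<forall>\<sigma>. field_emb k \<sigma> \<longrightarrow> (\<forall>x\<in>k. \<sigma> x = x) \<or> (\<forall>x\<in>k. \<sigma> x = cnj x) \<or> (\<forall>x\<in>k. \<sigma> x \<in> \<real>))"

definition klin :: "(nat \<Rightarrow> complex) \<Rightarrow> (nat \<Rightarrow> cmat) \<Rightarrow> cmat" where
  "klin c e = (\<Sum>i<4. mat (c i) ** e i)"

text \<open>A is the image rho(A) of a quaternion algebra over k under a k-embedding
  rho into M_2(C): a k-subalgebra of M_2(C) with k-basis e_0..e_3 that spans M_2(C) over C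
  (equivalently A is central simple of dimension 4 over k and A tensor C = M_2(C)).\<close>
definition quat_alg :: "complex set \<Rightarrow> cmat set \<Rightarrow> (nat \<Rightarrow> cmat) \<Rightarrow> bool" where
  "quat_alg k A e \<longleftrightarrow>
     mat 1 \<in> A \<and> (\<forall>x\<in>A. \<forall>y\<in>A. x + y \<in> A \<and> x ** y \<in> A) \<and>
     (\<forall>c\<in>k. \<forall>x\<in>A. mat c ** x \<in> A) \<and>
     (\<forall>i<4. e i \<in> A) \<and>
     (\<forall>c. (\<forall>i<4. c i \<in> k) \<and> klin c e = 0 \<longrightarrow> (\<forall>i<4. c i = 0)) \<and>
     A = {klin c e | c. \<forall>i<4. c i \<in> k} \<and>
     (\<forall>M. \<exists>c. M = klin c e)"

text \<open>Bilinear form associated with the reduced norm (= determinant).\<close>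
definition nbil :: "cmat \<Rightarrow> cmat \<Rightarrow> complex" where
  "nbil x y = (det (x + y) - det x - det y) / 2"

text \<open>A is ramified at the real place sigma: A tensor_sigma R is a division algebra,
  i.e. its reduced norm form (transported by sigma) is anisotropic.\<close>
definition ramified_at :: "cmat set \<Rightarrow> (nat \<Rightarrow> cmat) \<Rightarrow> (complex \<Rightarrow> complex) \<Rightarrow> bool" where
  "ramified_at A e \<sigma> \<longleftrightarrow>
     (\<forall>r::nat \<Rightarrow> real. (\<exists>i<4. r i \<noteq> 0) \<longrightarrow>
        (\<Sum>i<4. \<Sum>j<4. r i * r j * Re (\<sigma> (nbil (e i) (e j)))) \<noteq> 0)"

definition is_order :: "complex set \<Rightarrow> cmat set \<Rightarrow> cmat set \<Rightarrow> bool" where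
  "is_order k A Ord \<longleftrightarrow> Ord \<subseteq> A \<and> mat 1 \<in> Ord \<and>
     (\<forall>x\<in>Ord. \<forall>y\<in>Ord. x + y \<in> Ord \<and> x ** y \<in> Ord) \<and> (\<forall>x\<in>Ord. - x \<in> Ord) \<and>
     (\<exists>G. finite G \<and> G \<subseteq> Ord \<and> Ord = {\<Sum>g\<in>G. mat (of_int (c g)) ** g | c. True}) \<and>
     A = {\<Sum>x\<in>T. mat (c x) ** x | T c. finite T \<and> T \<subseteq> Ord \<and> (\<forall>x\<in>T. c x \<in> k)}"

text \<open>Preimage in SL(2,C) of the image of Ord^1 in PSL(2,C).\<close>
definition norm_one_group :: "cmat set \<Rightarrow> cmat set" where
  "norm_one_group Ord = {s *\<^sub>R x | x s. x \<in> Ord \<and> det x = 1 \<and> (s = 1 \<or> s = -1)}"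

definition finite_index :: "cmat set \<Rightarrow> cmat set \<Rightarrow> bool" where
  "finite_index H G \<longleftrightarrow> (\<exists>F. finite F \<and> F \<subseteq> G \<and> G = {f ** h | f h. f \<in> F \<and> h \<in> H})"

definition commensurable :: "cmat set \<Rightarrow> cmat set \<Rightarrow> bool" where
  "commensurable G L \<longleftrightarrow> finite_index (G \<inter> L) G \<and> finite_index (G \<inter> L) L"

definition arithmetic_Kleinian :: "cmat set \<Rightarrow> bool" where
  "arithmetic_Kleinian G \<longleftrightarrow> SL2_preimage_group G \<and> discrete_group G \<and>
     (\<exists>k A e Ord. one_complex_place k \<and> quat_alg k A e \<and>
        (\<forall>\<sigma>. real_emb k \<sigma> \<longrightarrow> ramified_at A e \<sigma>) \<and>
        is_order k A Ord \<and> commensurable G (norm_one_group Ord))"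

definition compact_arith_manifold_group :: "cmat set \<Rightarrow> bool" where
  "compact_arith_manifold_group G \<longleftrightarrow> arithmetic_Kleinian G \<and> torsion_free G \<and> cocompact G"

end

theory Submission
  imports Defs
begin

text \<open>
  Let \<open>Ord\<close> be the order spanned by \<open>1, I, J, I J\<close> over \<open>\<int>[\<i>]\<close>, with \<open>I\<^sup>2 = 8\<close> and \<open>J\<^sup>2 = 20\<close>, let
  \<open>Gam\<close> be its cocompact group of elements of norm 1, and for \<open>a \<in> \<int>[\<i>]\<close> let \<open>Gcong a\<close> be the
  elements congruent to \<open>\<plusminus>1\<close> modulo \<open>a\<close>. An element \<open>x = 1 + a z\<close> of norm 1 has trace \<open>2 - a\<^sup>2 det z\<close>,
  so \<open>x\<close> is shortest when \<open>det z\<close> is a unit, and the order is such that this unit must be 1. Since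
  \<open>- y\<^sup>2 = 1 - a y\<close> whenever \<open>y \<in> Gam\<close> has trace \<open>a\<close>, the squares of the elements of trace \<open>a\<close>
  realise the systole of \<open>Gcong a\<close>.

  About \<open>R\<^sup>4\<close> elements of \<open>Gam\<close> have norm at most \<open>R\<close>, and their traces take only \<open>O(R\<^sup>2)\<close> values.
  Hence there are arbitrarily large \<open>a\<close> that are the trace of at least \<open>c |a|\<^sup>2\<close> elements
  of norm \<open>O(|a|)\<close>. Conjugating their squares by representatives of \<open>Gam / Gcong a\<close>
  yields \<open>c |a|\<^sup>2\<close> times the index many pairs, and each conjugacy class in \<open>Gcong a\<close> arises
  from \<open>O(log |a|)\<close> of them, because the orbit points near one period of an axis number
  \<open>O(log |a|)\<close>. The index is comparable to the volume and is \<open>O(|a|\<^sup>6)\<close>, the order of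
  \<open>SL\<^sub>2\<close> modulo \<open>a\<close>, so \<open>|a|\<^sup>2\<close> is at least a constant times the volume to the power \<open>1/3\<close>.
\<close>

subsection \<open>Isometries of hyperbolic space\<close>

text \<open>The obstacle is the other units. If \<open>det z\<close> could be -1, i or -i, traces
  such as 2 + a^2 would compete with a^2 - 2, and for some a they belong to shorter geodesics. The
  constants 8 and 20 are divisible by 4, so every norm is a square modulo 4; together with the
  relation between \<open>trace z\<close> and \<open>det z\<close> this excludes these units. The
  constants also give a division algebra, because 8 is a non-residue modulo the prime 2 - i and 20
  is divisible by that prime exactly once, and they give the Pell units 3 + I and 9 + 2 J.

  The exponent 4/3 rests on the index: counting residues of the whole order gives |a|^8, which would
  only yield 5/4. The factor |a|^2 is gained from the element y of trace a itself, which supplies a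
  splitting of the order modulo a.

  The values of a are not explicit. They come from averaging over all traces, with a lower bound for
  the number of group elements read off from the volume of a box. The large systole in turn forces
  the volume to be at least |a|^4 / 2048, which gives divergence and allows ln |a| to be replaced by
  the logarithm of the volume.\<close>

definition mk :: "complex \<Rightarrow> complex \<Rightarrow> complex \<Rightarrow> complex \<Rightarrow> cmat" where
  "mk a b c d = vector [vector [a, b], vector [c, d]]"

lemma mk_sel [simp]:
  "mk a b c d $ 1 $ 1 = a" "mk a b c d $ 1 $ 2 = b" "mk a b c d $ 2 $ 1 = c" "mk a b c d $ 2 $ 2 = d"
  by (simp_all add: mk_def)

lemma cmat_eq_iff:
  fixes m n :: cmat
  shows "m = n \<longleftrightarrow> m$1$1 = n$1$1 \<and> m$1$2 = n$1$2 \<and> m$2$1 = n$2$1 \<and> m$2$2 = n$2$2"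
  by (auto simp: vec_eq_iff forall_2)

lemma mm_sel [simp]:
  fixes m n :: cmat
  shows "(m ** n)$1$1 = m$1$1 * n$1$1 + m$1$2 * n$2$1"
    "(m ** n)$1$2 = m$1$1 * n$1$2 + m$1$2 * n$2$2"
    "(m ** n)$2$1 = m$2$1 * n$1$1 + m$2$2 * n$2$1"
    "(m ** n)$2$2 = m$2$1 * n$1$2 + m$2$2 * n$2$2"
  by (simp_all add: matrix_matrix_mult_def sum_2)

lemma mat_sel [simp]:
  "(mat a :: cmat)$1$1 = a" "(mat a :: cmat)$1$2 = 0" "(mat a :: cmat)$2$1 = 0" "(mat a :: cmat)$2$2 = a"
  by (simp_all add: mat_def)

lemma cmod_sq_complex: "(complex_of_real (cmod z))\<^sup>2 = z * cnj z"
  "complex_of_real (cmod z) * complex_of_real (cmod z) = z * cnj z"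
  by (metis complex_norm_square of_real_power) (metis complex_norm_square of_real_power power2_eq_square)

lemma trace_cmat: "trace (m::cmat) = m$1$1 + m$2$2"
  by (simp add: trace_def sum_2)

lemma norm_cmat_sq:
  fixes m :: cmat
  shows "(norm m)\<^sup>2 = (cmod (m$1$1))\<^sup>2 + (cmod (m$1$2))\<^sup>2 + (cmod (m$2$1))\<^sup>2 + (cmod (m$2$2))\<^sup>2"
  by (simp add: norm_vec_def L2_set_def sum_2 sum_nonneg)

text \<open>The adjugate: the inverse on determinant 1 and the quaternion conjugation on the order.
  Being linear in the entries, it visibly preserves integrality and congruences.\<close>

definition adj :: "cmat \<Rightarrow> cmat" where
  "adj m = mk (m$2$2) (- m$1$2) (- m$2$1) (m$1$1)"

lemma adj_sel [simp]:
  "adj m $1$1 = m$2$2" "adj m $1$2 = - m$1$2" "adj m $2$1 = - m$2$1" "adj m $2$2 = m$1$1"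
  by (simp_all add: adj_def)

lemma det_cmat: "det (m::cmat) = m$1$1 * m$2$2 - m$1$2 * m$2$1"
  by (simp add: det_2)

lemma mult_adj: "m ** adj m = mat (det m)" "adj m ** m = mat (det m)"
  by (simp_all add: cmat_eq_iff det_cmat)

lemma adj_mult: "adj (m ** n) = adj n ** adj m"
  by (simp add: cmat_eq_iff algebra_simps)

lemma adj_adj [simp]: "adj (adj m) = m"
  by (simp add: cmat_eq_iff)

lemma det_adj [simp]: "det (adj m) = det m"
  by (simp add: det_cmat)

lemma norm_adj [simp]: "norm (adj m) = norm m"
proof -
  have "(norm (adj m))\<^sup>2 = (norm m)\<^sup>2" by (simp add: norm_cmat_sq)
  then show ?thesis by (simp add: power2_eq_iff_nonneg)
qed

lemma det_uminus_cmat [simp]: "det (- m :: cmat) = det m"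
  by (simp add: det_cmat)

lemma mult_uminus_cmat [simp]:
  fixes m n :: cmat
  shows "(- m) ** n = - (m ** n)" "m ** (- n) = - (m ** n)"
  by (simp_all add: cmat_eq_iff)

lemma matrix_inv_eq_adj:
  fixes m :: cmat
  assumes "det m = 1"
  shows "matrix_inv m = adj m"
proof -
  have inv: "m ** adj m = mat 1" "adj m ** m = mat 1" using mult_adj[of m] assms by auto
  then have "\<exists>A. m ** A = mat 1 \<and> A ** m = mat 1" by blast
  then have "m ** matrix_inv m = mat 1 \<and> matrix_inv m ** m = mat 1"
    unfolding matrix_inv_def by (rule someI_ex)
  then have "matrix_inv m = (adj m ** m) ** matrix_inv m" "adj m ** (m ** matrix_inv m) = adj m"
    using inv by simp_all
  then show ?thesis by (simp add: matrix_mul_assoc)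
qed

lemma norm_mult_cmat:
  fixes m n :: cmat
  shows "norm (m ** n) \<le> norm m * norm n"
proof -
  have cs: "(cmod (a*b + c*d))\<^sup>2 \<le> ((cmod a)\<^sup>2 + (cmod c)\<^sup>2) * ((cmod b)\<^sup>2 + (cmod d)\<^sup>2)" for a b c d
  proof -
    have "cmod (a*b + c*d) \<le> cmod a * cmod b + cmod c * cmod d"
      by (metis norm_mult norm_triangle_ineq)
    then have "(cmod (a*b + c*d))\<^sup>2 \<le> (cmod a * cmod b + cmod c * cmod d)\<^sup>2"
      by (simp add: power_mono)
    also have "\<dots> \<le> ((cmod a)\<^sup>2 + (cmod c)\<^sup>2) * ((cmod b)\<^sup>2 + (cmod d)\<^sup>2)"
      using sum_squares_bound[of "cmod a * cmod d" "cmod c * cmod b"]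
      by (simp add: power2_eq_square algebra_simps)
    finally show ?thesis .
  qed
  have "(norm (m ** n))\<^sup>2 \<le> (norm m)\<^sup>2 * (norm n)\<^sup>2"
    unfolding norm_cmat_sq[of "m ** n"] mm_sel
    by (rule order_trans[OF add_mono[OF add_mono[OF add_mono[OF cs cs] cs] cs]])
       (simp add: norm_cmat_sq algebra_simps)
  then show ?thesis
    by (metis abs_norm_cancel abs_le_square_iff power_mult_distrib abs_of_nonneg mult_nonneg_nonneg norm_ge_zero)
qed

section \<open>Points of hyperbolic space as Hermitian matrices\<close>

definition ctr :: "cmat \<Rightarrow> cmat" where
  "ctr m = mk (cnj (m$1$1)) (cnj (m$2$1)) (cnj (m$1$2)) (cnj (m$2$2))"

lemma ctr_sel [simp]:
  "ctr m $1$1 = cnj (m$1$1)" "ctr m $1$2 = cnj (m$2$1)" "ctr m $2$1 = cnj (m$1$2)" "ctr m $2$2 = cnj (m$2$2)"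
  by (simp_all add: ctr_def)

lemma ctr_mult: "ctr (m ** n) = ctr n ** ctr m"
  by (simp add: cmat_eq_iff algebra_simps)

lemma adj_ctr: "adj (ctr m) = ctr (adj m)"
  by (simp add: cmat_eq_iff)

lemma trace_mult_ctr: "trace (m ** ctr m) = complex_of_real ((norm m)\<^sup>2)"
  by (simp add: trace_cmat norm_cmat_sq cmod_sq_complex)

text \<open>The upper triangular matrix of determinant 1 that carries the base point
  \<open>(0, 1)\<close> to \<open>p\<close>.\<close>

definition hmat :: "hpoint \<Rightarrow> cmat" where
  "hmat p = mk (complex_of_real (sqrt (snd p))) (fst p / complex_of_real (sqrt (snd p))) 0
     (1 / complex_of_real (sqrt (snd p)))"

text \<open>Identifies \<open>H3\<close> with the positive definite Hermitian matrices of
  determinant 1, on which a matrix g acts linearly by X to g X g*. This turns isometry computations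
  into matrix algebra.\<close>

definition Herm :: "hpoint \<Rightarrow> cmat" where
  "Herm p = mk (complex_of_real (((cmod (fst p))\<^sup>2 + (snd p)\<^sup>2) / snd p)) (fst p / complex_of_real (snd p))
     (cnj (fst p) / complex_of_real (snd p)) (1 / complex_of_real (snd p))"

lemma of_real_sqrt_sq: "t > 0 \<Longrightarrow> complex_of_real (sqrt t) * complex_of_real (sqrt t) = complex_of_real t"
  by (metis of_real_mult real_sqrt_mult_self abs_of_pos)

lemma det_hmat: "p \<in> H3 \<Longrightarrow> det (hmat p) = 1"
  by (simp add: det_cmat hmat_def H3_def)

lemma Herm_hmat:
  assumes "p \<in> H3"
  shows "Herm p = hmat p ** ctr (hmat p)"
  using assms
  by (simp add: cmat_eq_iff Herm_def hmat_def H3_def of_real_sqrt_sq cmod_sq_complex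
      field_simps power2_eq_square)

lemma Herm_inj:
  assumes "p \<in> H3" "q \<in> H3" "Herm p = Herm q"
  shows "p = q"
  using assms by (auto simp: cmat_eq_iff Herm_def H3_def prod_eq_iff)

lemma act_denominator_pos:
  fixes g :: cmat
  assumes "det g = 1" "snd p > 0"
  shows "(cmod (g$2$1 * fst p + g$2$2))\<^sup>2 + (cmod (g$2$1))\<^sup>2 * (snd p)\<^sup>2 > 0"
proof (cases "g$2$1 = 0")
  case True
  then have "g$2$2 \<noteq> 0" using assms(1) unfolding det_cmat by auto
  then show ?thesis using True by simp
next
  case False
  then show ?thesis using assms by (intro add_nonneg_pos) auto
qed

lemma act_in_H3:
  assumes "det g = 1" "p \<in> H3"
  shows "act g p \<in> H3"
  using act_denominator_pos[OF assms(1), of p] assms(2)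
  by (simp add: act_def H3_def Let_def)

lemma Herm_act:
  assumes "det g = 1" "p \<in> H3"
  shows "Herm (act g p) = g ** Herm p ** ctr g"
proof -
  define a b c d where "a = g$1$1" "b = g$1$2" "c = g$2$1" "d = g$2$2"
  note abcd = this
  define z t where "z = fst p" "t = snd p"
  note zt = this
  have t: "t > 0" using assms zt by (simp add: H3_def)
  define D where "D = (cmod (c*z+d))\<^sup>2 + (cmod c)\<^sup>2 * t\<^sup>2"
  have D: "D > 0" using act_denominator_pos[OF assms(1), of p] t by (simp add: D_def abcd zt)
  define w where "w = (a*z+b) * cnj (c*z+d) + a * cnj c * complex_of_real (t\<^sup>2)"
  have act: "act g p = (w / complex_of_real D, t / D)"
    by (simp add: act_def Let_def w_def D_def abcd zt)
  have det: "a * d - b * c = 1" using assms by (simp add: det_cmat abcd)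
  have g: "g = mk a b c d" by (simp add: cmat_eq_iff abcd)
  have Dc: "complex_of_real D = (c*z+d) * cnj (c*z+d) + c * cnj c * t\<^sup>2"
    by (simp only: D_def of_real_add of_real_mult complex_norm_square)
  \<comment> \<open>Multiplying the summand t^2 by |a d - b c|^2, which is 1, turns the claim into a
    polynomial identity.\<close>
  have key: "w * cnj w + of_real (t\<^sup>2) =
      complex_of_real D * ((a*z+b) * cnj (a*z+b) + a * cnj a * t\<^sup>2)"
  proof -
    have "(a * d - b * c) * cnj (a * d - b * c) = 1" by (simp add: det)
    moreover have "w * cnj w + of_real (t\<^sup>2) * ((a * d - b * c) * cnj (a * d - b * c)) =
      complex_of_real D * ((a*z+b) * cnj (a*z+b) + a * cnj a * t\<^sup>2)"
      unfolding Dc w_def by (simp add: algebra_simps power2_eq_square)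
    ultimately show ?thesis by simp
  qed
  have H: "Herm p = mk ((z * cnj z + t\<^sup>2) / t) (z / t) (cnj z / t) (1 / t)"
    by (simp add: Herm_def zt of_real_divide cmod_sq_complex)
  have t0: "complex_of_real t \<noteq> 0" and D0: "complex_of_real D \<noteq> 0" using t D by auto
  have e11: "complex_of_real (((cmod (w / D))\<^sup>2 + (t/D)\<^sup>2) / (t/D)) = (w * cnj w + of_real (t\<^sup>2)) / (D * t)"
    using t0 D0 by (simp add: norm_divide power_divide cmod_sq_complex field_simps power2_eq_square)
  have e12: "w / t = (a * ((z * cnj z + t\<^sup>2) / t) + b * (cnj z / t)) * cnj c + (a * (z / t) + b * (1 / t)) * cnj d"
    unfolding w_def using t0 by (simp add: divide_simps) (simp add: algebra_simps power2_eq_square)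
  have e21: "cnj w / t = (c * ((z * cnj z + t\<^sup>2) / t) + d * (cnj z / t)) * cnj a + (c * (z / t) + d * (1 / t)) * cnj b"
    unfolding w_def using t0 by (simp add: divide_simps) (simp add: algebra_simps power2_eq_square)
  have e22: "complex_of_real D / complex_of_real t = (c * ((z * cnj z + t\<^sup>2) / t) + d * (cnj z / t)) * cnj c + (c * (z / t) + d * (1 / t)) * cnj d"
    unfolding Dc using t0 by (simp add: divide_simps) (simp add: algebra_simps power2_eq_square)
  have e11': "((a*z+b) * cnj (a*z+b) + a * cnj a * t\<^sup>2) / t =
      (a * ((z * cnj z + t\<^sup>2) / t) + b * (cnj z / t)) * cnj a + (a * (z / t) + b * (1 / t)) * cnj b"
    using t0 by (simp add: divide_simps) (simp add: algebra_simps power2_eq_square)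
  show ?thesis
    unfolding act H unfolding g Herm_def fst_conv snd_conv e11 key cmat_eq_iff mm_sel mk_sel ctr_sel
    using t0 D0 e11' e12 e21 e22 by simp
qed

text \<open>The composition law is inherited from the linear action on Hermitian matrices, since
  \<open>Herm\<close> is injective.\<close>

lemma act_mult:
  assumes "det g = 1" "det h = 1" "p \<in> H3"
  shows "act (g ** h) p = act g (act h p)"
proof (rule Herm_inj)
  have "det (g ** h) = 1" using assms by (simp add: det_mul)
  then show "act (g ** h) p \<in> H3" "Herm (act (g ** h) p) = Herm (act g (act h p))"
    using assms by (simp_all add: act_in_H3 Herm_act ctr_mult matrix_mul_assoc)
qed (use assms in \<open>simp add: act_in_H3\<close>)

lemma act_one [simp]: "act (mat 1) p = p"
  by (simp add: act_def Let_def)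

lemma act_uminus [simp]: "act (- g) p = act g p"
proof -
  have "cmod (- (g$2$1 * fst p) - g$2$2) = cmod (g$2$1 * fst p + g$2$2)"
    using norm_minus_cancel[of "g$2$1 * fst p + g$2$2"] by simp
  then show ?thesis by (simp add: act_def Let_def algebra_simps)
qed

lemma act_adj_cancel:
  assumes "det g = 1" "p \<in> H3"
  shows "act (adj g) (act g p) = p" "act g (act (adj g) p) = p"
  using act_mult[of "adj g" g p] act_mult[of g "adj g" p] assms by (simp_all add: mult_adj)

text \<open>Twice the hyperbolic cosine of the distance to the base point \<open>(0, 1)\<close>.\<close>
definition hnorm :: "hpoint \<Rightarrow> real" where
  "hnorm p = ((cmod (fst p))\<^sup>2 + (snd p)\<^sup>2 + 1) / snd p"

lemma trace_Herm: "p \<in> H3 \<Longrightarrow> trace (Herm p) = complex_of_real (hnorm p)"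
  by (simp add: trace_cmat Herm_def hnorm_def H3_def field_simps)

lemma hnorm_act:
  assumes "det g = 1" "p \<in> H3"
  shows "hnorm (act g p) = (norm (g ** hmat p))\<^sup>2"
proof -
  have "Herm (act g p) = (g ** hmat p) ** ctr (g ** hmat p)"
    using assms by (simp add: Herm_act Herm_hmat ctr_mult matrix_mul_assoc)
  then have "complex_of_real (hnorm (act g p)) = complex_of_real ((norm (g ** hmat p))\<^sup>2)"
    using trace_Herm[OF act_in_H3[OF assms]] trace_mult_ctr by metis
  then show ?thesis by (simp only: of_real_eq_iff)
qed

lemma hnorm_hmat: "p \<in> H3 \<Longrightarrow> hnorm p = (norm (hmat p))\<^sup>2"
  using hnorm_act[of "mat 1" p] by simp

text \<open>The hyperbolic cosine of \<open>hdist\<close>. Stating displacement bounds with it keeps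
  them algebraic; \<open>arcosh\<close> enters only when lengths are compared.\<close>

definition ch :: "hpoint \<Rightarrow> hpoint \<Rightarrow> real" where
  "ch p q = 1 + ((cmod (fst p - fst q))\<^sup>2 + (snd p - snd q)\<^sup>2) / (2 * snd p * snd q)"

lemma hdist_ch: "hdist p q = arcosh (ch p q)"
  by (simp add: hdist_def ch_def)

lemma ch_ge_1: "p \<in> H3 \<Longrightarrow> q \<in> H3 \<Longrightarrow> ch p q \<ge> 1"
  by (simp add: ch_def H3_def)

text \<open>The pairing on the right is the polarised determinant, that is, the Lorentz form of the
  hyperboloid model.\<close>

lemma ch_Herm:
  assumes "p \<in> H3" "q \<in> H3"
  shows "complex_of_real (2 * ch p q) = trace (adj (Herm p) ** Herm q)"
proof -
  obtain z t where p: "p = (z, t)" by (cases p)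
  obtain w u where q: "q = (w, u)" by (cases q)
  have t: "complex_of_real t \<noteq> 0" "complex_of_real u \<noteq> 0" using assms p q by (auto simp: H3_def)
  show ?thesis using t
    by (simp add: p q ch_def trace_cmat Herm_def cmod_sq_complex of_real_divide field_simps)
       (simp add: algebra_simps power2_eq_square)
qed

text \<open>Any factor \<open>h\<close> of \<open>Herm p\<close> is allowed, not just
  \<open>hmat p\<close>: on the axis of a diagonalised element the natural factor is the
  diagonalising matrix.\<close>

lemma ch_act_of_Herm:
  assumes "det g = 1" "p \<in> H3" "Herm p = h ** ctr h"
  shows "ch p (act g p) = (norm (adj h ** g ** h))\<^sup>2 / 2"
proof -
  let ?X = "adj h ** g ** h"
  have "complex_of_real (2 * ch p (act g p)) = trace (adj (h ** ctr h) ** (g ** (h ** ctr h) ** ctr g))"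
    by (simp only: ch_Herm[OF assms(2) act_in_H3[OF assms(1,2)]] Herm_act[OF assms(1,2)] assms(3))
  also have "\<dots> = trace (ctr (adj h) ** (adj h ** g ** h ** ctr h ** ctr g))"
    by (simp add: adj_mult adj_ctr matrix_mul_assoc)
  also have "\<dots> = trace ((adj h ** g ** h ** ctr h ** ctr g) ** ctr (adj h))"
    by (rule trace_mul_sym)
  also have "\<dots> = trace (?X ** ctr ?X)"
    by (simp add: ctr_mult matrix_mul_assoc)
  finally have "complex_of_real (2 * ch p (act g p)) = complex_of_real ((norm ?X)\<^sup>2)"
    by (simp add: trace_mult_ctr)
  then show ?thesis by (simp only: of_real_eq_iff)
qed

lemma ch_act:
  assumes "det g = 1" "p \<in> H3"
  shows "ch p (act g p) = (norm (adj (hmat p) ** g ** hmat p))\<^sup>2 / 2"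
  by (rule ch_act_of_Herm[OF assms Herm_hmat[OF assms(2)]])

lemma trace_conj:
  assumes "det h = 1"
  shows "trace (adj h ** g ** h) = trace (g :: cmat)"
proof -
  have "trace (adj h ** g ** h) = trace (h ** (adj h ** g))" by (rule trace_mul_sym)
  also have "\<dots> = trace g" using assms by (simp add: matrix_mul_assoc mult_adj)
  finally show ?thesis .
qed

text \<open>For \<open>det g = 1\<close> the right-hand side is four times the hyperbolic cosine of the
  translation length, so this is the lower bound for displacements.\<close>
lemma norm_sq_ge_trace:
  assumes "det g = 1"
  shows "(cmod (trace g))\<^sup>2 + cmod ((trace g)\<^sup>2 - 4) \<le> 2 * (norm (g::cmat))\<^sup>2"
proof -
  define a b c d where "a = g$1$1" "b = g$1$2" "c = g$2$1" "d = g$2$2"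
  note abcd = this
  have "a * d - b * c = 1" using assms by (simp add: det_cmat abcd)
  then have "(a+d)\<^sup>2 - 4 = (a-d)\<^sup>2 + 4 * (b * c)"
    by (simp add: power2_eq_square algebra_simps)
  then have "cmod ((a+d)\<^sup>2 - 4) \<le> (cmod (a-d))\<^sup>2 + 4 * (cmod b * cmod c)"
    using norm_triangle_ineq[of "(a-d)\<^sup>2" "4*(b*c)"] by (simp add: norm_mult norm_power)
  moreover have "2 * (cmod b * cmod c) \<le> (cmod b)\<^sup>2 + (cmod c)\<^sup>2"
    using sum_squares_bound[of "cmod b" "cmod c"] by (simp add: algebra_simps)
  moreover have "(cmod (a+d))\<^sup>2 + (cmod (a-d))\<^sup>2 = 2 * (cmod a)\<^sup>2 + 2 * (cmod d)\<^sup>2"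
    unfolding cmod_power2 by (simp add: power2_eq_square algebra_simps)
  ultimately show ?thesis
    by (simp add: trace_cmat norm_cmat_sq flip: abcd)
qed

lemma ch_act_ge:
  assumes "det g = 1" "p \<in> H3"
  shows "ch p (act g p) \<ge> ((cmod (trace g))\<^sup>2 + cmod ((trace g)\<^sup>2 - 4)) / 4"
proof -
  have "det (adj (hmat p) ** g ** hmat p) = 1" using assms by (simp add: det_mul det_hmat)
  from norm_sq_ge_trace[OF this] show ?thesis
    using assms by (simp add: ch_act trace_conj det_hmat)
qed

subsection \<open>Invariance of hyperbolic volume\<close>

text \<open>The change of variables theorem speaks about \<open>real^3\<close>, so hyperbolic volume
  is transported there.\<close>

definition phi :: "real^3 \<Rightarrow> hpoint" where
  "phi v = (Complex (v$1) (v$2), v$3)"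

definition phi_inv :: "hpoint \<Rightarrow> real^3" where
  "phi_inv p = vector [Re (fst p), Im (fst p), snd p]"

lemma phi_inv_phi [simp]: "phi_inv (phi v) = v" "phi (phi_inv p) = p"
  by (auto simp: phi_def phi_inv_def vec_eq_iff forall_3 prod_eq_iff complex_eq_iff)

lemma phi_inv_image: "phi_inv ` E = phi -` E"
proof
  show "phi -` E \<subseteq> phi_inv ` E" by (metis imageI phi_inv_phi(1) subsetI vimageE)
qed auto

lemma continuous_on_phi: "continuous_on S phi"
proof -
  have eq: "phi = (\<lambda>v. (complex_of_real (v$1) + \<i> * complex_of_real (v$2), v$3))"
    by (auto simp: phi_def complex_eq_iff)
  moreover have "continuous_on S (\<lambda>v::real^3. (complex_of_real (v$1) + \<i> * complex_of_real (v$2), v$3))"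
    by (intro continuous_intros)
  ultimately show ?thesis by (subst eq)
qed

lemma borel_measurable_phi [measurable]: "phi \<in> borel_measurable borel"
  by (rule borel_measurable_continuous_onI) (rule continuous_on_phi)

lemma distr_phi: "distr lborel borel phi = lborel"
proof (rule lborel_eqI[symmetric])
  fix l u :: hpoint
  assume le: "\<And>b. b \<in> Basis \<Longrightarrow> l \<bullet> b \<le> u \<bullet> b"
  have bas: "(1, 0) \<in> (Basis :: hpoint set)" "(\<i>, 0) \<in> (Basis :: hpoint set)" "(0, 1) \<in> (Basis :: hpoint set)"
    by (auto simp: Basis_prod_def Basis_complex_def)
  have le': "Re (fst l) \<le> Re (fst u)" "Im (fst l) \<le> Im (fst u)" "snd l \<le> snd u"
    using le[OF bas(1)] le[OF bas(2)] le[OF bas(3)] by (auto simp: inner_complex_def inner_prod_def)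
  have "phi v \<in> box l u \<longleftrightarrow> Re (fst l) < v$1 \<and> v$1 < Re (fst u) \<and> Im (fst l) < v$2 \<and> v$2 < Im (fst u) \<and>
      snd l < v$3 \<and> v$3 < snd u" for v
    by (auto simp: mem_box Basis_prod_def Basis_complex_def ball_Un phi_def inner_complex_def inner_prod_def)
  moreover have "v \<in> box (phi_inv l) (phi_inv u) \<longleftrightarrow> Re (fst l) < v$1 \<and> v$1 < Re (fst u) \<and> Im (fst l) < v$2 \<and>
      v$2 < Im (fst u) \<and> snd l < v$3 \<and> v$3 < snd u" for v
    by (auto simp: mem_box_cart forall_3 phi_inv_def)
  ultimately have pre: "phi -` box l u = box (phi_inv l) (phi_inv u)" by blast
  have le3: "phi_inv l $ i \<le> phi_inv u $ i" for i
    using le' exhaust_3[of i] by (auto simp: phi_inv_def)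
  have le3': "phi_inv l \<bullet> b \<le> phi_inv u \<bullet> b" if "b \<in> Basis" for b
    using that le3 by (auto simp: Basis_vec_def inner_axis)
  have "emeasure (distr lborel borel phi) (box l u) = emeasure lborel (box (phi_inv l) (phi_inv u))"
    by (simp add: emeasure_distr pre)
  also have "\<dots> = (\<Prod>b\<in>Basis. (phi_inv u - phi_inv l) \<bullet> b)"
    using le3' by (simp add: emeasure_lborel_box_eq)
  also have "(\<Prod>b\<in>Basis. (phi_inv u - phi_inv l) \<bullet> b) = (\<Prod>b\<in>Basis. (u - l) \<bullet> b)"
  proof -
    have "(\<Prod>b\<in>Basis. (phi_inv u - phi_inv l) \<bullet> b) = (\<Prod>i\<in>UNIV. (phi_inv u - phi_inv l) $ i)"
    proof -
      have B: "(Basis :: (real^3) set) = range (\<lambda>i. axis i 1)" by (auto simp: Basis_vec_def)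
      have "inj (\<lambda>i::3. axis i (1::real))" by (simp add: inj_on_def axis_eq_axis)
      then show ?thesis unfolding B by (subst prod.reindex) (simp_all add: inner_axis)
    qed
    also have "\<dots> = (Re (fst u) - Re (fst l)) * (Im (fst u) - Im (fst l)) * (snd u - snd l)"
      unfolding UNIV_3 by (simp add: phi_inv_def)
    also have "\<dots> = (\<Prod>b\<in>Basis. (u - l) \<bullet> b)"
      by (simp add: Basis_prod_def Basis_complex_def prod.union_disjoint inner_prod_def inner_complex_def)
    finally show ?thesis .
  qed
  finally show "emeasure (distr lborel borel phi) (box l u) = (\<Prod>b\<in>Basis. (u - l) \<bullet> b)" .
qed simp

text \<open>Bridges the extended nonnegative integral and absolute integrability by sending
  non-integrable functions to infinity, so that the change of variables also covers sets of infinite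
  volume.\<close>

lemma nn_integral_absolutely_integrable:
  fixes f :: "real^'n \<Rightarrow> real"
  assumes S: "S \<in> sets borel" and f: "f \<in> borel_measurable borel" and nn: "\<And>x. x \<in> S \<Longrightarrow> 0 \<le> f x"
  shows "(\<integral>\<^sup>+x\<in>S. ennreal (f x) \<partial>lborel) =
    (if f absolutely_integrable_on S then ennreal (integral S f) else \<infinity>)"
proof -
  have eq: "(\<integral>\<^sup>+x\<in>S. ennreal (f x) \<partial>lborel) = (\<integral>\<^sup>+x. ennreal (indicat_real S x *\<^sub>R f x) \<partial>lebesgue)"
    unfolding nn_integral_completion
    by (rule nn_integral_cong) (auto simp: indicator_def)
  have meas: "(\<lambda>x. indicat_real S x *\<^sub>R f x) \<in> borel_measurable lborel"
    using S f by (intro borel_measurable_scaleR borel_measurable_indicator) auto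
  have nn': "AE x in lebesgue. 0 \<le> indicat_real S x *\<^sub>R f x"
    using nn by (auto simp: indicator_def)
  show ?thesis
  proof (cases "f absolutely_integrable_on S")
    case True
    then have int: "integrable lebesgue (\<lambda>x. indicat_real S x *\<^sub>R f x)"
      by (simp add: set_integrable_def)
    have "integral S f = (\<integral>x. indicat_real S x *\<^sub>R f x \<partial>lebesgue)"
      using set_lebesgue_integral_eq_integral(2)[OF True] by (simp add: set_lebesgue_integral_def)
    then show ?thesis using True eq nn_integral_eq_integral[OF int nn'] by simp
  next
    case False
    have "(\<integral>\<^sup>+x. ennreal (indicat_real S x *\<^sub>R f x) \<partial>lebesgue) = \<infinity>"
    proof (rule ccontr)
      assume "\<not> ?thesis"
      then have "integrable lebesgue (\<lambda>x. indicat_real S x *\<^sub>R f x)"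
        using meas nn' by (intro integrableI_nonneg measurable_completion) (auto simp: top.not_eq_extremum)
      then show False using False by (simp add: set_integrable_def)
    qed
    then show ?thesis using False eq by simp
  qed
qed

text \<open>Condition \<open>k\<close> says that the measure with density \<open>f\<close> is
  invariant under \<open>g\<close>. Then \<open>f\<close> is integrable on both sets with the same
  value or on neither, and in the latter case both sides are infinite.\<close>

lemma nn_integral_change_of_variables:
  fixes f :: "real^'n::{finite,wellorder} \<Rightarrow> real" and g :: "real^'n::_ \<Rightarrow> real^'n::_"
  assumes S: "S \<in> sets borel" "g ` S \<in> sets borel"
    and der: "\<And>x. x \<in> S \<Longrightarrow> (g has_derivative g' x) (at x)"
    and inj: "inj_on g S"
    and f: "f \<in> borel_measurable borel"
    and nn: "\<And>x. x \<in> S \<Longrightarrow> 0 \<le> f x"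
    and k: "\<And>x. x \<in> S \<Longrightarrow> \<bar>det (matrix (g' x))\<bar> * f (g x) = f x"
    and nn': "\<And>x. x \<in> S \<Longrightarrow> 0 \<le> f (g x)"
  shows "(\<integral>\<^sup>+x\<in>g ` S. ennreal (f x) \<partial>lborel) = (\<integral>\<^sup>+x\<in>S. ennreal (f x) \<partial>lborel)"
proof -
  \<comment> \<open>Change of variables is formulated for vector-valued integrands; real functions
    enter through \<open>real^1\<close>.\<close>
  have vec: "(u absolutely_integrable_on T \<and> integral T u = b) \<longleftrightarrow>
     ((\<lambda>x. vec (u x) :: real^1) absolutely_integrable_on T \<and> integral T (\<lambda>x. vec (u x) :: real^1) = vec b)"
    for u :: "real^'n::_ \<Rightarrow> real" and T b
    using integral_on_1_eq[where S = T and f = "\<lambda>x. vec (u x) :: real^1"]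
      absolutely_integrable_on_1_iff[where S = T and f = "\<lambda>x. vec (u x) :: real^1"] by simp
  have S': "S \<in> sets lebesgue" using S by simp
  have "f absolutely_integrable_on (g ` S) \<and> integral (g ` S) f = b \<longleftrightarrow>
      f absolutely_integrable_on S \<and> integral S f = b" for b
  proof -
    have "(\<lambda>x. vec (f x) :: real^1) absolutely_integrable_on g ` S \<and> integral (g ` S) (\<lambda>x. vec (f x) :: real^1) = vec b \<longleftrightarrow>
      (\<lambda>x. \<bar>det (matrix (g' x))\<bar> *\<^sub>R (vec (f (g x)) :: real^1)) absolutely_integrable_on S \<and>
      integral S (\<lambda>x. \<bar>det (matrix (g' x))\<bar> *\<^sub>R (vec (f (g x)) :: real^1)) = vec b"
      using has_absolute_integral_change_of_variables[OF S' has_derivative_at_withinI[OF der] inj, of "\<lambda>x. vec (f x) :: real^1" "vec b"]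
      by simp
    also have "\<dots> \<longleftrightarrow> (\<lambda>x. vec (f x) :: real^1) absolutely_integrable_on S \<and> integral S (\<lambda>x. vec (f x) :: real^1) = vec b"
    proof -
      have eq: "\<bar>det (matrix (g' x))\<bar> *\<^sub>R (vec (f (g x)) :: real^1) = vec (f x)" if "x \<in> S" for x
        using k[OF that] by (simp add: vec_eq_iff)
      have "(\<lambda>x. \<bar>det (matrix (g' x))\<bar> *\<^sub>R (vec (f (g x)) :: real^1)) absolutely_integrable_on S \<longleftrightarrow>
          (\<lambda>x. vec (f x) :: real^1) absolutely_integrable_on S"
        by (rule set_integrable_cong[OF refl refl eq])
      moreover have "integral S (\<lambda>x. \<bar>det (matrix (g' x))\<bar> *\<^sub>R (vec (f (g x)) :: real^1)) =
          integral S (\<lambda>x. vec (f x) :: real^1)"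
        by (rule integral_cong[OF eq])
      ultimately show ?thesis by (simp only:)
    qed
    finally show ?thesis using vec by simp
  qed
  then have "f absolutely_integrable_on (g ` S) \<longleftrightarrow> f absolutely_integrable_on S"
    "f absolutely_integrable_on S \<Longrightarrow> integral (g ` S) f = integral S f"
    by blast+
  moreover have "0 \<le> f y" if "y \<in> g ` S" for y using that nn' by auto
  ultimately show ?thesis
    by (simp add: nn_integral_absolutely_integrable[OF S(1) f nn] nn_integral_absolutely_integrable[OF S(2) f])
qed


lemma continuous_on_act:
  assumes "det g = 1"
  shows "continuous_on H3 (act g)"
proof -
  have "(cmod (g$2$1 * fst p + g$2$2))\<^sup>2 + (cmod (g$2$1))\<^sup>2 * (snd p)\<^sup>2 \<noteq> 0" if "p \<in> H3" for p
    using act_denominator_pos[OF assms, of p] that by (simp add: H3_def)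
  then have "\<forall>p\<in>H3. (cmod (g$2$1 * fst p + g$2$2))\<^sup>2 + (cmod (g$2$1))\<^sup>2 * (snd p)\<^sup>2 \<noteq> 0"
    "\<forall>p\<in>H3. complex_of_real ((cmod (g$2$1 * fst p + g$2$2))\<^sup>2 + (cmod (g$2$1))\<^sup>2 * (snd p)\<^sup>2) \<noteq> 0"
    by (auto simp del: of_real_add)
  then show ?thesis
    unfolding act_def Let_def by (intro continuous_intros)
qed

lemma open_H3: "open H3"
proof -
  have "H3 = snd -` {0<..}" by (auto simp: H3_def)
  then show ?thesis by (metis open_vimage_snd open_greaterThan)
qed

lemma H3_borel [measurable]: "H3 \<in> sets borel"
  using open_H3 by simp

lemma act_image_eq:
  assumes "det g = 1" "E \<subseteq> H3"
  shows "act g ` E = {p \<in> H3. act (adj g) p \<in> E}"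
proof
  show "act g ` E \<subseteq> {p \<in> H3. act (adj g) p \<in> E}"
    using assms by (auto simp: act_in_H3 act_adj_cancel subset_iff)
  show "{p \<in> H3. act (adj g) p \<in> E} \<subseteq> act g ` E"
    using assms act_adj_cancel(2)[OF assms(1)] by (metis (mono_tags, lifting) imageI mem_Collect_eq subsetI)
qed

lemma act_image_borel:
  assumes "det g = 1" "E \<subseteq> H3" "E \<in> sets borel"
  shows "act g ` E \<in> sets borel"
proof -
  have "act (adj g) \<in> borel_measurable (restrict_space borel H3)"
    by (rule borel_measurable_continuous_on_restrict) (simp add: assms(1) continuous_on_act)
  from measurable_sets[OF this assms(3)]
  have "act (adj g) -` E \<inter> H3 \<in> sets (restrict_space borel H3)"
    by (simp add: space_restrict_space)
  then have "act (adj g) -` E \<inter> H3 \<in> sets borel"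
    by (subst (asm) sets_restrict_space_iff) auto
  moreover have "act g ` E = act (adj g) -` E \<inter> H3" using act_image_eq[OF assms(1,2)] by auto
  ultimately show ?thesis by simp
qed

lemma act_inj_on: "det g = 1 \<Longrightarrow> E \<subseteq> H3 \<Longrightarrow> inj_on (act g) E"
  by (metis (no_types, lifting) act_adj_cancel(1) inj_on_def subsetD)

lemma hypvol_phi:
  assumes "E \<in> sets borel"
  shows "hypvol E = (\<integral>\<^sup>+v\<in>phi_inv ` E. ennreal (1 / (v$3)^3) \<partial>lborel)"
proof -
  note im = phi_inv_image[of E]
  have [measurable]: "(snd :: hpoint \<Rightarrow> real) \<in> borel_measurable borel"
    by (intro borel_measurable_continuous_onI continuous_intros)
  note assms [measurable]
  have "hypvol E = (\<integral>\<^sup>+p. ennreal (1 / (snd p)^3) * indicator E p \<partial>distr lborel borel phi)"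
    by (simp add: hypvol_def distr_phi)
  also have "\<dots> = (\<integral>\<^sup>+v. ennreal (1 / (snd (phi v))^3) * indicator E (phi v) \<partial>lborel)"
    by (subst nn_integral_distr) auto
  also have "\<dots> = (\<integral>\<^sup>+v\<in>phi_inv ` E. ennreal (1 / (v$3)^3) \<partial>lborel)"
    unfolding im by (rule nn_integral_cong) (simp add: phi_def indicator_def)
  finally show ?thesis .
qed

lemma hypvol_act_of_jacobian:
  assumes g: "det g = 1" and E: "E \<in> sets borel" "E \<subseteq> H3"
    and der: "\<And>v. v$3 > 0 \<Longrightarrow> ((\<lambda>v. phi_inv (act g (phi v))) has_derivative G v) (at v)"
    and jac: "\<And>v. v$3 > 0 \<Longrightarrow> \<bar>det (matrix (G v))\<bar> * (v$3)^3 = (snd (act g (phi v)))^3"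
  shows "hypvol (act g ` E) = hypvol E"
proof -
  let ?T = "\<lambda>v. phi_inv (act g (phi v))"
  have im: "phi_inv ` act g ` E = ?T ` phi_inv ` E" by (simp add: image_image)
  have bor: "phi_inv ` A \<in> sets borel" if "A \<in> sets borel" for A
    using measurable_sets[OF borel_measurable_phi that] by (simp add: phi_inv_image)
  have H: "v$3 > 0" "phi v \<in> H3" if v: "v \<in> phi_inv ` E" for v
  proof -
    obtain p where "p \<in> H3" "v = phi_inv p" using v E by blast
    then show "v$3 > 0" "phi v \<in> H3" by (simp_all, simp add: phi_inv_def H3_def)
  qed
  have H': "?T v $ 3 = snd (act g (phi v))" "snd (act g (phi v)) > 0" if "v \<in> phi_inv ` E" for v
    using act_in_H3[OF g H(2)[OF that]] by (simp_all add: phi_inv_def H3_def)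
  have "(\<integral>\<^sup>+v\<in>?T ` phi_inv ` E. ennreal (1 / (v$3)^3) \<partial>lborel) =
        (\<integral>\<^sup>+v\<in>phi_inv ` E. ennreal (1 / (v$3)^3) \<partial>lborel)"
  proof (rule nn_integral_change_of_variables)
    show "phi_inv ` E \<in> sets borel" "?T ` phi_inv ` E \<in> sets borel"
      using bor act_image_borel[OF g E(2,1)] E(1) by (simp_all flip: im)
    show "inj_on ?T (phi_inv ` E)"
      using act_inj_on[OF g E(2)] phi_inv_phi by (auto simp: inj_on_def) (metis phi_inv_phi(2))
    show "(?T has_derivative G v) (at v)" if "v \<in> phi_inv ` E" for v
      using der H(1)[OF that] .
    show "\<bar>det (matrix (G v))\<bar> * (1 / (?T v $ 3)^3) = 1 / (v$3)^3" if "v \<in> phi_inv ` E" for v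
      using jac[OF H(1)[OF that]] H[OF that] H'[OF that] by (simp add: field_simps)
  qed (use H H' in \<open>auto simp: less_imp_le\<close>)
  then show ?thesis
    using hypvol_phi[OF E(1)] hypvol_phi[OF act_image_borel[OF g E(2,1)]] by (simp only: im)
qed

lemma has_derivative_vec_3:
  assumes "(a has_derivative a') F" "(b has_derivative b') F" "(c has_derivative c') F"
  shows "((\<lambda>v. vector [a v, b v, c v] :: real^3) has_derivative (\<lambda>h. vector [a' h, b' h, c' h])) F"
proof -
  have eq: "vector [x, y, z] = x *\<^sub>R axis 1 1 + y *\<^sub>R axis 2 1 + z *\<^sub>R (axis 3 1 :: real^3)" for x y z :: real
    by (auto simp: vec_eq_iff forall_3 axis_def)
  show ?thesis unfolding eq
    by (intro has_derivative_add has_derivative_scaleR_left assms)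
qed

lemma has_derivative_nth3: "((\<lambda>v::real^3. v $ i) has_derivative (\<lambda>h. h $ i)) F"
  by (rule bounded_linear.has_derivative[OF bounded_linear_vec_nth has_derivative_ident])

text \<open>The map is the Euclidean similarity z to a^2 z + a b, t to |a|^2 t, whose Jacobian |a|^6
  matches the change of the cubed height.\<close>

lemma hypvol_act_upper:
  assumes E: "E \<in> sets borel" "E \<subseteq> H3" and a: "a \<noteq> 0"
  shows "hypvol (act (mk a b 0 (1/a)) ` E) = hypvol E"
proof (rule hypvol_act_of_jacobian[OF _ E])
  show "det (mk a b 0 (1/a)) = 1" using a by (simp add: det_cmat)
  define u w r where "u = Re (a\<^sup>2)" "w = Im (a\<^sup>2)" "r = (cmod a)\<^sup>2"
  note uwr = this
  have r: "r > 0" using a by (simp add: uwr)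
  have ur: "u\<^sup>2 + w\<^sup>2 = r\<^sup>2"
    unfolding uwr by (metis cmod_power2 norm_power)
  have act: "act (mk a b 0 (1/a)) p = (a\<^sup>2 * fst p + a * b, r * snd p)" for p
  proof -
    have D: "(cmod (1/a))\<^sup>2 = 1 / r" by (simp add: uwr norm_divide power_divide)
    have "act (mk a b 0 (1/a)) p = ((a * fst p + b) * cnj (1/a) / complex_of_real ((cmod (1/a))\<^sup>2), snd p / (cmod (1/a))\<^sup>2)"
      by (simp add: act_def Let_def)
    moreover have "cnj (1/a) / complex_of_real (1/r) = a"
      using a by (simp add: uwr cmod_sq_complex field_simps power2_eq_square)
    then have "(a * fst p + b) * cnj (1/a) / complex_of_real (1/r) = (a * fst p + b) * a"
      by (metis times_divide_eq_right)
    ultimately show ?thesis unfolding D by (simp add: algebra_simps power2_eq_square)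
  qed
  have fn: "(\<lambda>v. phi_inv (act (mk a b 0 (1/a)) (phi v))) =
      (\<lambda>v. vector [u * v$1 - w * v$2 + Re (a*b), w * v$1 + u * v$2 + Im (a*b), r * v$3])"
    unfolding act by (simp add: phi_inv_def phi_def uwr fun_eq_iff algebra_simps)
  let ?G = "\<lambda>h::real^3. vector [u * h$1 - w * h$2, w * h$1 + u * h$2, r * h$3] :: real^3"
  show "((\<lambda>v. phi_inv (act (mk a b 0 (1/a)) (phi v))) has_derivative ?G) (at v)" for v
    unfolding fn
    by (rule has_derivative_vec_3) (auto intro!: derivative_eq_intros has_derivative_nth3)
  have "det (matrix ?G) = r * (u\<^sup>2 + w\<^sup>2)"
    by (simp add: det_3 matrix_def axis_def power2_eq_square algebra_simps)
  then have "\<bar>det (matrix ?G)\<bar> = r^3" using r ur by (simp add: power2_eq_square power3_eq_cube)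
  then show "\<bar>det (matrix ?G)\<bar> * (v$3)^3 = (snd (act (mk a b 0 (1/a)) (phi v)))^3" for v
    by (simp add: act phi_def power_mult_distrib)
qed

lemma hypvol_act_inversion:
  assumes E: "E \<in> sets borel" "E \<subseteq> H3"
  shows "hypvol (act (mk 0 (-1) 1 0) ` E) = hypvol E"
proof (rule hypvol_act_of_jacobian[OF _ E])
  show "det (mk 0 (-1) 1 0) = 1" by (simp add: det_cmat)
  define D where "D = (\<lambda>v::real^3. (v$1)\<^sup>2 + (v$2)\<^sup>2 + (v$3)\<^sup>2)"
  define D' where "D' = (\<lambda>v::real^3. \<lambda>h::real^3. 2 * v$1 * h$1 + 2 * v$2 * h$2 + 2 * v$3 * h$3)"
  have D: "D v > 0" if "v$3 > 0" for v using that by (simp add: D_def add_nonneg_pos)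
  have fn: "(\<lambda>v. phi_inv (act (mk 0 (-1) 1 0) (phi v))) =
      (\<lambda>v. vector [- (v$1 / D v), v$2 / D v, v$3 / D v])"
    by (simp add: act_def Let_def phi_inv_def phi_def D_def fun_eq_iff cmod_power2
        flip: of_real_power of_real_add)
  have dD: "(D has_derivative D' v) (at v)" for v
    unfolding D_def D'_def by (auto intro!: derivative_eq_intros has_derivative_nth3)
  let ?G = "\<lambda>v h::real^3. vector [- ((h$1 * D v - v$1 * D' v h) / (D v)\<^sup>2), (h$2 * D v - v$2 * D' v h) / (D v)\<^sup>2,
      (h$3 * D v - v$3 * D' v h) / (D v)\<^sup>2] :: real^3"
  show "((\<lambda>v. phi_inv (act (mk 0 (-1) 1 0) (phi v))) has_derivative ?G v) (at v)" if "v$3 > 0" for v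
    unfolding fn
  proof -
    have dq: "((\<lambda>v. v$i / D v) has_derivative (\<lambda>h. (h$i * D v - v$i * D' v h) / (D v)\<^sup>2)) (at v)" for i
      using D[OF that] by (auto intro!: derivative_eq_intros has_derivative_nth3 dD simp: power2_eq_square field_simps)
    show "((\<lambda>v. vector [- (v$1 / D v), v$2 / D v, v$3 / D v]) has_derivative ?G v) (at v)"
      by (rule has_derivative_vec_3[OF has_derivative_minus[OF dq] dq dq])
  qed
  show "\<bar>det (matrix (?G v))\<bar> * (v$3)^3 = (snd (act (mk 0 (-1) 1 0) (phi v)))^3" if "v$3 > 0" for v
  proof -
    define x y t d where "x = v$1" "y = v$2" "t = v$3" "d = D v"
    note xytd = this
    have d: "d > 0" "d = x\<^sup>2 + y\<^sup>2 + t\<^sup>2" using D[OF that] by (simp_all add: xytd D_def)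
    \<comment> \<open>Up to the sign of the first row, the derivative is the reflection matrix (d I
      - 2 v v^T) / d^2 of an inversion in the unit sphere, which has determinant of absolute value 1
      / d^3.\<close>
    have ent: "?G v (axis j 1) $ i = (if i = 1 then - 1 else 1) * ((if i = j then d else 0) - 2 * v$i * v$j) / d\<^sup>2" for i j
      using exhaust_3[of i] exhaust_3[of j] d(1) by (auto simp: axis_def D'_def xytd field_simps)
    have "det (matrix (?G v)) = (d^2 * (2 * (x\<^sup>2 + y\<^sup>2 + t\<^sup>2) - d)) / (d\<^sup>2)^3"
      unfolding det_3 matrix_def vec_lambda_beta ent using d(1)
      by (simp add: xytd[symmetric] divide_simps) (simp add: algebra_simps power2_eq_square power3_eq_cube)
    also have "2 * (x\<^sup>2 + y\<^sup>2 + t\<^sup>2) - d = d" using d(2) by simp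
    also have "d\<^sup>2 * d / (d\<^sup>2)^3 = 1 / d^3" using d(1) by (simp add: field_simps power2_eq_square power3_eq_cube)
    finally have "\<bar>det (matrix (?G v))\<bar> = 1 / d^3" using d(1) by simp
    moreover have "snd (act (mk 0 (-1) 1 0) (phi v)) = t / d"
      by (simp add: act_def Let_def phi_def xytd D_def cmod_power2)
    ultimately show ?thesis by (simp add: power_divide flip: xytd)
  qed
qed

text \<open>Bruhat decomposition: \<open>g\<close> is upper triangular, or a product of two upper
  triangular matrices with the inversion between them.\<close>

lemma hypvol_act:
  assumes g: "det g = 1" and E: "E \<in> sets borel" "E \<subseteq> H3"
  shows "hypvol (act g ` E) = hypvol E"
proof (cases "g$2$1 = 0")
  case True
  have "g$1$1 * g$2$2 = 1" using g True by (simp add: det_cmat)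
  then have nz: "g$1$1 \<noteq> 0" "g$2$2 = 1 / g$1$1" by (auto simp: eq_divide_eq mult.commute)
  then have "g = mk (g$1$1) (g$1$2) 0 (1 / g$1$1)"
    using True by (simp add: cmat_eq_iff)
  then show ?thesis using hypvol_act_upper[OF E nz(1)] by metis
next
  case False
  define a b c d where "a = g$1$1" "b = g$1$2" "c = g$2$1" "d = g$2$2"
  note abcd = this
  have det: "a * d - b * c = 1" and c: "c \<noteq> 0" using g False by (auto simp: det_cmat abcd)
  define U J V where "U = mk 1 (a/c) 0 (1/1)" "J = mk 0 (-1) 1 0" "V = mk c d 0 (1/c)"
  note UJV = this
  have dets: "det U = 1" "det J = 1" "det V = 1" "det (J ** V) = 1"
    using c by (simp_all add: UJV det_cmat)
  have g': "g = U ** (J ** V)"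
    using c det by (simp add: cmat_eq_iff UJV flip: abcd) (simp add: field_simps)
  have im: "act g ` E = act U ` act J ` act V ` E"
    unfolding g' image_image using E(2) dets
    by (intro image_cong refl) (simp add: act_mult act_in_H3 subsetD[OF E(2)])
  have b: "act V ` E \<in> sets borel" "act V ` E \<subseteq> H3" "act J ` act V ` E \<in> sets borel" "act J ` act V ` E \<subseteq> H3"
    using E dets by (auto intro!: act_image_borel act_in_H3)
  have "hypvol (act U ` act J ` act V ` E) = hypvol (act J ` act V ` E)"
    unfolding UJV(1) by (rule hypvol_act_upper[OF b(3,4)]) simp
  also have "\<dots> = hypvol (act V ` E)" unfolding UJV(2) by (rule hypvol_act_inversion[OF b(1,2)])
  also have "\<dots> = hypvol E" unfolding UJV(3) by (rule hypvol_act_upper[OF E c])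
  finally show ?thesis by (simp add: im)
qed

subsection \<open>Fundamental domains\<close>

lemma adj_uminus [simp]: "adj (- m) = - adj m"
  by (simp add: cmat_eq_iff)

text \<open>Both g and -g act in the same way, so summing over the whole group would count every
  translate twice.\<close>

lemma half_group_exists:
  assumes "SL2_preimage_group G"
  obtains P where "P \<subseteq> G" "\<And>g. g \<in> G \<Longrightarrow> g \<in> P \<or> - g \<in> P"
    "\<And>g h. g \<in> P \<Longrightarrow> h \<in> P \<Longrightarrow> g \<noteq> h \<Longrightarrow> h \<noteq> - g"
proof -
  \<comment> \<open>The choice depends only on the set \<open>{g, - g}\<close>, hence agrees for the
    two signs.\<close>
  define r :: "cmat \<Rightarrow> cmat" where "r g = (SOME x. x \<in> {g, - g})" for g
  have r: "r g \<in> {g, - g}" for g unfolding r_def by (rule someI_ex) auto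
  have rm: "r (- g) = r g" for g unfolding r_def by (simp add: insert_commute)
  have neg: "- g \<in> G" if "g \<in> G" for g
  proof -
    have "- mat 1 ** g \<in> G" using assms that by (auto simp: SL2_preimage_group_def)
    then show ?thesis by simp
  qed
  show thesis
  proof
    show "r ` G \<subseteq> G" using r neg by (metis empty_iff image_subsetI insert_iff)
    show "g \<in> r ` G \<or> - g \<in> r ` G" if "g \<in> G" for g
      using r[of g] that by (metis empty_iff image_eqI insert_iff)
    show "h \<noteq> - g" if "g \<in> r ` G" "h \<in> r ` G" "g \<noteq> h" for g h
    proof
      assume "h = - g"
      moreover have "r x = x" if "x \<in> r ` G" for x
        using that r rm by (metis (no_types, lifting) empty_iff image_iff insert_iff minus_equation_iff)
      ultimately show False using that rm by metis
    qed
  qed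
qed

text \<open>A set whose translates cover \<open>H3\<close> is at least as large as one whose translates are
  almost disjoint; both volume bounds for a fundamental domain are instances.\<close>
lemma hypvol_packing_le_covering:
  assumes G: "SL2_preimage_group G" "countable G"
    and E: "E1 \<in> sets borel" "E1 \<subseteq> H3" "E2 \<in> sets borel" "E2 \<subseteq> H3"
    and cover: "(\<Union>g\<in>G. act g ` E1) = H3"
    and pack: "\<And>g h. g \<in> G \<Longrightarrow> h \<in> G \<Longrightarrow> h \<noteq> g \<Longrightarrow> h \<noteq> - g \<Longrightarrow> act g ` E2 \<inter> act h ` E2 \<in> null_sets lborel"
  shows "hypvol E2 \<le> hypvol E1"
proof -
  obtain P where P: "P \<subseteq> G" "\<And>g. g \<in> G \<Longrightarrow> g \<in> P \<or> - g \<in> P"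
    "\<And>g h. g \<in> P \<Longrightarrow> h \<in> P \<Longrightarrow> g \<noteq> h \<Longrightarrow> h \<noteq> - g"
    using half_group_exists[OF G(1)] by metis
  have cP: "countable P" using P(1) G(2) countable_subset by blast
  have det: "det g = 1" "adj g \<in> G" if "g \<in> G" for g
    using G(1) that matrix_inv_eq_adj by (auto simp: SL2_preimage_group_def)
  have detP: "det g = 1" "adj g \<in> G" if "g \<in> P" for g using det P(1) that by auto
  have mono: "act g ` E2 \<inter> E1 \<in> sets borel" "E2 \<inter> act g ` E1 \<in> sets borel" if "det g = 1" for g
    using that E by (auto intro: act_image_borel)
  have [measurable]: "(snd :: hpoint \<Rightarrow> real) \<in> borel_measurable borel"
    by (intro borel_measurable_continuous_onI continuous_intros)
  define w where "w = (\<lambda>p::hpoint. ennreal (1 / (snd p)^3))"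
  have w [measurable]: "w \<in> borel_measurable borel" unfolding w_def by measurable
  have hv: "hypvol S = (\<integral>\<^sup>+p. w p * indicator S p \<partial>lborel)" for S
    by (simp add: hypvol_def w_def)
  have swap: "(\<integral>\<^sup>+p. (\<integral>\<^sup>+g. w p * indicator (S g) p \<partial>count_space P) \<partial>lborel) =
      (\<integral>\<^sup>+g. hypvol (S g) \<partial>count_space P)" if "\<And>g. g \<in> P \<Longrightarrow> S g \<in> sets borel" for S :: "cmat \<Rightarrow> hpoint set"
    unfolding hv
  proof (rule nn_integral_count_space_nn_integral[OF cP])
    fix g assume "g \<in> P"
    note that[OF this, measurable]
    show "(\<lambda>p. w p * indicator (S g) p) \<in> borel_measurable lborel" by measurable
  qed
  have ge: "u g \<le> (\<integral>\<^sup>+g. u g \<partial>count_space P)" if "g \<in> P" for g and u :: "cmat \<Rightarrow> ennreal"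
    using nn_integral_ge_point[OF that] .
  \<comment> \<open>Unfolding: \<open>E2\<close> is cut into its intersections with the translates
    of \<open>E1\<close>, each piece is moved back into \<open>E1\<close>, and the moved pieces
    overlap only in null sets because the translates of \<open>E2\<close> do.\<close>
  have "hypvol E2 \<le> (\<integral>\<^sup>+p. (\<integral>\<^sup>+g. w p * indicator (E2 \<inter> act g ` E1) p \<partial>count_space P) \<partial>lborel)"
    unfolding hv
  proof (rule nn_integral_mono)
    fix p :: hpoint
    show "w p * indicator E2 p \<le> (\<integral>\<^sup>+g. w p * indicator (E2 \<inter> act g ` E1) p \<partial>count_space P)"
    proof (cases "p \<in> E2")
      case True
      then obtain g where g: "g \<in> G" "p \<in> act g ` E1" using cover E(4) by blast
      have "act (- g) ` E1 = act g ` E1" by (simp add: image_def)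
      then obtain g' where "g' \<in> P" "p \<in> act g' ` E1" using P(2)[OF g(1)] g(2) by metis
      then show ?thesis using ge[of g' "\<lambda>g. w p * indicator (E2 \<inter> act g ` E1) p"] True by simp
    qed simp
  qed
  also have "\<dots> = (\<integral>\<^sup>+g. hypvol (E2 \<inter> act g ` E1) \<partial>count_space P)"
    by (rule swap) (use detP mono in blast)
  also have "\<dots> = (\<integral>\<^sup>+g. hypvol (act (adj g) ` E2 \<inter> E1) \<partial>count_space P)"
  proof (rule nn_integral_cong)
    fix g assume "g \<in> space (count_space P)"
    then have g: "g \<in> P" by simp
    have inj: "inj_on (act (adj g)) H3" using act_inj_on detP[OF g] by simp
    have "act g ` E1 \<subseteq> H3" using act_in_H3 detP[OF g] E(2) by auto
    then have "act (adj g) ` (E2 \<inter> act g ` E1) = act (adj g) ` E2 \<inter> act (adj g) ` act g ` E1"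
      using inj_on_image_Int[OF inj E(4)] by simp
    also have "act (adj g) ` act g ` E1 = E1"
      using act_adj_cancel(1)[OF detP(1)[OF g]] E(2) by (force simp: image_image)
    finally show "hypvol (E2 \<inter> act g ` E1) = hypvol (act (adj g) ` E2 \<inter> E1)"
      using hypvol_act[of "adj g" "E2 \<inter> act g ` E1"] detP[OF g] mono(2) E(4) by (simp add: le_infI1)
  qed
  also have "\<dots> = (\<integral>\<^sup>+p. (\<integral>\<^sup>+g. w p * indicator (act (adj g) ` E2 \<inter> E1) p \<partial>count_space P) \<partial>lborel)"
    by (rule swap[symmetric]) (use detP mono in \<open>metis det_adj\<close>)
  also have "\<dots> \<le> hypvol E1"
    unfolding hv
  proof (rule nn_integral_mono_AE)
    have "AE p in lborel. p \<notin> act (adj g) ` E2 \<inter> act (adj h) ` E2" if "g \<in> P" "h \<in> P" "g \<noteq> h" for g h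
    proof (rule AE_not_in, rule pack)
      have "h \<noteq> - g" using P(3) that by blast
      then show "adj h \<noteq> adj g" "adj h \<noteq> - adj g"
        using that adj_uminus by (metis adj_adj)+
    qed (use detP that in auto)
    then have "AE p in lborel. \<forall>g\<in>P. \<forall>h\<in>P. g \<noteq> h \<longrightarrow> p \<notin> act (adj g) ` E2 \<inter> act (adj h) ` E2"
      by (auto simp: AE_ball_countable[OF cP])
    then show "AE p in lborel. (\<integral>\<^sup>+g. w p * indicator (act (adj g) ` E2 \<inter> E1) p \<partial>count_space P) \<le> w p * indicator E1 p"
    proof (rule AE_mp, intro AE_I2 impI)
      fix p :: hpoint
      assume un: "\<forall>g\<in>P. \<forall>h\<in>P. g \<noteq> h \<longrightarrow> p \<notin> act (adj g) ` E2 \<inter> act (adj h) ` E2"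
      show "(\<integral>\<^sup>+g. w p * indicator (act (adj g) ` E2 \<inter> E1) p \<partial>count_space P) \<le> w p * indicator E1 p"
      proof (cases "\<exists>g\<in>P. p \<in> act (adj g) ` E2 \<inter> E1")
        case True
        then obtain g where g: "g \<in> P" "p \<in> act (adj g) ` E2 \<inter> E1" by blast
        have "(\<integral>\<^sup>+x. w p * indicator (act (adj x) ` E2 \<inter> E1) p \<partial>count_space P) =
            (\<integral>\<^sup>+x. w p * indicator {g} x \<partial>count_space P)"
          using un g by (intro nn_integral_cong) (auto simp: indicator_def)
        also have "\<dots> = w p"
          using g by (subst nn_integral_cmult_indicator) (auto simp: emeasure_count_space)
        finally show ?thesis using g by simp
      next
        case False
        then have "(\<integral>\<^sup>+x. w p * indicator (act (adj x) ` E2 \<inter> E1) p \<partial>count_space P) = (\<integral>\<^sup>+x. 0 \<partial>count_space P)"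
          by (intro nn_integral_cong) (auto simp: indicator_def)
        then show ?thesis by simp
      qed
    qed
  qed
  finally show ?thesis .
qed

text \<open>Every nontrivial element moves every point by at least \<open>arcosh \<kappa>\<close>.\<close>
definition displaces :: "cmat set \<Rightarrow> real \<Rightarrow> bool" where
  "displaces G \<kappa> \<longleftrightarrow> \<kappa> > 1 \<and> (\<forall>g\<in>G. nontrivial_elt g \<longrightarrow> (\<forall>p\<in>H3. ch p (act g p) \<ge> \<kappa>))"

lemma displaced_translates_disjoint:
  assumes G: "SL2_preimage_group G" and k: "displaces G \<kappa>"
    and B: "B \<subseteq> H3" "\<And>p q. p \<in> B \<Longrightarrow> q \<in> B \<Longrightarrow> ch p q < \<kappa>"
    and g: "g \<in> G" "h \<in> G" "h \<noteq> g" "h \<noteq> - g"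
  shows "act g ` B \<inter> act h ` B = {}"
proof (rule ccontr)
  assume "\<not> ?thesis"
  then obtain p q where pq: "p \<in> B" "q \<in> B" "act g p = act h q" by blast
  have det: "det g = 1" "det h = 1" using G g by (auto simp: SL2_preimage_group_def)
  have G': "adj h ** g \<in> G" using G g matrix_inv_eq_adj[OF det(2)] by (metis SL2_preimage_group_def)
  have "h ** (adj h ** g) = g" using det by (simp add: matrix_mul_assoc mult_adj)
  then have "nontrivial_elt (adj h ** g)"
    using g by (auto simp: nontrivial_elt_def)
  moreover have "q = act (adj h ** g) p"
    using pq det B(1) act_adj_cancel(1)[OF det(2)] by (metis act_mult det_adj subsetD)
  ultimately have "ch p q \<ge> \<kappa>" using k G' pq(1) B(1) by (auto simp: displaces_def)
  then show False using B(2)[OF pq(1,2)] by simp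
qed

text \<open>Cover \<open>H3\<close> by countably many open sets of diameter below the displacement;
  the translates of each are disjoint. Removing from every set all translates of the earlier ones
  leaves one point per orbit.\<close>

lemma fund_domain_exists:
  assumes G: "SL2_preimage_group G" "countable G" and k: "displaces G \<kappa>"
  shows "\<exists>F. fund_domain G F"
proof -
  let ?C = "{U. open U \<and> U \<subseteq> H3 \<and> (\<forall>p\<in>U. \<forall>q\<in>U. ch p q < \<kappa>)}"
  have "\<exists>U\<in>?C. x \<in> U" if x: "x \<in> H3" for x
  proof -
    have cont: "continuous_on (H3 \<times> H3) (\<lambda>(p, q). ch p q)"
      unfolding ch_def split_def by (intro continuous_intros) (auto simp: H3_def)
    have op: "open (H3 \<times> H3)" using open_H3 by (simp add: open_Times)
    have "open ((\<lambda>(p, q). ch p q) -` {..<\<kappa>} \<inter> (H3 \<times> H3))"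
      by (rule continuous_on_open_vimage[OF op, THEN iffD1, OF cont, rule_format, OF open_lessThan])
    moreover have "(x, x) \<in> (\<lambda>(p, q). ch p q) -` {..<\<kappa>} \<inter> (H3 \<times> H3)"
      using x k by (simp add: ch_def displaces_def)
    ultimately obtain A B where AB: "open A" "open B" "(x, x) \<in> A \<times> B" "A \<times> B \<subseteq> (\<lambda>(p, q). ch p q) -` {..<\<kappa>} \<inter> (H3 \<times> H3)"
      by (rule open_prod_elim)
    then have "A \<inter> B \<in> ?C" "x \<in> A \<inter> B" by auto
    then show ?thesis by blast
  qed
  then have UC: "\<Union>?C = H3" by auto
  obtain C where C: "C \<subseteq> ?C" "countable C" "\<Union>C = H3"
    using Lindelof[of ?C] UC by (metis (no_types, lifting) mem_Collect_eq)
  have "(0, 1) \<in> H3" by (simp add: H3_def)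
  then have "C \<noteq> {}" using C(3) by auto
  then obtain U :: "nat \<Rightarrow> hpoint set" where U: "range U = C" using C(2) by (metis range_from_nat_into)
  have Ui: "open (U n)" "U n \<subseteq> H3" "\<And>p q. p \<in> U n \<Longrightarrow> q \<in> U n \<Longrightarrow> ch p q < \<kappa>" for n
    using U C(1) by (blast)+
  have Uc: "\<Union>(range U) = H3" using U C by simp
  define T where "T n = (\<Union>g\<in>G. act g ` U n)" for n
  define F where "F = (\<Union>n. U n - (\<Union>m<n. T m))"
  have det: "det g = 1" "adj g \<in> G" if "g \<in> G" for g
    using G(1) that matrix_inv_eq_adj by (auto simp: SL2_preimage_group_def)
  have T_act: "act g p \<in> T n" if "g \<in> G" "p \<in> T n" for g p n
  proof -
    obtain h q where h: "h \<in> G" "q \<in> U n" "p = act h q" using \<open>p \<in> T n\<close> by (auto simp: T_def)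
    then have "act g p = act (g ** h) q" using act_mult[OF det(1) det(1)] Ui(2) that by (metis subsetD)
    moreover have "g ** h \<in> G" using G that h by (simp add: SL2_preimage_group_def)
    ultimately show ?thesis using h by (auto simp: T_def)
  qed
  have U_T: "U n \<subseteq> T n" for n
    using G by (auto simp: T_def SL2_preimage_group_def intro!: bexI[of _ "mat 1"])
  have "T n \<in> sets borel" for n
    unfolding T_def using G(2) det Ui(1,2) by (intro sets.countable_UN'' act_image_borel) auto
  then have Fb: "F \<in> sets borel" using Ui(1) by (auto simp: F_def)
  have FH: "F \<subseteq> H3" using Ui(2) by (auto simp: F_def)
  have "p \<in> (\<Union>g\<in>G. act g ` F)" if p: "p \<in> H3" for p
  proof -
    have "\<exists>n. p \<in> T n" using Uc U_T p by blast
    then obtain n where n: "p \<in> T n" "\<And>m. m < n \<Longrightarrow> p \<notin> T m"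
      using exists_least_iff[of "\<lambda>n. p \<in> T n"] by blast
    then obtain g q where g: "g \<in> G" "q \<in> U n" "p = act g q" by (auto simp: T_def)
    have "q \<notin> T m" if "m < n" for m using T_act[OF g(1)] n(2)[OF that] g(3) by blast
    then have "q \<in> F" using g by (auto simp: F_def)
    then show ?thesis using g by blast
  qed
  moreover have "act g ` F \<subseteq> H3" if "g \<in> G" for g using act_in_H3 det[OF that] FH by auto
  ultimately have cover: "(\<Union>g\<in>G. act g ` F) = H3" by blast
  have disj: "act g ` F \<inter> act h ` F = {}" if g: "g \<in> G" "h \<in> G" "h \<noteq> g" "h \<noteq> - g" for g h
  proof (rule ccontr)
    assume "\<not> ?thesis"
    then obtain p q where pq: "p \<in> F" "q \<in> F" "act g p = act h q" by blast
    obtain n m where nm: "p \<in> U n" "\<And>i. i < n \<Longrightarrow> p \<notin> T i" "q \<in> U m" "\<And>i. i < m \<Longrightarrow> q \<notin> T i"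
      using pq by (auto simp: F_def)
    have "q = act (adj h) (act g p)" using pq act_adj_cancel(1)[OF det(1)[OF g(2)]] FH by (metis subsetD)
    then have 1: "q \<in> T n" using T_act U_T nm(1) g det by (meson subsetD)
    have "p = act (adj g) (act h q)" using pq act_adj_cancel(1)[OF det(1)[OF g(1)]] FH by (metis subsetD)
    then have 2: "p \<in> T m" using T_act U_T nm(3) g det by (meson subsetD)
    have "n = m" using 1 2 nm by (metis linorder_neqE_nat)
    moreover have "act g ` U n \<inter> act h ` U n = {}"
      by (rule displaced_translates_disjoint[OF G(1) k Ui(2) _ g]) (rule Ui(3))
    ultimately show False using nm(1,3) pq(3) by blast
  qed
  show ?thesis
    using Fb FH cover disj by (intro exI[of _ F]) (simp add: fund_domain_def)
qed

text \<open>Since \<open>vol\<close> takes the volume of some fundamental domain by choice,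
  existence of a domain is required first; afterwards the comparison of packings with coverings
  applies to whichever domain was chosen.\<close>

lemma vol_bounds:
  assumes G: "SL2_preimage_group G" "countable G" and k: "displaces G \<kappa>"
    and K: "K \<in> sets borel" "K \<subseteq> H3" "(\<Union>g\<in>G. act g ` K) = H3" "hypvol K < \<infinity>"
  shows "ennreal (vol G) \<le> hypvol K"
    and "\<And>B. B \<in> sets borel \<Longrightarrow> B \<subseteq> H3 \<Longrightarrow> (\<And>p q. p \<in> B \<Longrightarrow> q \<in> B \<Longrightarrow> ch p q < \<kappa>) \<Longrightarrow> hypvol B \<le> ennreal (vol G)"
proof -
  have "\<exists>F. fund_domain G F \<and> (SOME v. \<exists>F. fund_domain G F \<and> v = hypvol F) = hypvol F"
    by (rule someI_ex) (use fund_domain_exists[OF G k] in blast)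
  then obtain F where F: "fund_domain G F" "vol G = enn2real (hypvol F)"
    unfolding vol_def by auto
  have Fb: "F \<in> sets borel" "F \<subseteq> H3" "(\<Union>g\<in>G. act g ` F) = H3"
    "\<And>g h. g \<in> G \<Longrightarrow> h \<in> G \<Longrightarrow> h \<noteq> g \<Longrightarrow> h \<noteq> - g \<Longrightarrow> act g ` F \<inter> act h ` F \<in> null_sets lborel"
    using F(1) by (auto simp: fund_domain_def)
  have le: "hypvol F \<le> hypvol K"
    by (rule hypvol_packing_le_covering[OF G K(1,2) Fb(1,2) K(3) Fb(4)])
  \<comment> \<open>Finiteness matters here, because \<open>enn2real\<close> sends infinity to
    0.\<close>
  then have eq: "ennreal (vol G) = hypvol F" using K(4) F(2) by (simp add: ennreal_enn2real_if)
  then show "ennreal (vol G) \<le> hypvol K" using le by simp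
  show "hypvol B \<le> ennreal (vol G)"
    if B: "B \<in> sets borel" "B \<subseteq> H3" "\<And>p q. p \<in> B \<Longrightarrow> q \<in> B \<Longrightarrow> ch p q < \<kappa>" for B
    unfolding eq
    by (rule hypvol_packing_le_covering[OF G Fb(1,2) B(1,2) Fb(3)])
      (simp add: displaced_translates_disjoint[OF G(1) k B(2,3)])
qed

subsection \<open>Gaussian integers\<close>

definition Zi :: "complex set" where
  "Zi = {z. Re z \<in> \<int> \<and> Im z \<in> \<int>}"

lemma Zi_closed [simp, intro]:
  "0 \<in> Zi" "1 \<in> Zi" "\<i> \<in> Zi" "x \<in> Zi \<Longrightarrow> - x \<in> Zi" "numeral n \<in> Zi" "of_int k \<in> Zi"
  "x \<in> Zi \<Longrightarrow> y \<in> Zi \<Longrightarrow> x + y \<in> Zi" "x \<in> Zi \<Longrightarrow> y \<in> Zi \<Longrightarrow> x - y \<in> Zi"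
  "x \<in> Zi \<Longrightarrow> y \<in> Zi \<Longrightarrow> x * y \<in> Zi" "x \<in> Zi \<Longrightarrow> x ^ m \<in> Zi"
proof -
  show mult: "x \<in> Zi \<Longrightarrow> y \<in> Zi \<Longrightarrow> x * y \<in> Zi" for x y by (simp add: Zi_def)
  show "x \<in> Zi \<Longrightarrow> x ^ m \<in> Zi"
    by (induction m) (auto simp: mult Zi_def)
qed (auto simp: Zi_def)

lemma ZiE:
  assumes "z \<in> Zi"
  obtains p q where "z = Complex (of_int p) (of_int q)"
  using assms by (auto simp: Zi_def complex_eq_iff elim!: Ints_cases)

lemma Complex_Zi [simp]: "Complex (of_int p) (of_int q) \<in> Zi"
  by (simp add: Zi_def)

lemma norm_sq_Zi:
  assumes "z \<in> Zi"
  obtains n :: nat where "(cmod z)\<^sup>2 = real n"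
proof -
  obtain p q where z: "z = Complex (of_int p) (of_int q)" using assms by (rule ZiE)
  have "(cmod z)\<^sup>2 = real (nat (p\<^sup>2 + q\<^sup>2))" by (simp add: z cmod_power2)
  then show thesis by (rule that)
qed

lemma Zi_norm_sq_cases:
  assumes "z \<in> Zi"
  shows "z = 0 \<or> cmod z = 1 \<or> (cmod z)\<^sup>2 \<ge> 2"
proof -
  obtain n :: nat where n: "(cmod z)\<^sup>2 = real n" using assms by (rule norm_sq_Zi)
  consider "n = 0" | "n = 1" | "n \<ge> 2" by linarith
  then show ?thesis
  proof cases
    case 2
    then have "cmod z = 1" using n by (metis norm_ge_zero of_nat_1 power2_eq_1_iff abs_of_nonneg abs_1 real_sqrt_abs real_sqrt_one)
    then show ?thesis by simp
  qed (use n in auto)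
qed

lemma Zi_norm_ge_1: "z \<in> Zi \<Longrightarrow> z \<noteq> 0 \<Longrightarrow> cmod z \<ge> 1"
  using Zi_norm_sq_cases[of z] abs_le_square_iff[of 1 "cmod z"] by auto

lemma Zi_unit_cases:
  assumes "z \<in> Zi" "cmod z = 1"
  shows "z = 1 \<or> z = -1 \<or> z = \<i> \<or> z = -\<i>"
proof -
  obtain p q where z: "z = Complex (of_int p) (of_int q)" using assms(1) by (rule ZiE)
  have "(cmod z)\<^sup>2 = of_int (p\<^sup>2 + q\<^sup>2)" by (simp add: z cmod_power2)
  then have e: "p\<^sup>2 + q\<^sup>2 = 1" using assms(2) by (metis of_int_eq_1_iff one_power2)
  have "\<bar>p\<bar> \<le> 1" "\<bar>q\<bar> \<le> 1"
    using e abs_le_square_iff[of p 1] abs_le_square_iff[of q 1] zero_le_power2[of p] zero_le_power2[of q] by auto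
  then have "p \<in> {-1, 0, 1}" "q \<in> {-1, 0, 1}" by auto
  then show ?thesis using e by (auto simp: z complex_eq_iff)
qed

lemma finite_Zi_ball: "finite {z \<in> Zi. cmod z \<le> r}"
proof -
  let ?I = "{- \<lceil>\<bar>r\<bar>\<rceil> .. \<lceil>\<bar>r\<bar>\<rceil>}"
  have "{z \<in> Zi. cmod z \<le> r} \<subseteq> (\<lambda>(p, q). Complex (of_int p) (of_int q)) ` (?I \<times> ?I)"
  proof
    fix z assume "z \<in> {z \<in> Zi. cmod z \<le> r}"
    then have "z \<in> Zi" "cmod z \<le> r" by auto
    moreover obtain p q where z: "z = Complex (of_int p) (of_int q)" using \<open>z \<in> Zi\<close> by (rule ZiE)
    moreover have "\<bar>of_int p\<bar> \<le> cmod z" "\<bar>of_int q\<bar> \<le> cmod z"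
      using abs_Re_le_cmod[of z] abs_Im_le_cmod[of z] z by auto
    ultimately have "\<bar>real_of_int p\<bar> \<le> \<bar>r\<bar>" "\<bar>real_of_int q\<bar> \<le> \<bar>r\<bar>" by linarith+
    then have "p \<in> ?I" "q \<in> ?I" by (simp_all, linarith+)
    then show "z \<in> (\<lambda>(p, q). Complex (of_int p) (of_int q)) ` (?I \<times> ?I)" using z by auto
  qed
  then show ?thesis by (rule finite_subset) auto
qed

text \<open>Reduction modulo the prime \<open>2 - \<i>\<close> above 5, which sends \<open>\<i>\<close> to 2.\<close>
definition red5 :: "complex \<Rightarrow> int" where
  "red5 z = (\<lfloor>Re z\<rfloor> + 2 * \<lfloor>Im z\<rfloor>) mod 5"

lemma red5_Complex: "red5 (Complex (of_int p) (of_int q)) = (p + 2 * q) mod 5"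
  by (simp add: red5_def)

lemma red5_add: "x \<in> Zi \<Longrightarrow> y \<in> Zi \<Longrightarrow> red5 (x + y) = (red5 x + red5 y) mod 5"
proof (elim ZiE)
  fix p q p' q' assume "x = Complex (of_int p) (of_int q)" "y = Complex (of_int p') (of_int q')"
  then have "x + y = Complex (of_int (p + p')) (of_int (q + q'))" by (simp add: complex_eq_iff)
  then show ?thesis using \<open>x = _\<close> \<open>y = _\<close> by (simp only: red5_Complex mod_add_eq) (simp add: algebra_simps)
qed

lemma red5_mult: "x \<in> Zi \<Longrightarrow> y \<in> Zi \<Longrightarrow> red5 (x * y) = (red5 x * red5 y) mod 5"
proof (elim ZiE)
  fix p q p' q' assume xy: "x = Complex (of_int p) (of_int q)" "y = Complex (of_int p') (of_int q')"
  then have "x * y = Complex (of_int (p * p' - q * q')) (of_int (p * q' + q * p'))"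
    by (simp add: complex_eq_iff)
  moreover have "(p + 2 * q) * (p' + 2 * q') = (p * p' - q * q' + 2 * (p * q' + q * p')) + q * q' * 5"
    by (simp add: algebra_simps)
  ultimately show ?thesis unfolding xy by (simp only: red5_Complex mod_mult_eq mod_mult_self1)
qed

lemma red5_const: "red5 (- (8)) = 2" "red5 (2 - \<i>) = 0" "red5 (4 * (2 + \<i>)) = 1"
proof -
  have "- 8 = Complex (of_int (- 8)) (of_int 0)" "2 - \<i> = Complex (of_int 2) (of_int (- 1))"
    "4 * (2 + \<i>) = Complex (of_int 8) (of_int 4)" by (simp_all add: complex_eq_iff)
  then show "red5 (- (8)) = 2" "red5 (2 - \<i>) = 0" "red5 (4 * (2 + \<i>)) = 1"
    by (simp_all only: red5_Complex) simp_all
qed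

lemma red5_range: "red5 z \<in> {0, 1, 2, 3, 4}"
proof -
  have "0 \<le> red5 z" "red5 z < 5" unfolding red5_def by simp_all
  then show ?thesis by auto
qed

lemma red5_zeroD:
  assumes "z \<in> Zi" "red5 z = 0"
  obtains w where "w \<in> Zi" "z = (2 - \<i>) * w"
proof -
  obtain p q where z: "z = Complex (of_int p) (of_int q)" using assms(1) by (rule ZiE)
  have "5 dvd p + 2 * q" using assms(2) by (simp add: z red5_Complex dvd_eq_mod_eq_0)
  then obtain k where k: "p = 5 * k - 2 * q" by (metis dvd_def add_diff_cancel_right')
  have "z = (2 - \<i>) * Complex (of_int (2 * k - q)) (of_int k)"
    by (simp add: z complex_eq_iff k)
  moreover have "Complex (of_int (2 * k - q)) (of_int k) \<in> Zi" by (rule Complex_Zi)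
  ultimately show thesis by (rule that[rotated])
qed

text \<open>8 is congruent to 3, which is not a square modulo 5, so x^2 = 8 y^2 has only the zero
  solution there. The proof runs through all residues.\<close>

lemma binary_form_anisotropic_mod_5:
  assumes "x \<in> Zi" "y \<in> Zi" "red5 (x\<^sup>2 + (- (8)) * y\<^sup>2) = 0"
  shows "red5 x = 0 \<and> red5 y = 0"
proof -
  have "- (8::complex) \<in> Zi" by (intro Zi_closed)
  then have "red5 (x * x + (- (8)) * (y * y)) = ((red5 x * red5 x) mod 5 + (2 * ((red5 y * red5 y) mod 5)) mod 5) mod 5"
    using assms(1,2) by (simp only: red5_add red5_mult red5_const Zi_closed)
  then have "((red5 x * red5 x) mod 5 + (2 * ((red5 y * red5 y) mod 5)) mod 5) mod 5 = 0"
    using assms(3) by (simp add: power2_eq_square)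
  then show ?thesis using red5_range[of x] red5_range[of y] by auto
qed

text \<open>Infinite descent at the prime p = 2 - i. The form is N(x0, x1) - 20 N(x2, x3) with N(x,
  y) = x^2 - 8 y^2, and 20 = 4 (2 + i) p contains p exactly once. So p divides x0 and x1, then x2
  and x3, and dividing it out lowers the sum of squared moduli by the factor 5.\<close>

lemma quaternary_form_anisotropic:
  assumes "x0 \<in> Zi" "x1 \<in> Zi" "x2 \<in> Zi" "x3 \<in> Zi"
    and "x0\<^sup>2 - 8 * x1\<^sup>2 - 20 * x2\<^sup>2 + 160 * x3\<^sup>2 = 0"
  shows "x0 = 0 \<and> x1 = 0 \<and> x2 = 0 \<and> x3 = 0"
proof -
  obtain n0 :: nat where "(cmod x0)\<^sup>2 = real n0" using assms(1) by (rule norm_sq_Zi)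
  obtain n1 :: nat where "(cmod x1)\<^sup>2 = real n1" using assms(2) by (rule norm_sq_Zi)
  obtain n2 :: nat where "(cmod x2)\<^sup>2 = real n2" using assms(3) by (rule norm_sq_Zi)
  obtain n3 :: nat where "(cmod x3)\<^sup>2 = real n3" using assms(4) by (rule norm_sq_Zi)
  have "\<exists>n::nat. (cmod x0)\<^sup>2 + (cmod x1)\<^sup>2 + (cmod x2)\<^sup>2 + (cmod x3)\<^sup>2 = real n"
    by (rule exI[of _ "n0 + n1 + n2 + n3"]) (simp add: \<open>(cmod x0)\<^sup>2 = _\<close> \<open>(cmod x1)\<^sup>2 = _\<close> \<open>(cmod x2)\<^sup>2 = _\<close> \<open>(cmod x3)\<^sup>2 = _\<close>)
  then obtain n :: nat where "(cmod x0)\<^sup>2 + (cmod x1)\<^sup>2 + (cmod x2)\<^sup>2 + (cmod x3)\<^sup>2 = real n" by blast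
  then show ?thesis using assms
  proof (induction n arbitrary: x0 x1 x2 x3 rule: less_induct)
    case (less n)
    note Z = less.prems(2-5)
    let ?p = "2 - \<i>"
    have pp: "?p * (2 + \<i>) = 5" by (simp add: algebra_simps)
    have pn: "(cmod ?p)\<^sup>2 = 5" by (simp add: cmod_power2)
    have p0: "?p \<noteq> 0" by (simp add: complex_eq_iff)
    have e1: "x0\<^sup>2 + (- (8)) * x1\<^sup>2 = ?p * (4 * (2 + \<i>) * (x2\<^sup>2 + (- (8)) * x3\<^sup>2))"
      using less.prems(6) pp by algebra
    have mem: "x2\<^sup>2 + (- (8)) * x3\<^sup>2 \<in> Zi" "?p \<in> Zi" "4 * (2 + \<i>) \<in> Zi"
      by (intro Zi_closed Z)+
    have "red5 (x0\<^sup>2 + (- (8)) * x1\<^sup>2) = 0"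
      unfolding e1 using red5_mult[OF mem(2), of "4 * (2 + \<i>) * (x2\<^sup>2 + (- (8)) * x3\<^sup>2)"] mem
      by (simp add: red5_const)
    from binary_form_anisotropic_mod_5[OF Z(1,2) this]
    obtain w0 w1 where w01: "w0 \<in> Zi" "x0 = ?p * w0" "w1 \<in> Zi" "x1 = ?p * w1"
      using red5_zeroD Z(1,2) by metis
    have "?p * (?p * (w0\<^sup>2 + (- (8)) * w1\<^sup>2)) = ?p * (4 * (2 + \<i>) * (x2\<^sup>2 + (- (8)) * x3\<^sup>2))"
      using e1 unfolding w01 by algebra
    then have e2: "?p * (w0\<^sup>2 + (- (8)) * w1\<^sup>2) = 4 * (2 + \<i>) * (x2\<^sup>2 + (- (8)) * x3\<^sup>2)"
      using p0 by (metis mult_left_cancel)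
    have "w0\<^sup>2 + (- (8)) * w1\<^sup>2 \<in> Zi" by (intro Zi_closed w01)
    then have "red5 (4 * (2 + \<i>) * (x2\<^sup>2 + (- (8)) * x3\<^sup>2)) = 0"
      unfolding e2[symmetric] by (simp only: red5_mult mem red5_const) simp
    then have "red5 (x2\<^sup>2 + (- (8)) * x3\<^sup>2) = 0"
      using red5_mult[OF mem(3,1)] red5_range[of "x2\<^sup>2 + (- (8)) * x3\<^sup>2"] red5_const(3) by auto
    from binary_form_anisotropic_mod_5[OF Z(3,4) this]
    obtain w2 w3 where w23: "w2 \<in> Zi" "x2 = ?p * w2" "w3 \<in> Zi" "x3 = ?p * w3"
      using red5_zeroD Z(3,4) by metis
    have N: "real n = 5 * ((cmod w0)\<^sup>2 + (cmod w1)\<^sup>2 + (cmod w2)\<^sup>2 + (cmod w3)\<^sup>2)"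
      using less.prems(1) by (simp add: w01 w23 norm_mult power_mult_distrib pn)
    show ?case
    proof (cases "n = 0")
      case True
      then have "(cmod w0)\<^sup>2 + (cmod w1)\<^sup>2 + (cmod w2)\<^sup>2 + (cmod w3)\<^sup>2 = 0" using N by simp
      then have "w0 = 0 \<and> w1 = 0 \<and> w2 = 0 \<and> w3 = 0"
        by (simp add: add_nonneg_eq_0_iff)
      then show ?thesis by (simp add: w01 w23)
    next
      case False
      obtain n0 :: nat where n0: "(cmod w0)\<^sup>2 = real n0" using w01(1) by (rule norm_sq_Zi)
      obtain n1 :: nat where n1: "(cmod w1)\<^sup>2 = real n1" using w01(3) by (rule norm_sq_Zi)
      obtain n2 :: nat where n2: "(cmod w2)\<^sup>2 = real n2" using w23(1) by (rule norm_sq_Zi)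
      obtain n3 :: nat where n3: "(cmod w3)\<^sup>2 = real n3" using w23(3) by (rule norm_sq_Zi)
      have "real n = real (5 * (n0 + n1 + n2 + n3))" using N by (simp add: n0 n1 n2 n3)
      then have "n = 5 * (n0 + n1 + n2 + n3)" by (simp only: of_nat_eq_iff)
      then have lt: "n0 + n1 + n2 + n3 < n" using False by presburger
      have "?p\<^sup>2 * (w0\<^sup>2 - 8 * w1\<^sup>2 - 20 * w2\<^sup>2 + 160 * w3\<^sup>2) = 0"
        using less.prems(6) unfolding w01 w23 by algebra
      then have "w0\<^sup>2 - 8 * w1\<^sup>2 - 20 * w2\<^sup>2 + 160 * w3\<^sup>2 = 0" using p0 by simp
      with less.IH[OF lt _ w01(1,3) w23(1,3)] have "w0 = 0 \<and> w1 = 0 \<and> w2 = 0 \<and> w3 = 0"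
        by (simp add: n0 n1 n2 n3)
      then show ?thesis by (simp add: w01 w23)
    qed
  qed
qed

subsection \<open>The quaternion order\<close>

definition r8 :: complex where
  "r8 = complex_of_real (sqrt 8)"

lemma r8_sq [simp]: "r8 * r8 = 8" "r8 * (r8 * x) = 8 * x"
proof -
  show "r8 * r8 = 8" by (simp add: r8_def flip: of_real_mult)
  then show "r8 * (r8 * x) = 8 * x" by (simp flip: mult.assoc)
qed

lemma r8_nz [simp]: "r8 \<noteq> 0"
  by (simp add: r8_def)

lemma norm_r8: "1 \<le> cmod r8"
  by (simp add: r8_def)

text \<open>\<open>qmat x0 x1 x2 x3\<close> is \<open>x0 + x1 I + x2 J + x3 I J\<close> with \<open>I\<^sup>2 = 8\<close> and \<open>J\<^sup>2 = 20\<close>.\<close>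
definition qmat :: "complex \<Rightarrow> complex \<Rightarrow> complex \<Rightarrow> complex \<Rightarrow> cmat" where
  "qmat x0 x1 x2 x3 = mk (x0 + r8 * x1) (20 * (x2 + r8 * x3)) (x2 - r8 * x3) (x0 - r8 * x1)"

lemma qmat_add: "qmat x0 x1 x2 x3 + qmat y0 y1 y2 y3 = qmat (x0 + y0) (x1 + y1) (x2 + y2) (x3 + y3)"
  by (simp add: cmat_eq_iff qmat_def algebra_simps)

lemma qmat_uminus: "- qmat x0 x1 x2 x3 = qmat (- x0) (- x1) (- x2) (- x3)"
  by (simp add: cmat_eq_iff qmat_def algebra_simps)

lemma qmat_mult: "qmat x0 x1 x2 x3 ** qmat y0 y1 y2 y3 =
   qmat (x0*y0 + 8*x1*y1 + 20*x2*y2 - 160*x3*y3) (x0*y1 + x1*y0 - 20*x2*y3 + 20*x3*y2)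
     (x0*y2 + x2*y0 + 8*x1*y3 - 8*x3*y1) (x0*y3 + x3*y0 + x1*y2 - x2*y1)"
  by (simp add: cmat_eq_iff qmat_def algebra_simps)

lemma qmat_scale: "mat c ** qmat x0 x1 x2 x3 = qmat (c * x0) (c * x1) (c * x2) (c * x3)"
  by (simp add: cmat_eq_iff qmat_def algebra_simps)

lemma qmat_mat: "mat c = qmat c 0 0 0"
  by (simp add: cmat_eq_iff qmat_def)

lemma qmat_zero: "0 = qmat 0 0 0 0"
  by (simp add: cmat_eq_iff qmat_def)

lemma adj_qmat: "adj (qmat x0 x1 x2 x3) = qmat x0 (- x1) (- x2) (- x3)"
  by (simp add: cmat_eq_iff qmat_def algebra_simps)

lemma trace_qmat: "trace (qmat x0 x1 x2 x3) = 2 * x0"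
  by (simp add: trace_cmat qmat_def)

lemma det_qmat: "det (qmat x0 x1 x2 x3) = x0\<^sup>2 - 8 * x1\<^sup>2 - 20 * x2\<^sup>2 + 160 * x3\<^sup>2"
  by (simp add: det_cmat qmat_def algebra_simps power2_eq_square)

lemma qmat_coords:
  fixes m :: cmat
  assumes "m = qmat x0 x1 x2 x3"
  shows "x0 = (m$1$1 + m$2$2) / 2" "x1 = (m$1$1 - m$2$2) / (2 * r8)"
    "x2 = (m$1$2 / 20 + m$2$1) / 2" "x3 = (m$1$2 / 20 - m$2$1) / (2 * r8)"
  by (simp_all add: assms qmat_def field_simps)

lemma qmat_eq_iff: "qmat x0 x1 x2 x3 = qmat y0 y1 y2 y3 \<longleftrightarrow> x0 = y0 \<and> x1 = y1 \<and> x2 = y2 \<and> x3 = y3"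
  by (metis qmat_coords)

lemma qmat_surj: "\<exists>x0 x1 x2 x3. m = qmat x0 x1 x2 x3"
  by (rule exI[of _ "(m$1$1 + m$2$2) / 2"], rule exI[of _ "(m$1$1 - m$2$2) / (2 * r8)"],
      rule exI[of _ "(m$1$2 / 20 + m$2$1) / 2"], rule exI[of _ "(m$1$2 / 20 - m$2$1) / (2 * r8)"])
    (simp add: cmat_eq_iff qmat_def field_simps)

lemma norm_entry_le:
  fixes m :: cmat
  shows "cmod (m$i$j) \<le> norm m"
  by (rule order_trans[OF Finite_Cartesian_Product.norm_nth_le Finite_Cartesian_Product.norm_nth_le])

lemma qmat_coords_norm_le:
  assumes "m = qmat x0 x1 x2 x3"
  shows "cmod x0 \<le> norm m" "cmod x1 \<le> norm m" "cmod x2 \<le> norm m" "cmod x3 \<le> norm m"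
proof -
  have half: "cmod ((a + b) / c) \<le> N" "cmod ((a - b) / c) \<le> N"
    if "cmod a \<le> N" "cmod b \<le> N" "2 \<le> cmod c" for a b c N
  proof -
    have N: "0 \<le> N" using that(1) norm_ge_zero order_trans by blast
    have "2 * N \<le> cmod c * N" using that N by (simp add: mult_right_mono)
    then have "cmod (a + b) \<le> cmod c * N" "cmod (a - b) \<le> cmod c * N"
      using norm_triangle_ineq[of a b] norm_triangle_ineq4[of a b] that by linarith+
    moreover have "0 < cmod c" using that by linarith
    ultimately show "cmod ((a + b) / c) \<le> N" "cmod ((a - b) / c) \<le> N"
      by (simp_all add: norm_divide divide_le_eq mult.commute)
  qed
  have c: "2 \<le> cmod (2 * r8)" "2 \<le> cmod (2::complex)" using norm_r8 by (simp_all add: norm_mult)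
  have e: "cmod (m$1$2 / 20) \<le> norm m"
  proof -
    have "cmod (m$1$2) / 20 \<le> norm m"
      using norm_entry_le[of m 1 2] norm_ge_zero[of m] by linarith
    then show ?thesis by (simp only: norm_divide norm_numeral)
  qed
  show "cmod x0 \<le> norm m" "cmod x1 \<le> norm m" "cmod x2 \<le> norm m" "cmod x3 \<le> norm m"
    unfolding qmat_coords[OF assms]
    by (rule half[OF norm_entry_le norm_entry_le] half[OF e norm_entry_le], rule c)+
qed

definition Ord :: "cmat set" where
  "Ord = {qmat x0 x1 x2 x3 | x0 x1 x2 x3. x0 \<in> Zi \<and> x1 \<in> Zi \<and> x2 \<in> Zi \<and> x3 \<in> Zi}"

lemma qmat_in_Ord [simp]: "qmat x0 x1 x2 x3 \<in> Ord \<longleftrightarrow> x0 \<in> Zi \<and> x1 \<in> Zi \<and> x2 \<in> Zi \<and> x3 \<in> Zi"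
  unfolding Ord_def using qmat_eq_iff by auto

lemma OrdE:
  assumes "m \<in> Ord"
  obtains x0 x1 x2 x3 where "m = qmat x0 x1 x2 x3" "x0 \<in> Zi" "x1 \<in> Zi" "x2 \<in> Zi" "x3 \<in> Zi"
  using assms by (auto simp: Ord_def)

lemma Ord_mult: "x \<in> Ord \<Longrightarrow> y \<in> Ord \<Longrightarrow> x ** y \<in> Ord"
  by (elim OrdE) (simp add: qmat_mult)

lemma Ord_add: "x \<in> Ord \<Longrightarrow> y \<in> Ord \<Longrightarrow> x + y \<in> Ord"
  by (elim OrdE) (simp add: qmat_add)

lemma Ord_uminus: "x \<in> Ord \<Longrightarrow> - x \<in> Ord"
  by (elim OrdE) (simp add: qmat_uminus)

lemma Ord_diff: "x \<in> Ord \<Longrightarrow> y \<in> Ord \<Longrightarrow> x - y \<in> Ord"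
  using Ord_add[of x "- y"] Ord_uminus[of y] by simp

lemma Ord_mat: "c \<in> Zi \<Longrightarrow> mat c \<in> Ord"
  by (simp add: qmat_mat)

lemma Ord_adj: "x \<in> Ord \<Longrightarrow> adj x \<in> Ord"
  by (elim OrdE) (simp add: adj_qmat)

lemma Ord_zero: "0 \<in> Ord"
  by (simp add: qmat_zero)

lemmas Ord_closed = Ord_mult Ord_add Ord_uminus Ord_diff Ord_mat Ord_adj Ord_zero

lemma Ord_trace: "x \<in> Ord \<Longrightarrow> trace x \<in> Zi"
  by (elim OrdE) (simp add: trace_qmat)

lemma Ord_det: "x \<in> Ord \<Longrightarrow> det x \<in> Zi"
  by (elim OrdE) (simp add: det_qmat)

text \<open>The division property of the algebra. It is what makes the quotient compact, and it
  separates nontrivial elements of a congruence subgroup from the identity.\<close>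

lemma Ord_det_eq_0:
  assumes "x \<in> Ord" "det x = 0"
  shows "x = 0"
proof -
  obtain x0 x1 x2 x3 where x: "x = qmat x0 x1 x2 x3" "x0 \<in> Zi" "x1 \<in> Zi" "x2 \<in> Zi" "x3 \<in> Zi"
    using assms(1) by (rule OrdE)
  have "x0\<^sup>2 - 8 * x1\<^sup>2 - 20 * x2\<^sup>2 + 160 * x3\<^sup>2 = 0" using assms(2) unfolding x(1) det_qmat .
  from quaternary_form_anisotropic[OF x(2-5) this] show ?thesis by (simp add: x(1) qmat_zero)
qed

lemma finite_Ord_ball: "finite {m \<in> Ord. norm m \<le> r}"
proof -
  let ?B = "{z \<in> Zi. cmod z \<le> r}"
  have "{m \<in> Ord. norm m \<le> r} \<subseteq> (\<lambda>(x0, x1, x2, x3). qmat x0 x1 x2 x3) ` (?B \<times> ?B \<times> ?B \<times> ?B)"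
  proof
    fix m assume "m \<in> {m \<in> Ord. norm m \<le> r}"
    then have m: "m \<in> Ord" "norm m \<le> r" by auto
    obtain x0 x1 x2 x3 where x: "m = qmat x0 x1 x2 x3" "x0 \<in> Zi" "x1 \<in> Zi" "x2 \<in> Zi" "x3 \<in> Zi"
      using m(1) by (rule OrdE)
    then have "(x0, x1, x2, x3) \<in> ?B \<times> ?B \<times> ?B \<times> ?B"
      using qmat_coords_norm_le[OF x(1)] m(2) by auto
    then show "m \<in> (\<lambda>(x0, x1, x2, x3). qmat x0 x1 x2 x3) ` (?B \<times> ?B \<times> ?B \<times> ?B)"
      using x(1) by force
  qed
  then show ?thesis by (rule finite_subset) (auto simp: finite_Zi_ball)
qed

text \<open>Since \<open>det x\<close> is congruent to \<open>(trace x / 2)\<^sup>2\<close> modulo 4, the only unit that is a reduced norm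
  from the trace class of a norm-one element is 1.\<close>
lemma Ord_det_unit:
  assumes "x \<in> Ord" "cmod (det x) = 1" "y \<in> Ord" "det y = 1" "trace x = - (trace y * det x)"
  shows "det x = 1"
proof -
  obtain x0 x1 x2 x3 where x: "x = qmat x0 x1 x2 x3" "x0 \<in> Zi" "x1 \<in> Zi" "x2 \<in> Zi" "x3 \<in> Zi"
    using assms(1) by (rule OrdE)
  obtain y0 y1 y2 y3 where y: "y = qmat y0 y1 y2 y3" "y0 \<in> Zi" "y1 \<in> Zi" "y2 \<in> Zi" "y3 \<in> Zi"
    using assms(3) by (rule OrdE)
  define v where "v = - 2 * x1\<^sup>2 - 5 * x2\<^sup>2 + 40 * x3\<^sup>2"
  define w where "w = - 2 * y1\<^sup>2 - 5 * y2\<^sup>2 + 40 * y3\<^sup>2"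
  have vw: "v \<in> Zi" "w \<in> Zi" unfolding v_def w_def using x y by (auto intro!: Zi_closed)
  have dx: "det x = x0\<^sup>2 + 4 * v" by (simp add: x det_qmat v_def algebra_simps)
  have dy: "1 = y0\<^sup>2 + 4 * w" using assms(4) by (simp add: y det_qmat w_def algebra_simps)
  have t: "x0 = - (y0 * det x)" using assms(5) by (simp add: trace_qmat x(1) y(1))
  have not_half: "(1/2::complex) \<notin> Zi"
  proof
    assume "(1/2::complex) \<in> Zi"
    then have "cmod (1/2) \<ge> 1" by (rule Zi_norm_ge_1) simp
    then show False by (simp add: norm_divide)
  qed
  have not_i: "x0\<^sup>2 + 4 * v \<noteq> \<i>" "x0\<^sup>2 + 4 * v \<noteq> -\<i>"
  proof -
    obtain p q where p: "x0 = Complex (of_int p) (of_int q)" using x(2) by (rule ZiE)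
    obtain k l where k: "v = Complex (of_int k) (of_int l)" using vw(1) by (rule ZiE)
    have im: "Im (x0\<^sup>2 + 4 * v) = of_int (2 * (p * q + 2 * l))" by (simp add: p k power2_eq_square)
    have "(2 * (p * q + 2 * l)) \<noteq> 1" "(2 * (p * q + 2 * l)) \<noteq> -1" by presburger+
    then have "Im (x0\<^sup>2 + 4 * v) \<noteq> 1" "Im (x0\<^sup>2 + 4 * v) \<noteq> -1" unfolding im by linarith+
    then show "x0\<^sup>2 + 4 * v \<noteq> \<i>" "x0\<^sup>2 + 4 * v \<noteq> -\<i>"
      by (metis imaginary_unit.sel(2), metis imaginary_unit.sel(2) uminus_complex.sel(2))
  qed
  have "det x \<noteq> -1"
  proof
    assume a: "det x = -1"
    then have "x0 = y0" using t by simp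
    then have "4 * w = 1 - y0\<^sup>2" "4 * v = -1 - y0\<^sup>2"
      using dx dy a by (metis add_diff_cancel_left')+
    then have "4 * w - 4 * v = 2" by (simp only:) simp
    moreover have "w - v = (4 * w - 4 * v) / 4" by (simp add: field_simps)
    ultimately have "w - v = 1/2" by (simp only:) simp
    then show False using not_half vw Zi_closed(8) by metis
  qed
  then show ?thesis
    using Zi_unit_cases[OF Ord_det[OF assms(1)] assms(2)] not_i dx by auto
qed

subsection \<open>Arithmetic data\<close>

definition Qi :: "complex set" where
  "Qi = {of_rat p + of_rat q * \<i> | p q. True}"

lemma Re_Im_of_rat [simp]: "Re (of_rat q) = of_rat q" "Im (of_rat q) = 0"
proof -
  have "of_rat q = complex_of_real (of_rat q)" by (cases q) (simp add: of_rat_rat)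
  then show "Re (of_rat q) = of_rat q" "Im (of_rat q) = 0" by simp_all
qed

lemma Qi_iff: "z \<in> Qi \<longleftrightarrow> Re z \<in> \<rat> \<and> Im z \<in> \<rat>"
proof
  assume "Re z \<in> \<rat> \<and> Im z \<in> \<rat>"
  then obtain p q where "Re z = of_rat p" "Im z = of_rat q" by (auto elim!: Rats_cases)
  then have "z = of_rat p + of_rat q * \<i>" by (simp add: complex_eq_iff)
  then show "z \<in> Qi" by (auto simp: Qi_def)
qed (auto simp: Qi_def)

lemma subfield_Qi: "subfield_C Qi"
  unfolding subfield_C_def
proof (intro conjI ballI impI)
  fix x assume "x \<in> Qi" "x \<noteq> 0"
  then show "inverse x \<in> Qi"
    by (auto simp: Qi_iff intro!: Rats_divide Rats_add Rats_power)
qed (auto simp: Qi_iff)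

lemma number_field_Qi: "number_field Qi"
  unfolding number_field_def
proof (intro conjI exI)
  show "subfield_C Qi" by (rule subfield_Qi)
  show "finite {1, \<i>}" by simp
  show "{1, \<i>} \<subseteq> Qi" by (auto simp: Qi_iff)
  have "\<exists>c. z = (\<Sum>b\<in>{1, \<i>}. of_rat (c b) * b)" if z: "z \<in> Qi" for z
  proof -
    obtain p q where "z = of_rat p + of_rat q * \<i>" using z by (auto simp: Qi_def)
    then show ?thesis by (intro exI[of _ "\<lambda>b. if b = 1 then p else q"]) (simp add: complex_eq_iff)
  qed
  moreover have "(\<Sum>b\<in>{1, \<i>}. of_rat (c b) * b) \<in> Qi" for c :: "complex \<Rightarrow> rat"
    by (auto simp: Qi_def complex_eq_iff)
  ultimately show "Qi = {\<Sum>b\<in>{1, \<i>}. of_rat (c b) * b | c. True}" by blast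
qed

lemma field_emb_Qi:
  assumes "field_emb Qi \<sigma>"
  shows "(\<forall>x\<in>Qi. \<sigma> x = x) \<or> (\<forall>x\<in>Qi. \<sigma> x = cnj x)"
proof -
  have add: "\<sigma> (x + y) = \<sigma> x + \<sigma> y" and mult: "\<sigma> (x * y) = \<sigma> x * \<sigma> y" if "x \<in> Qi" "y \<in> Qi" for x y
    using assms that by (auto simp: field_emb_def)
  have one: "\<sigma> 1 = 1" using assms by (simp add: field_emb_def)
  have mem: "of_nat n \<in> Qi" "of_int k \<in> Qi" "of_rat q \<in> Qi" "\<i> \<in> Qi" for n k q
    by (auto simp: Qi_iff)
  have zero: "\<sigma> 0 = 0" using add[of 0 0] mem(1)[of 0] by simp
  have nat: "\<sigma> (of_nat n) = of_nat n" for n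
    by (induction n) (simp_all add: zero one add mem Qi_iff)
  have int: "\<sigma> (of_int k) = of_int k" for k
  proof (cases k rule: int_cases2)
    case (nonneg n) then show ?thesis using nat by simp
  next
    case (nonpos n)
    have "\<sigma> (of_nat n + of_int k) = \<sigma> (of_nat n) + \<sigma> (of_int k)" by (rule add) (rule mem)+
    then show ?thesis using nonpos nat zero by (simp add: add_eq_0_iff)
  qed
  have rat: "\<sigma> (of_rat q) = of_rat q" for q
  proof (cases q)
    case (Fract a b)
    have b: "of_int b \<noteq> (0::complex)" using Fract by simp
    have "\<sigma> (of_rat q * of_int b) = \<sigma> (of_rat q) * \<sigma> (of_int b)" by (rule mult) (rule mem)+
    moreover have "of_rat q * of_int b = (of_int a :: complex)"
      using Fract b by (simp add: of_rat_rat)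
    ultimately have "\<sigma> (of_rat q) * of_int b = of_rat q * of_int b" by (metis int)
    then show ?thesis using b by (metis mult_right_cancel)
  qed
  have "\<sigma> \<i> * \<sigma> \<i> = -1"
    using mult[OF mem(4) mem(4)] int[of "-1"] by simp
  then have "(\<sigma> \<i> - \<i>) * (\<sigma> \<i> + \<i>) = 0" by (simp add: algebra_simps)
  then have "\<sigma> \<i> = \<i> \<or> \<sigma> \<i> = - \<i>" by (auto simp: eq_neg_iff_add_eq_0)
  moreover have "\<sigma> (of_rat p + of_rat q * \<i>) = of_rat p + of_rat q * \<sigma> \<i>" for p q
  proof -
    have "of_rat q * \<i> \<in> Qi" using mem subfield_Qi by (auto simp: subfield_C_def)
    then show ?thesis using add mult mem rat by simp
  qed
  moreover have "cnj (of_rat p) = of_rat p" for p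
    by (simp add: complex_eq_iff)
  ultimately show ?thesis by (auto simp: Qi_def)
qed

lemma one_complex_place_Qi: "one_complex_place Qi"
proof -
  have "\<i> \<in> Qi" by (simp add: Qi_iff)
  moreover have "\<i> \<notin> \<real>" by (simp add: complex_is_Real_iff)
  ultimately show ?thesis
    unfolding one_complex_place_def using number_field_Qi field_emb_Qi by blast
qed

text \<open>Every embedding sends i to i or -i, never to a real number. This settles the
  ramification condition in the definition of arithmeticity.\<close>

lemma no_real_emb_Qi: "\<not> real_emb Qi \<sigma>"
proof
  assume "real_emb Qi \<sigma>"
  then have "field_emb Qi \<sigma>" "\<sigma> \<i> \<in> \<real>" by (auto simp: real_emb_def Qi_iff)
  then show False using field_emb_Qi[of \<sigma>] by (auto simp: Qi_iff complex_is_Real_iff)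
qed

definition Aq :: "cmat set" where
  "Aq = {qmat x0 x1 x2 x3 | x0 x1 x2 x3. x0 \<in> Qi \<and> x1 \<in> Qi \<and> x2 \<in> Qi \<and> x3 \<in> Qi}"

lemma qmat_in_Aq [simp]: "qmat x0 x1 x2 x3 \<in> Aq \<longleftrightarrow> x0 \<in> Qi \<and> x1 \<in> Qi \<and> x2 \<in> Qi \<and> x3 \<in> Qi"
  unfolding Aq_def using qmat_eq_iff by auto

definition ebas :: "nat \<Rightarrow> cmat" where
  "ebas i = qmat (if i = 0 then 1 else 0) (if i = 1 then 1 else 0) (if i = 2 then 1 else 0) (if i = 3 then 1 else 0)"

lemma klin_ebas: "klin c ebas = qmat (c 0) (c 1) (c 2) (c 3)"
proof -
  have "{..<4} = {0, 1, 2, 3::nat}" by auto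
  then show ?thesis by (simp add: klin_def ebas_def qmat_scale qmat_add)
qed

lemma Qi_closed:
  "0 \<in> Qi" "1 \<in> Qi" "numeral n \<in> Qi" "x \<in> Qi \<Longrightarrow> - x \<in> Qi"
  "x \<in> Qi \<Longrightarrow> y \<in> Qi \<Longrightarrow> x + y \<in> Qi" "x \<in> Qi \<Longrightarrow> y \<in> Qi \<Longrightarrow> x - y \<in> Qi"
  "x \<in> Qi \<Longrightarrow> y \<in> Qi \<Longrightarrow> x * y \<in> Qi"
  by (auto simp: Qi_iff)

lemma quat_alg_Aq: "quat_alg Qi Aq ebas"
  unfolding quat_alg_def
proof (intro conjI ballI allI impI)
  show "mat 1 \<in> Aq" unfolding Aq_def qmat_mat using Qi_closed by blast
  show "x + y \<in> Aq" "x ** y \<in> Aq" if "x \<in> Aq" "y \<in> Aq" for x y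
    using that by (auto simp: Aq_def qmat_add qmat_mult qmat_eq_iff Qi_closed)
  show "mat c ** x \<in> Aq" if "c \<in> Qi" "x \<in> Aq" for c x
    using that by (auto simp: Aq_def qmat_scale qmat_eq_iff Qi_closed)
  show "ebas i \<in> Aq" for i by (auto simp: Aq_def ebas_def qmat_eq_iff Qi_closed)
  have four: "i < 4 \<Longrightarrow> i = 0 \<or> i = 1 \<or> i = 2 \<or> i = (3::nat)" for i by auto
  show "c i = 0" if "(\<forall>i<4. c i \<in> Qi) \<and> klin c ebas = 0" "i < 4" for c i
    using that four[of i] by (auto simp: klin_ebas qmat_zero qmat_eq_iff)
  show "Aq = {klin c ebas |c. \<forall>i<4. c i \<in> Qi}"
  proof
    show "{klin c ebas |c. \<forall>i<4. c i \<in> Qi} \<subseteq> Aq" by (auto simp: klin_ebas)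
    show "Aq \<subseteq> {klin c ebas |c. \<forall>i<4. c i \<in> Qi}"
    proof
      fix x assume "x \<in> Aq"
      then obtain x0 x1 x2 x3 where x: "x = qmat x0 x1 x2 x3" "x0 \<in> Qi" "x1 \<in> Qi" "x2 \<in> Qi" "x3 \<in> Qi"
        by (auto simp: Aq_def)
      let ?c = "\<lambda>i::nat. if i = 0 then x0 else if i = 1 then x1 else if i = 2 then x2 else x3"
      have "x = klin ?c ebas" "\<forall>i<4. ?c i \<in> Qi" using x by (auto simp: klin_ebas)
      then show "x \<in> {klin c ebas |c. \<forall>i<4. c i \<in> Qi}" by blast
    qed
  qed
  show "\<exists>c. M = klin c ebas" for M
  proof -
    obtain x0 x1 x2 x3 where x: "M = qmat x0 x1 x2 x3" using qmat_surj by blast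
    let ?c = "\<lambda>i::nat. if i = 0 then x0 else if i = 1 then x1 else if i = 2 then x2 else x3"
    have "M = klin ?c ebas" using x by (auto simp: klin_ebas)
    then show ?thesis by blast
  qed
qed

lemma is_order_Ord: "is_order Qi Aq Ord"
  unfolding is_order_def
proof (intro conjI ballI)
  have ZQ: "z \<in> Qi" if "z \<in> Zi" for z
    using that Ints_subset_Rats by (auto simp: Zi_def Qi_iff)
  show "Ord \<subseteq> Aq" using ZQ by (auto simp: Ord_def)
  show "mat 1 \<in> Ord" "\<And>x. x \<in> Ord \<Longrightarrow> - x \<in> Ord" "\<And>x y. x \<in> Ord \<Longrightarrow> y \<in> Ord \<Longrightarrow> x + y \<in> Ord"
    "\<And>x y. x \<in> Ord \<Longrightarrow> y \<in> Ord \<Longrightarrow> x ** y \<in> Ord"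
    by (auto intro: Ord_closed)
  have four: "{..<4} = {0, 1, 2, 3::nat}" by auto
  \<comment> \<open>A basis of the order over the ordinary integers: each of the four basis
    quaternions and its multiple by i.\<close>
  define f where "f = (\<lambda>(i, b). mat (if b then \<i> else 1) ** ebas i)"
  define I where "I = {..<4::nat} \<times> (UNIV :: bool set)"
  have inj: "inj_on f I"
    by (auto simp: inj_on_def I_def f_def ebas_def qmat_scale qmat_eq_iff complex_eq_iff split: if_splits)
  have sum_f: "(\<Sum>g\<in>f ` I. mat (of_int (c g)) ** g) =
     qmat (of_int (c (f (0, False))) + of_int (c (f (0, True))) * \<i>) (of_int (c (f (1, False))) + of_int (c (f (1, True))) * \<i>)
       (of_int (c (f (2, False))) + of_int (c (f (2, True))) * \<i>) (of_int (c (f (3, False))) + of_int (c (f (3, True))) * \<i>)"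
    for c :: "cmat \<Rightarrow> int"
  proof -
    have "(\<Sum>g\<in>f ` I. mat (of_int (c g)) ** g) = (\<Sum>(i, b)\<in>I. mat (of_int (c (f (i, b)))) ** f (i, b))"
      by (simp add: sum.reindex[OF inj] case_prod_beta)
    also have "\<dots> = (\<Sum>i<4. \<Sum>b\<in>UNIV. mat (of_int (c (f (i, b)))) ** f (i, b))"
      unfolding I_def by (rule sum.cartesian_product[symmetric])
    also have "\<dots> = qmat (of_int (c (f (0, False))) + of_int (c (f (0, True))) * \<i>) (of_int (c (f (1, False))) + of_int (c (f (1, True))) * \<i>)
       (of_int (c (f (2, False))) + of_int (c (f (2, True))) * \<i>) (of_int (c (f (3, False))) + of_int (c (f (3, True))) * \<i>)"
      by (simp add: four UNIV_bool f_def ebas_def qmat_scale qmat_add)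
    finally show ?thesis .
  qed
  have "Ord = {\<Sum>g\<in>f ` I. mat (of_int (c g)) ** g |c. True}"
  proof
    show "{\<Sum>g\<in>f ` I. mat (of_int (c g)) ** g |c. True} \<subseteq> Ord"
      by (auto simp: sum_f)
    show "Ord \<subseteq> {\<Sum>g\<in>f ` I. mat (of_int (c g)) ** g |c. True}"
    proof
      fix x assume "x \<in> Ord"
      then obtain x0 x1 x2 x3 where x: "x = qmat x0 x1 x2 x3" "x0 \<in> Zi" "x1 \<in> Zi" "x2 \<in> Zi" "x3 \<in> Zi"
        by (rule OrdE)
      let ?x = "\<lambda>i::nat. if i = 0 then x0 else if i = 1 then x1 else if i = 2 then x2 else x3"
      define d where "d = (\<lambda>(i, b). if b then \<lfloor>Im (?x i)\<rfloor> else \<lfloor>Re (?x i)\<rfloor>)"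
      \<comment> \<open>Coefficients in the definition of an order are indexed by matrices, so the
        integer coordinates are pulled back along the injective map \<open>f\<close>.\<close>
      define c where "c = d \<circ> inv_into I f"
      have c: "c (f (i, b)) = d (i, b)" if "i < 4" for i b
        using that inv_into_f_f[OF inj, of "(i, b)"] by (simp add: c_def I_def)
      have fl: "of_int \<lfloor>Re z\<rfloor> + of_int \<lfloor>Im z\<rfloor> * \<i> = z" if "z \<in> Zi" for z
        using that by (auto simp: Zi_def complex_eq_iff elim!: Ints_cases)
      have "x = (\<Sum>g\<in>f ` I. mat (of_int (c g)) ** g)"
        unfolding sum_f by (simp add: c d_def fl x)
      then show "x \<in> {\<Sum>g\<in>f ` I. mat (of_int (c g)) ** g |c. True}" by blast
    qed
  qed
  moreover have "finite (f ` I)" by (simp add: I_def)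
  moreover have "f ` I \<subseteq> Ord" by (auto simp: f_def I_def ebas_def qmat_scale)
  ultimately show "\<exists>G. finite G \<and> G \<subseteq> Ord \<and> Ord = {\<Sum>g\<in>G. mat (of_int (c g)) ** g |c. True}"
    by blast
  have sub: "(\<Sum>x\<in>T. mat (c x) ** x) \<in> Aq" if "finite T" "T \<subseteq> Ord" "\<forall>x\<in>T. c x \<in> Qi" for T c
    using that
  proof (induction T)
    case empty
    then show ?case by (auto simp: Aq_def qmat_zero qmat_eq_iff Qi_closed)
  next
    case (insert x T)
    have "x \<in> Aq" using insert.prems \<open>Ord \<subseteq> Aq\<close> by auto
    then have "mat (c x) ** x \<in> Aq" using quat_alg_Aq insert.prems by (auto simp: quat_alg_def)
    then show ?case using insert quat_alg_Aq by (simp add: quat_alg_def)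
  qed
  show "Aq = {\<Sum>x\<in>T. mat (c x) ** x |T c. finite T \<and> T \<subseteq> Ord \<and> (\<forall>x\<in>T. c x \<in> Qi)}"
  proof
    show "{\<Sum>x\<in>T. mat (c x) ** x |T c. finite T \<and> T \<subseteq> Ord \<and> (\<forall>x\<in>T. c x \<in> Qi)} \<subseteq> Aq"
      using sub by auto
    show "Aq \<subseteq> {\<Sum>x\<in>T. mat (c x) ** x |T c. finite T \<and> T \<subseteq> Ord \<and> (\<forall>x\<in>T. c x \<in> Qi)}"
    proof
      fix x assume "x \<in> Aq"
      moreover have "Aq = {klin c ebas |c. \<forall>i<4. c i \<in> Qi}"
        using quat_alg_Aq unfolding quat_alg_def by (elim conjE)
      ultimately obtain c where c: "x = klin c ebas" "\<forall>i<4. c i \<in> Qi" by auto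
      have inj4: "inj_on ebas {..<4}"
        by (auto simp: inj_on_def ebas_def qmat_eq_iff split: if_splits)
      define c' where "c' = c \<circ> inv_into {..<4} ebas"
      have c': "c' (ebas i) = c i" if "i < 4" for i
        using that inv_into_f_f[OF inj4, of i] by (simp add: c'_def)
      have "x = (\<Sum>x\<in>ebas ` {..<4}. mat (c' x) ** x)"
        unfolding c(1) klin_def by (simp add: sum.reindex[OF inj4] c')
      moreover have "ebas ` {..<4} \<subseteq> Ord" by (auto simp: ebas_def)
      moreover have "\<forall>x\<in>ebas ` {..<4}. c' x \<in> Qi" using c(2) c' by auto
      ultimately show "x \<in> {\<Sum>x\<in>T. mat (c x) ** x |T c. finite T \<and> T \<subseteq> Ord \<and> (\<forall>x\<in>T. c x \<in> Qi)}"
        by blast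
    qed
  qed
qed

subsection \<open>Congruence subgroups\<close>

definition Gam :: "cmat set" where
  "Gam = {x \<in> Ord. det x = 1}"

lemma GamD: "x \<in> Gam \<Longrightarrow> x \<in> Ord" "x \<in> Gam \<Longrightarrow> det x = 1"
  by (auto simp: Gam_def)

lemma Gam_mult: "x \<in> Gam \<Longrightarrow> y \<in> Gam \<Longrightarrow> x ** y \<in> Gam"
  by (simp add: Gam_def Ord_mult det_mul)

lemma Gam_adj: "x \<in> Gam \<Longrightarrow> adj x \<in> Gam"
  by (simp add: Gam_def Ord_adj)

lemma Gam_uminus: "x \<in> Gam \<Longrightarrow> - x \<in> Gam"
  by (simp add: Gam_def Ord_uminus)

lemma Gam_one: "mat 1 \<in> Gam"
  by (simp add: Gam_def Ord_mat)

lemmas Gam_closed = Gam_mult Gam_adj Gam_uminus Gam_one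

lemma norm_one_group_Ord: "norm_one_group Ord = Gam"
proof
  show "norm_one_group Ord \<subseteq> Gam"
    by (auto simp: norm_one_group_def Gam_def Ord_uminus)
  show "Gam \<subseteq> norm_one_group Ord"
  proof
    fix x assume "x \<in> Gam"
    then have "x = 1 *\<^sub>R x \<and> x \<in> Ord \<and> det x = 1" by (simp add: Gam_def)
    then show "x \<in> norm_one_group Ord" unfolding norm_one_group_def by blast
  qed
qed

lemma adj_cancel:
  assumes "det g = 1"
  shows "adj g ** (g ** x) = x" "g ** (adj g ** x) = x" "x ** adj g ** g = x" "x ** g ** adj g = x"
  using assms by (simp_all add: matrix_mul_assoc mult_adj)
     (simp_all add: mult_adj flip: matrix_mul_assoc)

definition qcong :: "complex \<Rightarrow> cmat \<Rightarrow> cmat \<Rightarrow> bool" where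
  "qcong a m n \<longleftrightarrow> (\<exists>y\<in>Ord. m = n + mat a ** y)"

lemma mat_mult_left_commute:
  fixes x y :: cmat
  shows "x ** (mat a ** y) = mat a ** (x ** y)"
  by (simp add: cmat_eq_iff algebra_simps)

lemma cmat_distrib:
  fixes x y z :: cmat
  shows "x ** (y + z) = x ** y + x ** z" "(x + y) ** z = x ** z + y ** z"
    "x ** (y - z) = x ** y - x ** z" "(x - y) ** z = x ** z - y ** z"
  by (simp_all add: cmat_eq_iff algebra_simps)

lemma adj_add: "adj (m + n) = adj m + adj n"
  by (simp add: cmat_eq_iff)

lemma adj_scale: "adj (mat a ** m) = mat a ** adj m"
  by (simp add: cmat_eq_iff)

lemma qcong_refl [simp]: "qcong a m m"
  unfolding qcong_def by (rule bexI[of _ 0]) (auto simp: Ord_zero cmat_eq_iff)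

lemma qcong_sym: "qcong a m n \<Longrightarrow> qcong a n m"
  unfolding qcong_def by (metis Ord_uminus add_diff_cancel_right' mult_uminus_cmat(2) uminus_add_conv_diff add.commute)

lemma qcong_add:
  assumes "qcong a m n" "qcong a m' n'"
  shows "qcong a (m + m') (n + n')"
proof -
  obtain y y' where "y \<in> Ord" "m = n + mat a ** y" "y' \<in> Ord" "m' = n' + mat a ** y'"
    using assms by (auto simp: qcong_def)
  then have "y + y' \<in> Ord" "m + m' = n + n' + mat a ** (y + y')"
    by (simp_all add: Ord_add cmat_distrib algebra_simps)
  then show ?thesis unfolding qcong_def by blast
qed

lemma qcong_uminus: "qcong a m n \<Longrightarrow> qcong a (- m) (- n)"
  unfolding qcong_def by (metis Ord_uminus minus_add_distrib mult_uminus_cmat(2))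

lemma qcong_trans:
  assumes "qcong a m n" "qcong a n k"
  shows "qcong a m k"
  using qcong_add[OF qcong_add[OF assms] qcong_refl[of a "- n"]] by (simp add: algebra_simps)

lemma qcong_adj: "qcong a m n \<Longrightarrow> qcong a (adj m) (adj n)"
  unfolding qcong_def by (metis Ord_adj adj_add adj_scale)

lemma qcong_mult_left: "x \<in> Ord \<Longrightarrow> qcong a m n \<Longrightarrow> qcong a (x ** m) (x ** n)"
  unfolding qcong_def by (metis Ord_mult cmat_distrib(1) mat_mult_left_commute)

lemma qcong_mult_right: "x \<in> Ord \<Longrightarrow> qcong a m n \<Longrightarrow> qcong a (m ** x) (n ** x)"
  unfolding qcong_def by (metis Ord_mult cmat_distrib(2) matrix_mul_assoc)

lemma qcong_mult:
  "m' \<in> Ord \<Longrightarrow> n \<in> Ord \<Longrightarrow> qcong a m n \<Longrightarrow> qcong a m' n' \<Longrightarrow> qcong a (m ** m') (n ** n')"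
  using qcong_trans qcong_mult_left qcong_mult_right by blast

text \<open>The principal congruence subgroup together with its negatives: a group in PSL(2,C) is
  represented by its full preimage, which must contain -1.\<close>

definition Gcong :: "complex \<Rightarrow> cmat set" where
  "Gcong a = {x \<in> Gam. qcong a x (mat 1) \<or> qcong a x (- mat 1)}"

lemma Gcong_Gam: "x \<in> Gcong a \<Longrightarrow> x \<in> Gam"
  by (simp add: Gcong_def)

lemma Gcong_uminus: "x \<in> Gcong a \<Longrightarrow> - x \<in> Gcong a"
  using qcong_uminus[of a x "mat 1"] qcong_uminus[of a x "- mat 1"] by (auto simp: Gcong_def Gam_uminus)

lemma Gcong_mult:
  assumes "x \<in> Gcong a" "y \<in> Gcong a"
  shows "x ** y \<in> Gcong a"
proof -
  have one: "mat 1 \<in> Ord" "- mat 1 \<in> Ord" by (auto intro!: Ord_closed)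
  have "y \<in> Ord" using assms Gcong_Gam GamD by blast
  then have "qcong a (x ** y) (mat 1) \<or> qcong a (x ** y) (- mat 1)"
    using assms qcong_mult[OF _ one(1), of y a x "mat 1"] qcong_mult[OF _ one(2), of y a x "mat 1"]
      qcong_mult[OF _ one(1), of y a x "- mat 1"] qcong_mult[OF _ one(2), of y a x "- mat 1"]
    by (auto simp: Gcong_def)
  then show ?thesis using assms by (simp add: Gcong_def Gam_mult)
qed

lemma adj_one [simp]: "adj (mat 1) = mat 1"
  by (simp add: cmat_eq_iff)

lemma Gcong_adj: "x \<in> Gcong a \<Longrightarrow> adj x \<in> Gcong a"
  using qcong_adj[of a x] by (force simp: Gcong_def Gam_adj)

lemma Gcong_one: "mat 1 \<in> Gcong a"
  by (simp add: Gcong_def Gam_one)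

lemma Gcong_conj:
  assumes "x \<in> Gcong a" "h \<in> Gam"
  shows "h ** x ** adj h \<in> Gcong a"
proof -
  have h: "h \<in> Ord" "adj h \<in> Ord" "det h = 1" using assms GamD Gam_adj by blast+
  have "qcong a (h ** x ** adj h) (h ** m ** adj h)" if "qcong a x m" for m
    by (intro qcong_mult_left qcong_mult_right h that)
  from this[of "mat 1"] this[of "- mat 1"] show ?thesis
    using assms h by (auto simp: Gcong_def mult_adj Gam_mult Gam_adj)
qed

lemma SL2_preimage_group_Gcong: "SL2_preimage_group (Gcong a)"
  unfolding SL2_preimage_group_def
  using Gcong_one Gcong_uminus Gcong_mult Gcong_adj matrix_inv_eq_adj Gcong_Gam GamD by metis

lemma finite_Gam_ball: "finite {x \<in> Gam. norm x \<le> r}"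
  by (rule finite_subset[OF _ finite_Ord_ball[of r]]) (auto simp: Gam_def)

lemma discrete_Gcong: "discrete_group (Gcong a)"
  unfolding discrete_group_def
  by (intro allI, rule finite_subset[OF _ finite_Gam_ball]) (auto simp: Gcong_def)

lemma countable_Gcong: "countable (Gcong a)"
proof -
  have "Gcong a \<subseteq> (\<Union>n. {x \<in> Gam. norm x \<le> real n})"
    using real_arch_simple by (auto simp: Gcong_def)
  then show ?thesis
    by (rule countable_subset) (simp add: finite_Gam_ball countable_finite)
qed

section \<open>Residue counts and coset representatives modulo \<open>a\<close>\<close>

lemma card_Zi_ball:
  assumes "r \<ge> 1"
  shows "real (card {z \<in> Zi. cmod z \<le> r}) \<le> 9 * r\<^sup>2"
proof -
  let ?I = "{- \<lfloor>r\<rfloor> .. \<lfloor>r\<rfloor>}"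
  have "{z \<in> Zi. cmod z \<le> r} \<subseteq> (\<lambda>(p, q). Complex (of_int p) (of_int q)) ` (?I \<times> ?I)"
  proof
    fix z assume "z \<in> {z \<in> Zi. cmod z \<le> r}"
    then have "z \<in> Zi" "cmod z \<le> r" by auto
    moreover obtain p q where z: "z = Complex (of_int p) (of_int q)" using \<open>z \<in> Zi\<close> by (rule ZiE)
    moreover have "\<bar>of_int p\<bar> \<le> cmod z" "\<bar>of_int q\<bar> \<le> cmod z"
      using abs_Re_le_cmod[of z] abs_Im_le_cmod[of z] z by auto
    ultimately have "\<bar>real_of_int p\<bar> \<le> r" "\<bar>real_of_int q\<bar> \<le> r" by linarith+
    then have "p \<in> ?I" "q \<in> ?I" by (simp_all add: le_floor_iff, linarith+)
    then show "z \<in> (\<lambda>(p, q). Complex (of_int p) (of_int q)) ` (?I \<times> ?I)" using z by auto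
  qed
  then have "card {z \<in> Zi. cmod z \<le> r} \<le> card (?I \<times> ?I)"
    by (rule surj_card_le[rotated]) auto
  then have "real (card {z \<in> Zi. cmod z \<le> r}) \<le> real (nat (2 * \<lfloor>r\<rfloor> + 1)) ^ 2"
    by (simp add: power2_eq_square card_cartesian_product flip: of_nat_mult)
  also have "\<dots> \<le> (3 * r) ^ 2"
    using assms by (intro power_mono) (auto simp: of_nat_nat, linarith)
  finally show ?thesis by (simp add: power_mult_distrib)
qed

lemma Zi_residue:
  assumes "z \<in> Zi" "a \<in> Zi" "a \<noteq> 0"
  obtains w q where "w \<in> Zi" "q \<in> Zi" "z = w + a * q" "cmod w \<le> cmod a"
proof -
  define u where "u = z / a"
  define q where "q = Complex (of_int (round (Re u))) (of_int (round (Im u)))"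
  have "cmod (u - q) \<le> \<bar>Re (u - q)\<bar> + \<bar>Im (u - q)\<bar>" by (rule cmod_le)
  also have "\<dots> \<le> 1/2 + 1/2"
    unfolding q_def using of_int_round_abs_le[of "Re u"] of_int_round_abs_le[of "Im u"]
    by (intro add_mono) (simp_all add: abs_minus_commute)
  finally have "cmod (u - q) * cmod a \<le> 1 * cmod a" by (intro mult_right_mono) auto
  moreover have "(u - q) * a = z - a * q" using assms(3) by (simp add: u_def algebra_simps)
  ultimately have "cmod (z - a * q) \<le> cmod a" by (simp flip: norm_mult)
  moreover have "q \<in> Zi" by (simp add: q_def)
  ultimately show thesis using that[of "z - a * q" q] assms by auto
qed

text \<open>A set meeting every residue class, possibly more than once; it serves for upper bounds
  of order |a|^8.\<close>

definition residues_mod :: "complex \<Rightarrow> cmat set" where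
  "residues_mod a = (\<lambda>(x0, x1, x2, x3). qmat x0 x1 x2 x3) `
     ({z \<in> Zi. cmod z \<le> cmod a} \<times> {z \<in> Zi. cmod z \<le> cmod a} \<times> {z \<in> Zi. cmod z \<le> cmod a} \<times> {z \<in> Zi. cmod z \<le> cmod a})"

lemma finite_residues: "finite (residues_mod a)"
  by (simp add: residues_mod_def finite_Zi_ball)

lemma card_residues:
  assumes "cmod a \<ge> 1"
  shows "real (card (residues_mod a)) \<le> 9 ^ 4 * cmod a ^ 8"
proof -
  let ?B = "{z \<in> Zi. cmod z \<le> cmod a}"
  have "card (residues_mod a) \<le> card (?B \<times> ?B \<times> ?B \<times> ?B)"
    unfolding residues_mod_def by (rule card_image_le) (simp add: finite_Zi_ball)
  then have "real (card (residues_mod a)) \<le> real (card ?B) ^ 4"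
    by (simp add: card_cartesian_product power4_eq_xxxx mult.assoc flip: of_nat_mult)
  also have "\<dots> \<le> (9 * (cmod a)\<^sup>2) ^ 4"
    by (intro power_mono card_Zi_ball assms) auto
  finally show ?thesis by (simp add: power_mult_distrib flip: power_mult)
qed

lemma residue_exists:
  assumes "x \<in> Ord" "a \<in> Zi" "a \<noteq> 0"
  obtains r where "r \<in> residues_mod a" "r \<in> Ord" "qcong a x r"
proof -
  obtain x0 x1 x2 x3 where x: "x = qmat x0 x1 x2 x3" "x0 \<in> Zi" "x1 \<in> Zi" "x2 \<in> Zi" "x3 \<in> Zi"
    using assms(1) by (rule OrdE)
  obtain w0 q0 where 0: "w0 \<in> Zi" "q0 \<in> Zi" "x0 = w0 + a * q0" "cmod w0 \<le> cmod a"
    using Zi_residue[OF x(2) assms(2,3)] .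
  obtain w1 q1 where 1: "w1 \<in> Zi" "q1 \<in> Zi" "x1 = w1 + a * q1" "cmod w1 \<le> cmod a"
    using Zi_residue[OF x(3) assms(2,3)] .
  obtain w2 q2 where 2: "w2 \<in> Zi" "q2 \<in> Zi" "x2 = w2 + a * q2" "cmod w2 \<le> cmod a"
    using Zi_residue[OF x(4) assms(2,3)] .
  obtain w3 q3 where 3: "w3 \<in> Zi" "q3 \<in> Zi" "x3 = w3 + a * q3" "cmod w3 \<le> cmod a"
    using Zi_residue[OF x(5) assms(2,3)] .
  have "qcong a x (qmat w0 w1 w2 w3)"
    unfolding qcong_def by (rule bexI[of _ "qmat q0 q1 q2 q3"]) (use 0 1 2 3 in \<open>simp_all add: x(1) qmat_scale qmat_add\<close>)
  moreover have "qmat w0 w1 w2 w3 \<in> residues_mod a" unfolding residues_mod_def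
    by (rule image_eqI[of _ _ "(w0, w1, w2, w3)"]) (use 0 1 2 3 in auto)
  ultimately show thesis using that 0 1 2 3 by simp
qed

definition incongruent :: "complex \<Rightarrow> cmat set \<Rightarrow> bool" where
  "incongruent a S \<longleftrightarrow> S \<subseteq> Ord \<and> (\<forall>x\<in>S. \<forall>y\<in>S. qcong a x y \<longrightarrow> x = y)"

lemma incongruent_card:
  assumes "incongruent a S" "a \<in> Zi" "a \<noteq> 0"
  shows "finite S" "real (card S) \<le> 9 ^ 4 * cmod a ^ 8"
proof -
  have "\<exists>r. r \<in> residues_mod a \<and> qcong a x r" if x: "x \<in> S" for x
  proof -
    have "x \<in> Ord" using x assms(1) by (auto simp: incongruent_def)
    then show ?thesis using residue_exists[OF _ assms(2,3)] by metis
  qed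
  then obtain f where f: "\<And>x. x \<in> S \<Longrightarrow> f x \<in> residues_mod a \<and> qcong a x (f x)" by metis
  have inj: "inj_on f S"
  proof (rule inj_onI)
    fix x y assume xy: "x \<in> S" "y \<in> S" "f x = f y"
    then have "qcong a x y" using f[OF xy(1)] f[OF xy(2)] qcong_trans qcong_sym by metis
    then show "x = y" using assms(1) xy by (simp add: incongruent_def)
  qed
  have sub: "f ` S \<subseteq> residues_mod a" using f by auto
  show "finite S" using inj sub finite_residues by (metis finite_imageD finite_subset)
  have "card S \<le> card (residues_mod a)" using inj sub finite_residues by (rule card_inj_on_le)
  then show "real (card S) \<le> 9 ^ 4 * cmod a ^ 8"
    using card_residues[OF Zi_norm_ge_1[OF assms(2,3)]] by linarith
qed

lemma coset_representatives:
  obtains F where "F \<subseteq> Gam" "\<And>x. x \<in> Gam \<Longrightarrow> \<exists>f\<in>F. adj f ** x \<in> Gcong a"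
    "\<And>f f'. f \<in> F \<Longrightarrow> f' \<in> F \<Longrightarrow> adj f ** f' \<in> Gcong a \<Longrightarrow> f = f'"
proof -
  define R where "R x y \<longleftrightarrow> y \<in> Gam \<and> adj x ** y \<in> Gcong a" for x y
  have trans: "adj x ** z \<in> Gcong a" if "adj x ** y \<in> Gcong a" "adj y ** z \<in> Gcong a" "y \<in> Gam" for x y z
    using Gcong_mult[OF that(1,2)] adj_cancel(2)[of y z] GamD(2)[OF that(3)] by (simp flip: matrix_mul_assoc)
  have sym: "adj y ** x \<in> Gcong a" if "adj x ** y \<in> Gcong a" for x y
    using Gcong_adj[OF that] by (simp add: adj_mult)
  have refl: "R x x" if "x \<in> Gam" for x
    using that Gcong_one by (simp add: R_def mult_adj GamD)
  \<comment> \<open>Elements of the same left coset satisfy the same predicate \<open>R x\<close>,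
    so the choice returns the same representative for them.\<close>
  define r where "r x = (SOME y. R x y)" for x
  have r: "R x (r x)" if "x \<in> Gam" for x
    unfolding r_def by (rule someI) (rule refl[OF that])
  have r_eq: "r x = r y" if "x \<in> Gam" "y \<in> Gam" "adj x ** y \<in> Gcong a" for x y
  proof -
    have "R x z \<longleftrightarrow> R y z" for z
      unfolding R_def using trans sym that by metis
    then show ?thesis by (simp add: r_def)
  qed
  show thesis
  proof
    show "r ` Gam \<subseteq> Gam" using r by (auto simp: R_def)
    show "\<exists>f\<in>r ` Gam. adj f ** x \<in> Gcong a" if "x \<in> Gam" for x
      using r[OF that] that sym by (auto simp: R_def)
    show "f = f'" if ff: "f \<in> r ` Gam" "f' \<in> r ` Gam" "adj f ** f' \<in> Gcong a" for f f'
    proof -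
      obtain x y where xy: "x \<in> Gam" "y \<in> Gam" "f = r x" "f' = r y" using ff by auto
      have "adj x ** f \<in> Gcong a" "adj y ** f' \<in> Gcong a" "f \<in> Gam" "f' \<in> Gam" using r xy by (auto simp: R_def)
      then have "adj x ** y \<in> Gcong a" using ff(3) trans sym by metis
      then show ?thesis using r_eq xy by simp
    qed
  qed
qed

text \<open>If x and y are congruent modulo a, then x^-1 y is congruent to 1. Hence bounds for
  incongruent sets are bounds for the index.\<close>

lemma incongruent_coset_representatives:
  assumes "F \<subseteq> Gam" "\<And>f f'. f \<in> F \<Longrightarrow> f' \<in> F \<Longrightarrow> adj f ** f' \<in> Gcong a \<Longrightarrow> f = f'"
  shows "incongruent a F"
  unfolding incongruent_def
proof (intro conjI ballI impI)
  show "F \<subseteq> Ord" using assms(1) GamD by blast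
  fix x y assume xy: "x \<in> F" "y \<in> F" "qcong a x y"
  then have "x \<in> Gam" "y \<in> Gam" using assms(1) by auto
  then have "qcong a (adj x ** y) (adj x ** x)" "adj x ** y \<in> Gam"
    using qcong_mult_left[OF _ qcong_sym[OF xy(3)], of "adj x"] GamD Gam_adj Gam_mult by auto
  then have "adj x ** y \<in> Gcong a" using \<open>x \<in> Gam\<close> by (simp add: Gcong_def mult_adj GamD)
  then show "x = y" using assms(2) xy by blast
qed

lemma arithmetic_Gcong:
  assumes "a \<in> Zi" "a \<noteq> 0"
  shows "arithmetic_Kleinian (Gcong a)"
proof -
  obtain F where F: "F \<subseteq> Gam" "\<And>x. x \<in> Gam \<Longrightarrow> \<exists>f\<in>F. adj f ** x \<in> Gcong a"
    "\<And>f f'. f \<in> F \<Longrightarrow> f' \<in> F \<Longrightarrow> adj f ** f' \<in> Gcong a \<Longrightarrow> f = f'"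
    using coset_representatives by metis
  have "finite F" using incongruent_card(1)[OF incongruent_coset_representatives[OF F(1,3)] assms] .
  moreover have "Gam = {f ** h | f h. f \<in> F \<and> h \<in> Gcong a}"
  proof
    show "{f ** h | f h. f \<in> F \<and> h \<in> Gcong a} \<subseteq> Gam"
      using F(1) Gcong_Gam Gam_mult by blast
    show "Gam \<subseteq> {f ** h | f h. f \<in> F \<and> h \<in> Gcong a}"
    proof
      fix x assume "x \<in> Gam"
      then obtain f where f: "f \<in> F" "adj f ** x \<in> Gcong a" using F(2) by blast
      then have "x = f ** (adj f ** x)" using F(1) GamD adj_cancel(2) by (metis subsetD)
      then show "x \<in> {f ** h | f h. f \<in> F \<and> h \<in> Gcong a}" using f by blast
    qed
  qed
  moreover have "Gcong a \<inter> Gam = Gcong a" by (auto simp: Gcong_def)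
  ultimately have "finite_index (Gcong a \<inter> Gam) Gam"
    using F(1) by (auto simp: finite_index_def)
  moreover have "finite_index (Gcong a \<inter> Gam) (Gcong a)"
    unfolding finite_index_def \<open>Gcong a \<inter> Gam = Gcong a\<close>
    by (rule exI[of _ "{mat 1}"]) (auto simp: Gcong_one)
  ultimately have "commensurable (Gcong a) (norm_one_group Ord)"
    by (simp add: commensurable_def norm_one_group_Ord)
  moreover have "\<forall>\<sigma>. real_emb Qi \<sigma> \<longrightarrow> ramified_at Aq ebas \<sigma>" using no_real_emb_Qi by blast
  ultimately show ?thesis
    unfolding arithmetic_Kleinian_def
    using SL2_preimage_group_Gcong discrete_Gcong one_complex_place_Qi quat_alg_Aq is_order_Ord by blast
qed

subsection \<open>Cocompactness\<close>

definition cell :: "real \<Rightarrow> complex \<Rightarrow> int \<times> int" where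
  "cell \<delta> w = (\<lfloor>Re w / \<delta>\<rfloor>, \<lfloor>Im w / \<delta>\<rfloor>)"

definition corner :: "real \<Rightarrow> int \<times> int \<Rightarrow> complex" where
  "corner \<delta> k = Complex (\<delta> * of_int (fst k)) (\<delta> * of_int (snd k))"

lemma cell_corner:
  assumes "\<delta> > 0"
  shows "cmod (w - corner \<delta> (cell \<delta> w)) \<le> 2 * \<delta>"
proof -
  have 1: "\<bar>x - \<delta> * of_int \<lfloor>x / \<delta>\<rfloor>\<bar> \<le> \<delta>" for x
  proof -
    have "x - \<delta> * of_int \<lfloor>x / \<delta>\<rfloor> = \<delta> * (x / \<delta> - of_int \<lfloor>x / \<delta>\<rfloor>)"
      using assms by (simp add: algebra_simps)
    moreover have "0 \<le> x / \<delta> - of_int \<lfloor>x / \<delta>\<rfloor>" "x / \<delta> - of_int \<lfloor>x / \<delta>\<rfloor> \<le> 1" by linarith+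
    ultimately show ?thesis using assms by (simp add: abs_mult)
  qed
  have "cmod (w - corner \<delta> (cell \<delta> w)) \<le> \<bar>Re (w - corner \<delta> (cell \<delta> w))\<bar> + \<bar>Im (w - corner \<delta> (cell \<delta> w))\<bar>"
    by (rule cmod_le)
  also have "\<dots> \<le> \<delta> + \<delta>"
    using 1[of "Re w"] 1[of "Im w"] by (simp add: corner_def cell_def)
  finally show ?thesis by simp
qed

lemma cell_eq_close:
  assumes "\<delta> > 0" "cell \<delta> w = cell \<delta> w'"
  shows "cmod (w - w') \<le> 2 * \<delta>"
proof -
  have 1: "\<bar>x - y\<bar> \<le> \<delta>" if "\<lfloor>x / \<delta>\<rfloor> = \<lfloor>y / \<delta>\<rfloor>" for x y
  proof -
    have "x - y = \<delta> * (x / \<delta> - y / \<delta>)" using assms by (simp add: algebra_simps)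
    moreover have "\<bar>x / \<delta> - y / \<delta>\<bar> \<le> 1" using that by linarith
    ultimately show ?thesis using assms by (simp add: abs_mult)
  qed
  have "cmod (w - w') \<le> \<bar>Re (w - w')\<bar> + \<bar>Im (w - w')\<bar>" by (rule cmod_le)
  also have "\<dots> \<le> \<delta> + \<delta>"
    using 1[of "Re w" "Re w'"] 1[of "Im w" "Im w'"] assms(2) by (simp add: cell_def)
  finally show ?thesis by simp
qed

lemma cell_bounded:
  assumes "\<delta> > 0" "cmod w \<le> A"
  shows "cell \<delta> w \<in> {- \<lceil>A / \<delta>\<rceil> .. \<lceil>A / \<delta>\<rceil>} \<times> {- \<lceil>A / \<delta>\<rceil> .. \<lceil>A / \<delta>\<rceil>}"
proof -
  have 1: "- \<lceil>A / \<delta>\<rceil> \<le> \<lfloor>x / \<delta>\<rfloor> \<and> \<lfloor>x / \<delta>\<rfloor> \<le> \<lceil>A / \<delta>\<rceil>" if "\<bar>x\<bar> \<le> A" for x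
  proof -
    have "x / \<delta> \<le> A / \<delta>" "- (A / \<delta>) \<le> x / \<delta>"
      using that assms(1) by (simp_all add: divide_right_mono minus_divide_left del: minus_divide_left[symmetric])
    then show ?thesis by linarith
  qed
  have "\<bar>Re w\<bar> \<le> A" "\<bar>Im w\<bar> \<le> A" using abs_Re_le_cmod[of w] abs_Im_le_cmod[of w] assms(2) by linarith+
  then show ?thesis using 1 by (simp add: cell_def)
qed

text \<open>Pigeonhole on lattice points. The second row of cells is sheared by the first one, so
  that the number of cells does not depend on the point \<open>p\<close>.\<close>
lemma short_element_exists:
  assumes p: "p \<in> H3"
  shows "\<exists>x\<in>Ord. x \<noteq> 0 \<and> norm (x ** hmat p) \<le> 4000"
proof -
  obtain z t where zt: "p = (z, t)" by (cases p)
  have t: "t > 0" using p zt by (simp add: H3_def)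
  define \<sigma> where "\<sigma> = sqrt t"
  have s: "\<sigma> > 0" using t by (simp add: \<sigma>_def)
  \<comment> \<open>Right multiplication by \<open>hmat p\<close> scales the first column by
    \<sigma> and divides the sheared second column by \<sigma>. Cells of these sides therefore leave
    entries of modulus at most 2000.\<close>
  define \<delta> \<epsilon> where "\<delta> = 1000 / \<sigma>" "\<epsilon> = 1000 * \<sigma>"
  note de = this
  have dpos: "\<delta> > 0" "\<epsilon> > 0" and dmul: "\<delta> * \<epsilon> = 1000000" using s by (simp_all add: de)
  \<comment> \<open>\<open>M\<close> dominates every cell size, so that rounding up the number of
    cells costs only a constant factor.\<close>
  obtain M :: nat where M: "real M \<ge> max 1 (max \<delta> (max (cmod z * \<delta>) \<epsilon>))"
    using real_arch_simple by blast
  have M1: "real M \<ge> 1" "real M \<ge> \<delta>" "real M \<ge> cmod z * \<delta>" "real M \<ge> \<epsilon>" using M by auto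
  define grid where "grid = (\<lambda>(k, l). Complex (of_nat k) (of_nat l)) ` ({..M} \<times> {..M})"
  define X where "X = (\<lambda>(x0, x1, x2, x3). qmat x0 x1 x2 x3) ` (grid \<times> grid \<times> grid \<times> grid)"
  have "inj_on (\<lambda>(k, l). Complex (of_nat k) (of_nat l)) ({..M} \<times> {..M})"
    by (auto simp: inj_on_def)
  then have cgrid: "card grid = (M + 1)\<^sup>2"
    by (simp add: grid_def card_image card_cartesian_product power2_eq_square)
  have "inj_on (\<lambda>(x0, x1, x2, x3). qmat x0 x1 x2 x3) (grid \<times> grid \<times> grid \<times> grid)"
    by (auto simp: inj_on_def qmat_eq_iff)
  then have cX: "card X = (M + 1) ^ 8"
    unfolding X_def by (simp add: card_image card_cartesian_product cgrid flip: power_add)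
  have grid: "w \<in> Zi" "cmod w \<le> 2 * real M" if w: "w \<in> grid" for w
  proof -
    obtain k l where kl: "w = Complex (of_nat k) (of_nat l)" "k \<le> M" "l \<le> M" using w by (auto simp: grid_def)
    then show "w \<in> Zi" by (simp add: Zi_def)
    have "cmod w \<le> real k + real l" using cmod_le[of w] kl by simp
    then show "cmod w \<le> 2 * real M" using kl by linarith
  qed
  have XOrd: "X \<subseteq> Ord" using grid(1) by (auto simp: X_def)
  have r8: "cmod r8 \<le> 3"
    by (simp add: r8_def real_le_lsqrt)
  have Xent: "cmod (x$i$j) \<le> 160 * real M" if "x \<in> X" for x i j
  proof -
    obtain x0 x1 x2 x3 where x: "x = qmat x0 x1 x2 x3" "x0 \<in> grid" "x1 \<in> grid" "x2 \<in> grid" "x3 \<in> grid"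
      using \<open>x \<in> X\<close> by (auto simp: X_def)
    have pm: "cmod (u + r8 * v) \<le> 8 * real M" "cmod (u - r8 * v) \<le> 8 * real M" if "u \<in> grid" "v \<in> grid" for u v
    proof -
      have "cmod (r8 * v) \<le> 3 * (2 * real M)" unfolding norm_mult by (intro mult_mono r8 grid that) auto
      then show "cmod (u + r8 * v) \<le> 8 * real M" "cmod (u - r8 * v) \<le> 8 * real M"
        using norm_triangle_ineq[of u "r8 * v"] norm_triangle_ineq4[of u "r8 * v"] grid(2)[OF that(1)] by linarith+
    qed
    have "(i = 1 \<or> i = 2) \<and> (j = 1 \<or> j = 2)" using exhaust_2 by blast
    then show ?thesis
      using pm[OF x(2,3)] pm[OF x(4,5)]
      by (auto simp: x(1) qmat_def norm_mult distrib_left[symmetric] simp del: distrib_left_numeral)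
  qed
  define A1 A2 where "A1 = 160 * real M" "A2 = 480 * real M"
  note A = this
  \<comment> \<open>Points whose first coordinates lie in one cell share the corner, so the
    difference of their \<open>sh\<close> values is the true difference of v + z u, while
    \<open>sh\<close> itself stays bounded independently of the size of z u.\<close>
  define sh where "sh u v = v + z * (u - corner \<delta> (cell \<delta> u))" for u v
  define f where "f x = (cell \<delta> (x$1$1), cell \<delta> (x$2$1), cell \<epsilon> (sh (x$1$1) (x$1$2)), cell \<epsilon> (sh (x$2$1) (x$2$2)))" for x :: cmat
  have sh_bound: "cmod (sh u v) \<le> A2" if "cmod v \<le> A1" for u v
  proof -
    have "cmod (z * (u - corner \<delta> (cell \<delta> u))) \<le> cmod z * (2 * \<delta>)"
      unfolding norm_mult by (intro mult_left_mono cell_corner dpos) simp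
    then have "cmod (sh u v) \<le> A1 + 2 * (cmod z * \<delta>)"
      unfolding sh_def using norm_triangle_ineq[of v "z * (u - corner \<delta> (cell \<delta> u))"] that by linarith
    then show ?thesis using M1(3) by (simp add: A)
  qed
  let ?I = "{- \<lceil>A1 / \<delta>\<rceil> .. \<lceil>A1 / \<delta>\<rceil>}" and ?J = "{- \<lceil>A2 / \<epsilon>\<rceil> .. \<lceil>A2 / \<epsilon>\<rceil>}"
  have fim: "f ` X \<subseteq> (?I \<times> ?I) \<times> (?I \<times> ?I) \<times> (?J \<times> ?J) \<times> (?J \<times> ?J)"
  proof
    fix y assume "y \<in> f ` X"
    then obtain x where x: "x \<in> X" "y = f x" by auto
    have e: "cmod (x$i$j) \<le> A1" for i j using Xent[OF x(1)] by (simp add: A)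
    show "y \<in> (?I \<times> ?I) \<times> (?I \<times> ?I) \<times> (?J \<times> ?J) \<times> (?J \<times> ?J)"
      unfolding x(2) f_def
      using cell_bounded[OF dpos(1) e[of 1 1]] cell_bounded[OF dpos(1) e[of 2 1]]
        cell_bounded[OF dpos(2) sh_bound[OF e[of 1 2]], of "x$1$1"] cell_bounded[OF dpos(2) sh_bound[OF e[of 2 2]], of "x$2$1"]
      by blast
  qed
  have cI: "real (card {- \<lceil>u\<rceil> .. \<lceil>u\<rceil>}) \<le> 3 * u" if "u \<ge> 3" for u :: real
    using that by (simp, linarith)
  have "A1 / \<delta> \<ge> 160" "A2 / \<epsilon> \<ge> 480" using M1 dpos by (simp_all add: A le_divide_eq)
  then have cIJ: "real (card ?I) \<le> 480 * real M / \<delta>" "real (card ?J) \<le> 1440 * real M / \<epsilon>"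
    using cI[of "A1 / \<delta>"] cI[of "A2 / \<epsilon>"] by (simp_all add: A)
  have "\<not> inj_on f X"
  proof
    assume "inj_on f X"
    then have "card X \<le> card ((?I \<times> ?I) \<times> (?I \<times> ?I) \<times> (?J \<times> ?J) \<times> (?J \<times> ?J))"
      using fim by (rule card_inj_on_le) simp
    also have "\<dots> = (card ?I * card ?J) ^ 4"
      by (simp only: card_cartesian_product power4_eq_xxxx) (simp only: ac_simps)
    finally have "real ((M + 1) ^ 8) \<le> (real (card ?I) * real (card ?J)) ^ 4"
      unfolding cX by (metis of_nat_le_iff of_nat_mult of_nat_power)
    also have "\<dots> \<le> ((480 * real M / \<delta>) * (1440 * real M / \<epsilon>)) ^ 4"
      using dpos by (intro power_mono mult_mono cIJ) auto
    also have "(480 * real M / \<delta>) * (1440 * real M / \<epsilon>) = (480 * 1440) * (real M)\<^sup>2 / (\<delta> * \<epsilon>)"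
      by (simp add: power2_eq_square)
    \<comment> \<open>The reason for 1000: the product 480 * 1440 = 691200 is below \<delta>
      \<epsilon> = 1000000, so there are fewer cells than lattice points.\<close>
    also have "(\<dots>) ^ 4 \<le> ((real M)\<^sup>2) ^ 4"
      unfolding dmul by (rule power_mono) simp_all
    finally have "real ((M + 1) ^ 8) \<le> ((real M)\<^sup>2) ^ 4" .
    then have "real ((M + 1) ^ 8) \<le> real (M ^ 8)" by (simp flip: power_mult)
    then have "(M + 1) ^ 8 \<le> M ^ 8" by (simp only: of_nat_le_iff)
    then show False using power_less_imp_less_base[of "M" 8 "M + 1"] power_strict_mono[of M "M + 1" 8] by simp
  qed
  then obtain x y where xy: "x \<in> X" "y \<in> X" "x \<noteq> y" "f x = f y" by (auto simp: inj_on_def)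
  define d where "d = x - y"
  have d11: "cmod (d$1$1) \<le> 2 * \<delta>" "cmod (d$2$1) \<le> 2 * \<delta>"
    using xy(4) cell_eq_close[OF dpos(1)] by (auto simp: f_def d_def)
  have e: "cell \<delta> (x$1$1) = cell \<delta> (y$1$1)" "cell \<delta> (x$2$1) = cell \<delta> (y$2$1)"
    using xy(4) by (auto simp: f_def)
  have "cmod (sh (x$1$1) (x$1$2) - sh (y$1$1) (y$1$2)) \<le> 2 * \<epsilon>"
    "cmod (sh (x$2$1) (x$2$2) - sh (y$2$1) (y$2$2)) \<le> 2 * \<epsilon>"
    using xy(4) cell_eq_close[OF dpos(2)] by (auto simp: f_def)
  then have d12: "cmod (d$1$1 * z + d$1$2) \<le> 2 * \<epsilon>" "cmod (d$2$1 * z + d$2$2) \<le> 2 * \<epsilon>"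
    unfolding sh_def e by (simp_all add: d_def algebra_simps)
  have col1: "cmod (u * complex_of_real \<sigma>) \<le> 2000" if "cmod u \<le> 2 * \<delta>" for u
  proof -
    have "cmod u * \<sigma> \<le> (2 * \<delta>) * \<sigma>" using that s by (intro mult_right_mono) auto
    then show ?thesis using s by (simp add: norm_mult de)
  qed
  have col2: "cmod (u * (z / complex_of_real \<sigma>) + v * (1 / complex_of_real \<sigma>)) \<le> 2000" if "cmod (u * z + v) \<le> 2 * \<epsilon>" for u v
  proof -
    have "u * (z / complex_of_real \<sigma>) + v * (1 / complex_of_real \<sigma>) = (u * z + v) / complex_of_real \<sigma>"
      by (simp add: add_divide_distrib)
    then have "cmod (u * (z / complex_of_real \<sigma>) + v * (1 / complex_of_real \<sigma>)) = cmod (u * z + v) / \<sigma>"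
      using s by (simp add: norm_divide)
    also have "\<dots> \<le> 2 * \<epsilon> / \<sigma>" using that s by (intro divide_right_mono) auto
    finally show ?thesis using s by (simp add: de)
  qed
  have h: "hmat p = mk (complex_of_real \<sigma>) (z / complex_of_real \<sigma>) 0 (1 / complex_of_real \<sigma>)"
    by (simp add: hmat_def zt \<sigma>_def)
  have sq: "(cmod w)\<^sup>2 \<le> 2000\<^sup>2" if "cmod w \<le> 2000" for w by (rule power_mono[OF that]) simp
  have "(norm (d ** hmat p))\<^sup>2 \<le> 2000\<^sup>2 + 2000\<^sup>2 + 2000\<^sup>2 + 2000\<^sup>2"
    unfolding norm_cmat_sq h mm_sel mk_sel mult_zero_right add_0_right
    by (intro add_mono sq col1 col2 d11 d12)
  then have "(norm (d ** hmat p))\<^sup>2 \<le> 4000\<^sup>2" by simp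
  then have "norm (d ** hmat p) \<le> 4000" by (rule power2_le_imp_le) simp
  moreover have "d \<in> Ord" "d \<noteq> 0" using xy XOrd by (auto simp: d_def intro: Ord_diff)
  ultimately show ?thesis by blast
qed


lemma norm_det_le: "cmod (det (m::cmat)) \<le> (norm m)\<^sup>2"
proof -
  have "cmod (det m) \<le> cmod (m$1$1) * cmod (m$2$2) + cmod (m$1$2) * cmod (m$2$1)"
    unfolding det_cmat using norm_triangle_ineq4[of "m$1$1 * m$2$2" "m$1$2 * m$2$1"] by (simp add: norm_mult)
  also have "\<dots> \<le> (norm m)\<^sup>2"
    using sum_squares_bound[of "cmod (m$1$1)" "cmod (m$2$2)"] sum_squares_bound[of "cmod (m$1$2)" "cmod (m$2$1)"]
      zero_le_power2[of "cmod (m$1$1)"] zero_le_power2[of "cmod (m$1$2)"]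
      zero_le_power2[of "cmod (m$2$1)"] zero_le_power2[of "cmod (m$2$2)"]
      mult_nonneg_nonneg[OF norm_ge_zero norm_ge_zero, of "m$1$1" "m$2$2"]
      mult_nonneg_nonneg[OF norm_ge_zero norm_ge_zero, of "m$1$2" "m$2$1"]
    unfolding norm_cmat_sq by linarith
  finally show ?thesis .
qed

lemma mat_cancel: "a \<noteq> 0 \<Longrightarrow> mat a ** x = mat a ** y \<Longrightarrow> x = (y::cmat)"
  by (simp add: cmat_eq_iff)

lemma det_scale: "det (mat a ** x) = a\<^sup>2 * det (x::cmat)"
  by (simp add: det_cmat power2_eq_square algebra_simps)

text \<open>If x and x0 have the same norm \<nu> and are congruent modulo \<nu>, then
  \<open>adj x0 ** x\<close> is divisible by \<nu>, and the quotient has norm 1. So one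
  representative for each pair of a norm and a residue suffices.\<close>

lemma finitely_many_classes_of_det:
  "\<exists>X. finite X \<and> X \<subseteq> Ord \<and> (\<forall>x0\<in>X. x0 \<noteq> 0) \<and>
     (\<forall>x\<in>Ord. x \<noteq> 0 \<longrightarrow> cmod (det x) \<le> C \<longrightarrow> (\<exists>x0\<in>X. \<exists>\<gamma>\<in>Gam. x = x0 ** \<gamma>))"
proof -
  define I where "I = (SIGMA \<nu>:{\<nu> \<in> Zi. cmod \<nu> \<le> C}. residues_mod \<nu>)"
  define Q where "Q = (\<lambda>(\<nu>, r) x. x \<in> Ord \<and> x \<noteq> 0 \<and> det x = \<nu> \<and> qcong \<nu> x r)"
  define X where "X = (\<lambda>i. SOME x. Q i x) ` {i \<in> I. \<exists>x. Q i x}"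
  have "finite I" by (auto simp: I_def finite_Zi_ball finite_residues)
  then have fin: "finite X" by (simp add: X_def)
  have XQ: "\<exists>i\<in>I. Q i x" if "x \<in> X" for x
  proof -
    obtain i where i: "i \<in> I" "\<exists>x. Q i x" "x = (SOME x. Q i x)" using \<open>x \<in> X\<close> unfolding X_def by blast
    then show ?thesis using someI_ex[OF i(2)] by metis
  qed
  show ?thesis
  proof (rule exI[of _ X], intro conjI ballI impI)
    show "X \<subseteq> Ord" "\<And>x. x \<in> X \<Longrightarrow> x \<noteq> 0" using XQ by (auto simp: Q_def)
    fix x assume x: "x \<in> Ord" "x \<noteq> 0" "cmod (det x) \<le> C"
    define \<nu> where "\<nu> = det x"
    have \<nu>: "\<nu> \<in> Zi" "\<nu> \<noteq> 0" using x Ord_det Ord_det_eq_0 by (auto simp: \<nu>_def)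
    obtain r where r: "r \<in> residues_mod \<nu>" "r \<in> Ord" "qcong \<nu> x r"
      using residue_exists[OF x(1) \<nu>] .
    have Qx: "Q (\<nu>, r) x" using x r by (simp add: Q_def \<nu>_def)
    have iI: "(\<nu>, r) \<in> I" using \<nu> x r by (simp add: I_def \<nu>_def)
    define x0 where "x0 = (SOME x. Q (\<nu>, r) x)"
    have "x0 \<in> X" unfolding X_def x0_def using Qx iI by blast
    have "Q (\<nu>, r) x0" unfolding x0_def by (rule someI[where P = "Q (\<nu>, r)" and x = x]) (rule Qx)
    then have x0: "x0 \<in> Ord" "det x0 = \<nu>" "qcong \<nu> x0 r" by (auto simp: Q_def)
    have "qcong \<nu> x x0" using r(3) x0(3) qcong_trans qcong_sym by metis
    then have "qcong \<nu> (adj x0 ** x) (adj x0 ** x0)" by (rule qcong_mult_left[OF Ord_adj[OF x0(1)]])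
    then obtain y where y: "y \<in> Ord" "adj x0 ** x = mat \<nu> + mat \<nu> ** y"
      by (auto simp: qcong_def mult_adj x0)
    define \<gamma> where "\<gamma> = mat 1 + y"
    have g: "adj x0 ** x = mat \<nu> ** \<gamma>" by (simp add: y \<gamma>_def cmat_distrib)
    have "mat \<nu> ** x = x0 ** (adj x0 ** x)" by (simp add: matrix_mul_assoc mult_adj x0)
    also have "\<dots> = mat \<nu> ** (x0 ** \<gamma>)" by (simp add: g mat_mult_left_commute)
    finally have xg: "x = x0 ** \<gamma>" by (rule mat_cancel[OF \<nu>(2)])
    then have "\<nu> = \<nu> * det \<gamma>" using det_mul[of x0 \<gamma>] x0 by (simp add: \<nu>_def)
    then have "\<gamma> \<in> Gam" using \<nu> y by (simp add: Gam_def \<gamma>_def Ord_closed)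
    then show "\<exists>x0\<in>X. \<exists>\<gamma>\<in>Gam. x = x0 ** \<gamma>" using xg \<open>x0 \<in> X\<close> by blast
  qed (use fin in auto)
qed

lemma norm_scale: "norm (mat a ** m) = cmod a * norm (m::cmat)"
proof -
  have "(norm (mat a ** m))\<^sup>2 = (cmod a * norm m)\<^sup>2"
    by (simp add: norm_cmat_sq norm_mult power_mult_distrib algebra_simps)
  then show ?thesis by (simp add: power2_eq_iff_nonneg)
qed

text \<open>A nonzero x of the order with \<open>x ** hmat p\<close> short has bounded norm, hence x
  = x0 \<gamma> with x0 from a finite list. Cancelling x0 with its adjugate costs a bounded factor
  because a nonzero norm has modulus at least 1, so \<gamma> brings p close to the base
  point.\<close>

lemma Gam_cocompact:
  obtains C where "C \<ge> 2" "\<And>p. p \<in> H3 \<Longrightarrow> \<exists>\<gamma>\<in>Gam. hnorm (act \<gamma> p) \<le> C"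
proof -
  obtain X where X: "finite X" "X \<subseteq> Ord" "\<forall>x0\<in>X. x0 \<noteq> 0"
    "\<forall>x\<in>Ord. x \<noteq> 0 \<longrightarrow> cmod (det x) \<le> 4000\<^sup>2 \<longrightarrow> (\<exists>x0\<in>X. \<exists>\<gamma>\<in>Gam. x = x0 ** \<gamma>)"
    using finitely_many_classes_of_det[of "4000\<^sup>2"] by (elim exE conjE) (rule that)
  define N where "N = (\<Sum>x\<in>X. norm x)"
  have N: "norm x \<le> N" if "x \<in> X" for x
    unfolding N_def using that X(1) by (intro member_le_sum) auto
  have "\<exists>\<gamma>\<in>Gam. hnorm (act \<gamma> p) \<le> max 2 ((N * 4000)\<^sup>2)" if p: "p \<in> H3" for p
  proof -
    obtain x where x: "x \<in> Ord" "x \<noteq> 0" "norm (x ** hmat p) \<le> 4000" using short_element_exists[OF p] by blast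
    have "det (x ** hmat p) = det x" by (simp add: det_mul det_hmat p)
    then have "cmod (det x) \<le> (norm (x ** hmat p))\<^sup>2" by (metis norm_det_le)
    also have "\<dots> \<le> 4000\<^sup>2" by (rule power_mono[OF x(3)]) simp
    finally obtain x0 \<gamma> where g: "x0 \<in> X" "\<gamma> \<in> Gam" "x = x0 ** \<gamma>" using X(4) x by blast
    have d0: "1 \<le> cmod (det x0)"
      using Zi_norm_ge_1 Ord_det Ord_det_eq_0 X(2,3) g(1) by (metis subsetD)
    have "adj x0 ** (x ** hmat p) = mat (det x0) ** (\<gamma> ** hmat p)"
      by (simp add: g(3) matrix_mul_assoc mult_adj)
    then have "cmod (det x0) * norm (\<gamma> ** hmat p) = norm (adj x0 ** (x ** hmat p))"
      by (simp add: norm_scale)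
    also have "\<dots> \<le> norm x0 * norm (x ** hmat p)" using norm_mult_cmat[of "adj x0"] by simp
    also have "\<dots> \<le> N * 4000" using x(3) N[OF g(1)] order_trans[OF norm_ge_zero N[OF g(1)]] by (intro mult_mono) auto
    finally have "cmod (det x0) * norm (\<gamma> ** hmat p) \<le> N * 4000" .
    moreover have "1 * norm (\<gamma> ** hmat p) \<le> cmod (det x0) * norm (\<gamma> ** hmat p)"
      using d0 by (intro mult_right_mono) auto
    ultimately have "norm (\<gamma> ** hmat p) \<le> N * 4000" by linarith
    then have "hnorm (act \<gamma> p) \<le> (N * 4000)\<^sup>2"
      unfolding hnorm_act[OF GamD(2)[OF g(2)] p] by (rule power_mono) simp
    then show ?thesis using g(2) by force
  qed
  then show thesis using that[of "max 2 ((N * 4000)\<^sup>2)"] by simp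
qed

text \<open>For C at least 2, the closed ball of radius arcosh (C / 2) about the base point.\<close>

definition Kset :: "real \<Rightarrow> hpoint set" where
  "Kset C = {p \<in> H3. hnorm p \<le> C}"

text \<open>Clearing the denominator gives closed conditions on the whole ambient space: height 0 is
  excluded automatically by the summand 1, which yields compactness.\<close>

lemma Kset_eq: "Kset C = {p. 0 \<le> snd p \<and> (cmod (fst p))\<^sup>2 + (snd p)\<^sup>2 + 1 \<le> C * snd p}"
proof -
  have "snd p > 0" if "0 \<le> snd p" "(cmod (fst p))\<^sup>2 + (snd p)\<^sup>2 + 1 \<le> C * snd p" for p :: hpoint
  proof (rule ccontr)
    assume "\<not> ?thesis"
    then have "snd p = 0" using that by simp
    then show False using that zero_le_power2[of "cmod (fst p)"] by simp
  qed
  then show ?thesis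
    by (auto simp: Kset_def H3_def hnorm_def divide_le_eq less_imp_le)
qed

lemma compact_Kset: "compact (Kset C)"
proof (rule compact_eq_bounded_closed[THEN iffD2], rule conjI)
  show "closed (Kset C)"
    unfolding Kset_eq by (intro closed_Collect_conj closed_Collect_le continuous_intros)
  have "norm p \<le> 2 * \<bar>C\<bar>" if p: "p \<in> Kset C" for p
  proof -
    have 1: "0 \<le> snd p" "(cmod (fst p))\<^sup>2 + (snd p)\<^sup>2 \<le> C * snd p" using p unfolding Kset_eq by auto
    have s: "snd p \<le> \<bar>C\<bar>"
    proof (cases "snd p = 0")
      case False
      have "snd p * snd p \<le> C * snd p" using 1 zero_le_power2[of "cmod (fst p)"] power2_eq_square[of "snd p"] by linarith
      then show ?thesis using False 1(1) by simp
    qed simp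
    have "(cmod (fst p))\<^sup>2 \<le> C * snd p" using 1 zero_le_power2[of "snd p"] by linarith
    also have "\<dots> \<le> \<bar>C\<bar> * \<bar>C\<bar>" using s 1(1) by (intro mult_mono) auto
    finally have "(cmod (fst p))\<^sup>2 \<le> \<bar>C\<bar>\<^sup>2" unfolding power2_eq_square[of "\<bar>C\<bar>"] .
    then have "cmod (fst p) \<le> \<bar>C\<bar>" by (rule power2_le_imp_le) simp
    then show ?thesis using norm_Pair_le[of "fst p" "snd p"] s 1(1) by simp
  qed
  then show "bounded (Kset C)" unfolding bounded_iff by blast
qed

lemma Kset_borel: "Kset C \<in> sets borel"
  by (rule borel_closed[OF compact_imp_closed[OF compact_Kset]])

lemma Kset_H3: "Kset C \<subseteq> H3"
  by (auto simp: Kset_def)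

lemma hypvol_Kset_finite: "hypvol (Kset C) < \<infinity>"
proof -
  have "1 / (snd p)^3 \<le> \<bar>C\<bar>^3" if p: "p \<in> Kset C" for p
  proof -
    have "snd p > 0" "(cmod (fst p))\<^sup>2 + (snd p)\<^sup>2 + 1 \<le> C * snd p" using p Kset_H3 unfolding Kset_eq H3_def by (auto simp: Kset_eq)
    then have "1 \<le> \<bar>C\<bar> * snd p"
      using zero_le_power2[of "cmod (fst p)"] zero_le_power2[of "snd p"] mult_right_mono[of C "\<bar>C\<bar>" "snd p"] by linarith
    then have "1 / snd p \<le> \<bar>C\<bar>" using \<open>snd p > 0\<close> by (simp add: divide_le_eq)
    then have "(1 / snd p)^3 \<le> \<bar>C\<bar>^3" using \<open>snd p > 0\<close> by (intro power_mono) auto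
    then show ?thesis by (simp add: power_divide)
  qed
  then have "hypvol (Kset C) \<le> (\<integral>\<^sup>+p. ennreal (\<bar>C\<bar>^3) * indicator (Kset C) p \<partial>lborel)"
    unfolding hypvol_def by (intro nn_integral_mono) (auto simp: indicator_def intro!: ennreal_leI)
  also have "\<dots> = ennreal (\<bar>C\<bar>^3) * emeasure lborel (Kset C)"
    using Kset_borel by (intro nn_integral_cmult_indicator) simp
  also have "\<dots> < \<infinity>"
    using emeasure_compact_finite[OF compact_Kset, of C] by (simp add: ennreal_mult_less_top)
  finally show ?thesis .
qed

subsection \<open>Displacement in congruence subgroups\<close>

text \<open>Four times the hyperbolic cosine of the translation length of an element of trace \<open>t\<close>.\<close>
definition fl :: "complex \<Rightarrow> real" where
  "fl t = (cmod t)\<^sup>2 + cmod (t\<^sup>2 - 4)"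

lemma fl_uminus [simp]: "fl (- t) = fl t"
  by (simp add: fl_def)

lemma trace_uminus_cmat [simp]: "trace (- x) = - trace (x::cmat)"
  by (simp add: trace_cmat)

lemma trace_scale: "trace (mat a ** x) = a * trace (x::cmat)"
  by (simp add: trace_cmat algebra_simps)

lemma trace_mat: "trace (mat a :: cmat) = 2 * a"
  by (simp add: trace_cmat)

lemma det_add_scale: "det (x + mat a ** y) = det x + a * trace (x ** adj y) + a\<^sup>2 * det (y::cmat)"
  by (simp add: det_cmat trace_cmat algebra_simps power2_eq_square)

text \<open>Write x or -x as 1 + a z. Norm 1 forces the trace of z to be -a det z, which is
  precisely the relation under which \<open>Ord_det_unit\<close>, applied with the element y of
  trace a, excludes the units other than 1.\<close>

lemma Gcong_cases:
  assumes y: "y \<in> Gam" "trace y = a" and a: "a \<noteq> 0"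
    and x: "x \<in> Gcong a" "nontrivial_elt x"
  obtains u where "u \<in> Zi" "u = 1 \<or> (cmod u)\<^sup>2 \<ge> 2" "trace x = 2 - a\<^sup>2 * u \<or> trace x = - (2 - a\<^sup>2 * u)"
proof -
  have "\<exists>z\<in>Ord. x = mat 1 + mat a ** z \<or> x = - (mat 1 + mat a ** z)"
  proof -
    consider "qcong a x (mat 1)" | "qcong a (- x) (mat 1)"
      using x(1) qcong_uminus[of a x "- mat 1"] by (auto simp: Gcong_def)
    then show ?thesis
    proof cases
      case 2
      then obtain z where "z \<in> Ord" "- x = mat 1 + mat a ** z" by (auto simp: qcong_def)
      then show ?thesis by (metis minus_minus)
    qed (auto simp: qcong_def)
  qed
  then obtain z where z: "z \<in> Ord" "x = mat 1 + mat a ** z \<or> x = - (mat 1 + mat a ** z)" by blast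
  have "det x = 1" using x(1) Gcong_Gam GamD by blast
  then have "det (mat 1 + mat a ** z) = 1" using z(2) det_uminus_cmat by metis
  then have "a * (trace z + a * det z) = 0"
    unfolding det_add_scale by (simp add: det_cmat trace_cmat power2_eq_square algebra_simps)
  then have tz: "trace z = - (a * det z)" using a by (simp add: eq_neg_iff_add_eq_0)
  have tx: "trace (mat 1 + mat a ** z) = 2 - a\<^sup>2 * det z"
    by (simp add: trace_add trace_scale trace_mat tz power2_eq_square)
  have "det z \<noteq> 0"
  proof
    assume "det z = 0"
    then have "z = 0" using Ord_det_eq_0 z(1) by blast
    then have "mat 1 + mat a ** z = mat 1" by (simp add: cmat_eq_iff)
    then show False using x(2) z(2) by (auto simp: nontrivial_elt_def)
  qed
  then have "det z = 1 \<or> (cmod (det z))\<^sup>2 \<ge> 2"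
    using Zi_norm_sq_cases[OF Ord_det[OF z(1)]] Ord_det_unit[OF z(1), of y] y tz GamD by auto
  then show thesis using that[of "det z"] Ord_det[OF z(1)] z(2) tx trace_uminus_cmat by metis
qed

lemma fl_two_minus:
  "fl (2 - w) = (cmod (2 - w))\<^sup>2 + cmod w * cmod (w - 4)"
proof -
  have "(2 - w)\<^sup>2 - 4 = w * (w - 4)" by (simp add: power2_eq_square algebra_simps)
  then show ?thesis by (simp add: fl_def norm_mult)
qed

lemma fl_lower:
  assumes "cmod w \<ge> 4"
  shows "fl (2 - w) \<ge> (cmod w - 2)\<^sup>2 + cmod w * (cmod w - 4)"
proof -
  have "cmod w - 2 \<le> cmod (2 - w)" "cmod w - 4 \<le> cmod (w - 4)"
    using norm_triangle_ineq2[of w 2] norm_triangle_ineq2[of w 4] by (simp_all add: norm_minus_commute)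
  then show ?thesis unfolding fl_two_minus using assms
    by (intro add_mono power_mono mult_left_mono) auto
qed

lemma fl_upper: "fl (2 - w) \<le> (cmod w + 2)\<^sup>2 + cmod w * (cmod w + 4)"
proof -
  have "cmod (2 - w) \<le> cmod w + 2" "cmod (w - 4) \<le> cmod w + 4"
    using norm_triangle_ineq4[of 2 w] norm_triangle_ineq4[of w 4] by simp_all
  then show ?thesis unfolding fl_two_minus
    by (intro add_mono power_mono mult_left_mono) auto
qed

text \<open>For u = 1 the trace is a^2 - 2 up to sign. Otherwise |u|^2 is at least 2, and the
  leading term 2 |a|^4 |u|^2 of \<open>fl\<close> exceeds 2 |a|^4 by enough to absorb the terms of
  order |a|^2.\<close>

lemma Gcong_fl_ge:
  assumes y: "y \<in> Gam" "trace y = a" and a: "cmod a \<ge> 4"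
    and x: "x \<in> Gcong a" "nontrivial_elt x"
  shows "fl (trace x) \<ge> fl (a\<^sup>2 - 2)" "cmod (trace x) \<ge> 3"
proof -
  have "a \<noteq> 0" using a by auto
  then obtain u where u: "u \<in> Zi" "u = 1 \<or> (cmod u)\<^sup>2 \<ge> 2" "trace x = 2 - a\<^sup>2 * u \<or> trace x = - (2 - a\<^sup>2 * u)"
    using Gcong_cases[OF y _ x] by blast
  define A where "A = (cmod a)\<^sup>2"
  have A: "A \<ge> 16" using power_mono[OF a, of 2] by (simp add: A_def)
  have f0: "fl (a\<^sup>2 - 2) = fl (2 - a\<^sup>2)" using fl_uminus[of "2 - a\<^sup>2"] by simp
  have fx: "fl (trace x) = fl (2 - a\<^sup>2 * u)" "cmod (trace x) = cmod (2 - a\<^sup>2 * u)"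
    using u(3) fl_uminus norm_minus_cancel by metis+
  have nW: "cmod (a\<^sup>2 * u) = A * cmod u" by (simp add: A_def norm_mult norm_power)
  have u1: "cmod u \<ge> 1" using u(2) abs_le_square_iff[of 1 "cmod u"] by auto
  have W1: "A * cmod u \<ge> A" using u1 A by (simp add: mult_le_cancel_left1)
  have "A * cmod u - 2 \<le> cmod (2 - a\<^sup>2 * u)"
    using norm_triangle_ineq2[of "a\<^sup>2 * u" 2] nW by (simp add: norm_minus_commute)
  then show "cmod (trace x) \<ge> 3" using W1 A fx by linarith
  show "fl (trace x) \<ge> fl (a\<^sup>2 - 2)"
  proof (cases "u = 1")
    case True
    then show ?thesis using fx f0 by simp
  next
    case False
    then have "(cmod u)\<^sup>2 \<ge> 2" using u(2) by simp
    \<comment> \<open>14/10 is a rational lower bound for the square root of 2.\<close>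
    then have "(14/10)\<^sup>2 \<le> (cmod u)\<^sup>2" by (simp add: power2_eq_square)
    then have "14/10 \<le> cmod u" by (rule power2_le_imp_le) simp
    then have "A * (14/10) \<le> A * cmod u" using A by (intro mult_left_mono) auto
    define W where "W = A * cmod u"
    have W: "W \<ge> 14/10 * A" using \<open>A * (14/10) \<le> _\<close> by (simp add: W_def)
    have "fl (2 - a\<^sup>2) \<le> (A + 2)\<^sup>2 + A * (A + 4)"
      using fl_upper[of "a\<^sup>2"] by (simp add: A_def norm_power)
    also have "\<dots> = 2 * (A * A) + 8 * A + 4" by (simp add: power2_eq_square algebra_simps)
    also have "\<dots> \<le> 2 * (W * W) - 8 * W + 4"
    proof -
      have "0 \<le> (W - 14/10 * A) * (W + 14/10 * A - 4)" using W A by (intro mult_nonneg_nonneg) auto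
      then have "W * W - 4 * W \<ge> 196/100 * (A * A) - 56/10 * A" by (simp add: algebra_simps)
      moreover have "A * A \<ge> 16 * A" using A by (intro mult_right_mono) auto
      ultimately show ?thesis using A by linarith
    qed
    also have "\<dots> = (W - 2)\<^sup>2 + W * (W - 4)" by (simp add: power2_eq_square algebra_simps)
    also have "\<dots> \<le> fl (2 - a\<^sup>2 * u)"
      using fl_lower[of "a\<^sup>2 * u"] W A unfolding nW W_def[symmetric] by linarith
    finally show ?thesis using fx f0 by simp
  qed
qed

lemma fl_ge_sq:
  assumes "cmod a \<ge> 4"
  shows "fl (a\<^sup>2 - 2) \<ge> ((cmod a)\<^sup>2 - 2)\<^sup>2"
proof -
  have "(cmod a)\<^sup>2 \<ge> 16" using power_mono[OF assms, of 2] by simp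
  then show ?thesis
    using fl_lower[of "a\<^sup>2"] fl_uminus[of "2 - a\<^sup>2"] by (simp add: norm_power) (smt (verit) mult_nonneg_nonneg)
qed

lemma displaces_Gcong:
  assumes y: "y \<in> Gam" "trace y = a" and a: "cmod a \<ge> 4"
  shows "displaces (Gcong a) (fl (a\<^sup>2 - 2) / 4)"
  unfolding displaces_def
proof (intro conjI ballI impI)
  have "(cmod a)\<^sup>2 \<ge> 16" using power_mono[OF a, of 2] by simp
  then have "((cmod a)\<^sup>2 - 2)\<^sup>2 \<ge> 14\<^sup>2" by (intro power_mono) auto
  then show "1 < fl (a\<^sup>2 - 2) / 4" using fl_ge_sq[OF a] by simp
  fix x p assume x: "x \<in> Gcong a" "nontrivial_elt x" and p: "p \<in> H3"
  have "det x = 1" using x Gcong_Gam GamD by blast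
  from ch_act_ge[OF this p] show "fl (a\<^sup>2 - 2) / 4 \<le> ch p (act x p)"
    using Gcong_fl_ge(1)[OF y a x] by (simp add: fl_def)
qed

lemma cayley_hamilton: "det (g::cmat) = 1 \<Longrightarrow> g ** g = mat (trace g) ** g - mat 1"
  by (simp add: cmat_eq_iff det_cmat trace_cmat algebra_simps)

text \<open>By Cayley-Hamilton, g^n = u g - v with Chebyshev-type coefficients, and trace of modulus
  at least 3 preserves |u| > |v|. So u is nonzero, and if g^n were 1 or -1, then g would be
  scalar.\<close>

lemma torsion_free_of_trace:
  assumes G: "\<And>g. g \<in> G \<Longrightarrow> det g = 1" "\<And>g. g \<in> G \<Longrightarrow> nontrivial_elt g \<Longrightarrow> cmod (trace g) \<ge> 3"
  shows "torsion_free G"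
  unfolding torsion_free_def
proof (intro ballI allI impI notI)
  fix g and n :: nat
  assume g: "g \<in> G" "n \<ge> 1" "\<not> nontrivial_elt (((\<lambda>x. g ** x) ^^ n) (mat 1))" "nontrivial_elt g"
  have det: "det g = 1" and t: "cmod (trace g) \<ge> 3" using G g by auto
  have "\<exists>u v. ((\<lambda>x. g ** x) ^^ n) (mat 1) = mat u ** g - mat v \<and> cmod u > cmod v"
    using g(2)
  proof (induction n rule: dec_induct)
    case base
    show ?case by (rule exI[of _ 1], rule exI[of _ 0]) (simp add: cmat_eq_iff)
  next
    case (step n)
    then obtain u v where uv: "((\<lambda>x. g ** x) ^^ n) (mat 1) = mat u ** g - mat v" "cmod u > cmod v" by blast
    have "((\<lambda>x. g ** x) ^^ Suc n) (mat 1) = mat u ** (g ** g) - mat v ** g"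
      by (simp add: uv cmat_distrib) (simp add: cmat_eq_iff algebra_simps)
    also have "\<dots> = mat (trace g * u - v) ** g - mat u"
      unfolding cayley_hamilton[OF det] by (simp add: cmat_eq_iff algebra_simps)
    finally have "((\<lambda>x. g ** x) ^^ Suc n) (mat 1) = mat (trace g * u - v) ** g - mat u" .
    moreover have "cmod u < cmod (trace g * u - v)"
    proof -
      have "3 * cmod u \<le> cmod (trace g * u)" unfolding norm_mult using t by (intro mult_right_mono) auto
      then show ?thesis using norm_triangle_ineq2[of "trace g * u" v] uv(2) norm_ge_zero[of v] by linarith
    qed
    ultimately show ?case by blast
  qed
  then obtain u v where uv: "((\<lambda>x. g ** x) ^^ n) (mat 1) = mat u ** g - mat v" "cmod u > cmod v" by blast
  have "u \<noteq> 0" using uv(2) norm_ge_zero[of v] by auto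
  have "mat u ** g - mat v = mat 1 \<or> mat u ** g - mat v = - mat 1"
    using g(3) uv(1) by (simp add: nontrivial_elt_def)
  then have sc: "g$1$2 = 0" "g$2$1 = 0" "g$1$1 = g$2$2"
  proof -
    assume "mat u ** g - mat v = mat 1 \<or> mat u ** g - mat v = - mat 1"
    then have "u * g$1$2 = 0 \<and> u * g$2$1 = 0 \<and> u * g$1$1 = u * g$2$2"
      by (elim disjE) (simp_all add: cmat_eq_iff diff_eq_eq del: mult_cancel_left)
    then show "g$1$2 = 0" "g$2$1 = 0" "g$1$1 = g$2$2"
      using \<open>u \<noteq> 0\<close> mult_left_cancel[OF \<open>u \<noteq> 0\<close>, of "g$1$1" "g$2$2"] by simp_all
  qed
  have "(g$2$2)\<^sup>2 = 1" using det sc by (simp add: det_cmat power2_eq_square)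
  then have "g$2$2 = 1 \<or> g$2$2 = -1" by (simp add: power2_eq_1_iff)
  then have "g = mat 1 \<or> g = - mat 1" using sc by (auto simp: cmat_eq_iff)
  then show False using g(4) by (simp add: nontrivial_elt_def)
qed

lemma torsion_free_Gcong:
  assumes y: "y \<in> Gam" "trace y = a" and a: "cmod a \<ge> 4"
  shows "torsion_free (Gcong a)"
  using Gcong_Gam GamD Gcong_fl_ge(2)[OF y a] by (intro torsion_free_of_trace) blast+

subsection \<open>Volume of the quotients\<close>

definition translates_K :: "cmat set \<Rightarrow> real \<Rightarrow> hpoint set" where
  "translates_K F C = (\<Union>f\<in>F. act (adj f) ` Kset C)"

lemma translates_K_cover:
  assumes F: "F \<subseteq> Gam" "\<And>x. x \<in> Gam \<Longrightarrow> \<exists>f\<in>F. adj f ** x \<in> Gcong a"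
    and C: "\<And>p. p \<in> H3 \<Longrightarrow> \<exists>\<gamma>\<in>Gam. hnorm (act \<gamma> p) \<le> C"
  shows "translates_K F C \<subseteq> H3" "(\<Union>g\<in>Gcong a. act g ` translates_K F C) = H3"
proof -
  have dF: "det f = 1" if "f \<in> F" for f using F(1) GamD that by blast
  show sub: "translates_K F C \<subseteq> H3"
    unfolding translates_K_def using Kset_H3 dF by (intro UN_least image_subsetI act_in_H3) auto
  have dG: "det g = 1" if "g \<in> Gcong a" for g using Gcong_Gam GamD that by blast
  show "(\<Union>g\<in>Gcong a. act g ` translates_K F C) = H3"
  proof
    show "(\<Union>g\<in>Gcong a. act g ` translates_K F C) \<subseteq> H3"
      using sub dG by (auto intro!: act_in_H3)
    show "H3 \<subseteq> (\<Union>g\<in>Gcong a. act g ` translates_K F C)"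
    proof
      fix p assume p: "p \<in> H3"
      obtain \<gamma> where g: "\<gamma> \<in> Gam" "hnorm (act \<gamma> p) \<le> C" using C[OF p] by blast
      obtain f where f: "f \<in> F" "adj f ** \<gamma> \<in> Gcong a" using F(2)[OF g(1)] by blast
      let ?g = "adj f ** \<gamma>"
      have "act \<gamma> p \<in> Kset C" using g p by (simp add: Kset_def act_in_H3 GamD)
      moreover have "act ?g p = act (adj f) (act \<gamma> p)"
        using act_mult[of "adj f" \<gamma> p] dF[OF f(1)] g p GamD by simp
      ultimately have "act ?g p \<in> translates_K F C" using f(1) by (auto simp: translates_K_def)
      moreover have "p = act (adj ?g) (act ?g p)" using act_adj_cancel(1)[OF dG[OF f(2)] p] by simp
      ultimately show "p \<in> (\<Union>g\<in>Gcong a. act g ` translates_K F C)" using Gcong_adj[OF f(2)] by blast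
    qed
  qed
qed

lemma compact_translates_K:
  assumes "finite F" "F \<subseteq> Gam"
  shows "compact (translates_K F C)"
  unfolding translates_K_def
proof (rule compact_UN[OF assms(1)])
  fix f assume "f \<in> F"
  then have "det (adj f) = 1" using assms(2) GamD by auto
  then show "compact (act (adj f) ` Kset C)"
    by (intro compact_continuous_image continuous_on_subset[OF continuous_on_act Kset_H3] compact_Kset)
qed

lemma hypvol_translates_K:
  assumes "finite F" "F \<subseteq> Gam"
  shows "hypvol (translates_K F C) \<le> of_nat (card F) * hypvol (Kset C)"
proof -
  define M where "M = density lborel (\<lambda>p::hpoint. ennreal (1 / (snd p)^3))"
  have [measurable]: "(snd :: hpoint \<Rightarrow> real) \<in> borel_measurable borel"
    by (intro borel_measurable_continuous_onI continuous_intros)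
  have hv: "hypvol E = emeasure M E" if "E \<in> sets borel" for E
    unfolding M_def hypvol_def using that by (subst emeasure_density) auto
  have d: "det (adj f) = 1" if "f \<in> F" for f using assms(2) GamD that by auto
  have b: "act (adj f) ` Kset C \<in> sets borel" if "f \<in> F" for f
    using act_image_borel[OF d[OF that] Kset_H3 Kset_borel] .
  have "hypvol (translates_K F C) = emeasure M (\<Union>f\<in>F. act (adj f) ` Kset C)"
    using compact_imp_closed[OF compact_translates_K[OF assms, of C]] by (simp add: hv translates_K_def)
  also have "\<dots> \<le> (\<Sum>f\<in>F. emeasure M (act (adj f) ` Kset C))"
    using assms(1) b by (intro emeasure_subadditive_finite) (auto simp: M_def)
  also have "\<dots> = (\<Sum>f\<in>F. hypvol (Kset C))"
    using hypvol_act[OF d Kset_borel Kset_H3] b by (intro sum.cong refl) (simp flip: hv)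
  finally show ?thesis by simp
qed

lemma hypvol_covered:
  assumes "finite F" "F \<subseteq> Gam" "B \<subseteq> translates_K F C"
  shows "hypvol B \<le> of_nat (card F) * hypvol (Kset C)"
proof -
  have "hypvol B \<le> hypvol (translates_K F C)"
    unfolding hypvol_def using assms(3) by (intro nn_integral_mono) (auto simp: indicator_def)
  then show ?thesis using hypvol_translates_K[OF assms(1,2), of C] by (rule order_trans)
qed

text \<open>An explicit substitute for a large hyperbolic ball: heights between 1 / X and 2 / X give
  volume of order X^2, while the hyperbolic cosine of the diameter is also of order X^2. It serves
  for the lower bound on the volume and for counting group elements.\<close>

definition thinbox :: "real \<Rightarrow> hpoint set" where
  "thinbox X = cbox (Complex (-1/4) (-1/4), 1 / X) (Complex (1/4) (1/4), 2 / X)"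

lemma thinbox_iff: "p \<in> thinbox X \<longleftrightarrow> \<bar>Re (fst p)\<bar> \<le> 1/4 \<and> \<bar>Im (fst p)\<bar> \<le> 1/4 \<and> 1 / X \<le> snd p \<and> snd p \<le> 2 / X"
  by (auto simp: thinbox_def mem_box Basis_prod_def Basis_complex_def ball_Un inner_complex_def inner_prod_def)

lemma thinbox_borel: "thinbox X \<in> sets borel"
  by (simp add: thinbox_def)

lemma thinbox_H3: "X > 0 \<Longrightarrow> thinbox X \<subseteq> H3"
  by (auto simp: thinbox_iff H3_def intro: less_le_trans[OF divide_pos_pos[OF zero_less_one]])

lemma hypvol_thinbox:
  assumes X: "X > 0"
  shows "hypvol (thinbox X) \<ge> ennreal (X\<^sup>2 / 32)"
proof -
  have "emeasure lborel (thinbox X) = (\<Prod>b\<in>Basis. ((Complex (1/4) (1/4), 2 / X) - (Complex (-1/4) (-1/4), 1 / X)) \<bullet> b)"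
    unfolding thinbox_def using X
    by (subst emeasure_lborel_cbox_eq) (auto simp: Basis_prod_def Basis_complex_def inner_complex_def inner_prod_def divide_right_mono)
  also have "(\<Prod>b\<in>Basis. ((Complex (1/4) (1/4), 2 / X) - (Complex (-1/4) (-1/4), 1 / X)) \<bullet> b) = 1 / (4 * X)"
    using X by (simp add: Basis_prod_def Basis_complex_def prod.union_disjoint inner_prod_def inner_complex_def field_simps)
  finally have e: "emeasure lborel (thinbox X) = ennreal (1 / (4 * X))" .
  have "ennreal (X\<^sup>2 / 32) = ennreal ((X/2)^3) * ennreal (1 / (4 * X))"
    using X by (simp add: power2_eq_square power3_eq_cube field_simps flip: ennreal_mult)
  also have "\<dots> = (\<integral>\<^sup>+p. ennreal ((X/2)^3) * indicator (thinbox X) p \<partial>lborel)"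
    unfolding e[symmetric] using thinbox_borel by (intro nn_integral_cmult_indicator[symmetric]) simp
  also have "\<dots> \<le> hypvol (thinbox X)"
    unfolding hypvol_def
  proof (intro nn_integral_mono)
    fix p :: hpoint
    show "ennreal ((X/2)^3) * indicator (thinbox X) p \<le> ennreal (1 / (snd p)^3) * indicator (thinbox X) p"
    proof (cases "p \<in> thinbox X")
      case True
      then have s: "snd p > 0" "snd p \<le> 2 / X" using thinbox_H3[OF X] by (auto simp: thinbox_iff H3_def)
      then have "X / 2 \<le> 1 / snd p" using X by (simp add: field_simps)
      then have "(X/2)^3 \<le> (1 / snd p)^3" using X by (intro power_mono) auto
      then show ?thesis using True by (simp add: power_divide ennreal_leI)
    qed simp
  qed
  finally show ?thesis .
qed

text \<open>Upper bound: one copy of the compact set for \<open>Gam\<close> per coset. Lower bound: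
  a box of diameter below the minimal displacement has disjoint translates.\<close>

lemma vol_Gcong_bounds:
  assumes y: "y \<in> Gam" "trace y = a" and a: "cmod a \<ge> 4"
    and F: "F \<subseteq> Gam" "finite F" "\<And>x. x \<in> Gam \<Longrightarrow> \<exists>f\<in>F. adj f ** x \<in> Gcong a"
    and C: "\<And>p. p \<in> H3 \<Longrightarrow> \<exists>\<gamma>\<in>Gam. hnorm (act \<gamma> p) \<le> C"
  shows "vol (Gcong a) \<le> card F * enn2real (hypvol (Kset C))"
    and "vol (Gcong a) \<ge> (cmod a) ^ 4 / 2048"
proof -
  let ?K = "translates_K F C"
  have Kb: "?K \<in> sets borel" using compact_imp_closed[OF compact_translates_K[OF F(2,1)]] by simp
  have Kf: "hypvol ?K < \<infinity>"
    using hypvol_translates_K[OF F(2,1), of C] hypvol_Kset_finite[of C]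
    by (metis ennreal_mult_less_top infinity_ennreal_def of_nat_less_top order_le_less_trans)
  have cov: "?K \<subseteq> H3" "(\<Union>g\<in>Gcong a. act g ` ?K) = H3"
    by (rule translates_K_cover[OF F(1,3) C]; assumption)+
  note vb = vol_bounds[OF SL2_preimage_group_Gcong countable_Gcong displaces_Gcong[OF y a] Kb cov Kf]
  have "ennreal (vol (Gcong a)) \<le> of_nat (card F) * hypvol (Kset C)"
    using vb(1) hypvol_translates_K[OF F(2,1), of C] by (rule order_trans)
  also have "\<dots> = ennreal (card F * enn2real (hypvol (Kset C)))"
    using hypvol_Kset_finite[of C] by (simp add: ennreal_mult ennreal_of_nat_eq_real_of_nat)
  finally show "vol (Gcong a) \<le> card F * enn2real (hypvol (Kset C))"
    by (simp add: ennreal_le_iff)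
  \<comment> \<open>With this X the hyperbolic cosine of the diameter is at most 1 + |a|^4 / 64,
    below the displacement bound (|a|^2 - 2)^2 / 4.\<close>
  define X where "X = (cmod a)\<^sup>2 / 8"
  have A: "(cmod a)\<^sup>2 \<ge> 16" using power_mono[OF a, of 2] by simp
  then have X: "X \<ge> 2" by (simp add: X_def)
  have "ch p q < fl (a\<^sup>2 - 2) / 4" if pq: "p \<in> thinbox X" "q \<in> thinbox X" for p q
  proof -
    have pos: "snd p > 0" "snd q > 0" using pq thinbox_H3[of X] X by (auto simp: H3_def)
    have i: "1 / snd p \<le> X" "1 / snd q \<le> X" using pq X pos by (auto simp: thinbox_iff field_simps)
    have iX: "1 / X \<le> 1/2" "0 < 1 / X" using X by (simp_all add: field_simps)
    have "\<bar>snd p - snd q\<bar> \<le> 1 / X" using pq by (auto simp: thinbox_iff)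
    then have "\<bar>snd p - snd q\<bar> \<le> \<bar>1/2\<bar>" using iX by linarith
    then have t: "(snd p - snd q)\<^sup>2 \<le> (1/2)\<^sup>2" by (simp only: abs_le_square_iff)
    have "\<bar>Re (fst p - fst q)\<bar> \<le> 1/2" "\<bar>Im (fst p - fst q)\<bar> \<le> 1/2"
      using pq unfolding thinbox_iff minus_complex.sel by linarith+
    then have "\<bar>Re (fst p - fst q)\<bar> \<le> \<bar>1/2\<bar>" "\<bar>Im (fst p - fst q)\<bar> \<le> \<bar>1/2\<bar>" by linarith+
    then have "(Re (fst p - fst q))\<^sup>2 \<le> (1/2)\<^sup>2" "(Im (fst p - fst q))\<^sup>2 \<le> (1/2)\<^sup>2"
      by (simp_all only: abs_le_square_iff)
    then have "(cmod (fst p - fst q))\<^sup>2 + (snd p - snd q)\<^sup>2 \<le> 3 * (1/2)\<^sup>2"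
      using t unfolding cmod_power2 by linarith
    moreover define Q where "Q = ((cmod (fst p - fst q))\<^sup>2 + (snd p - snd q)\<^sup>2) * ((1 / snd p) * (1 / snd q))"
    ultimately have "Q \<le> 3 * (1/2)\<^sup>2 * (X * X)"
      unfolding Q_def using i pos X by (intro mult_mono) auto
    then have "Q \<le> 3/4 * (X * X)" by (simp add: power2_eq_square)
    moreover have "ch p q = 1 + Q / 2"
      using pos by (simp add: ch_def Q_def)
    ultimately have "ch p q \<le> 1 + X * X" using zero_le_square[of X] by linarith
    also have "\<dots> < ((cmod a)\<^sup>2 - 2)\<^sup>2 / 4"
    proof -
      define A where "A = (cmod a)\<^sup>2"
      have "A \<ge> 16" using \<open>(cmod a)\<^sup>2 \<ge> 16\<close> by (simp add: A_def)
      then have "16 * A \<le> A * A" by (intro mult_right_mono) auto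
      have "X * X = A * A / 64" by (simp add: X_def A_def power2_eq_square)
      moreover have "(A - 2)\<^sup>2 / 4 = A * A / 4 - A + 1" by (simp add: power2_eq_square field_simps)
      ultimately have "1 + X * X < (A - 2)\<^sup>2 / 4" using \<open>16 * A \<le> A * A\<close> \<open>A \<ge> 16\<close> by linarith
      then show ?thesis by (simp add: A_def)
    qed
    also have "\<dots> \<le> fl (a\<^sup>2 - 2) / 4" using fl_ge_sq[OF a] by simp
    finally show ?thesis .
  qed
  from vb(2)[OF thinbox_borel thinbox_H3 this] have "hypvol (thinbox X) \<le> ennreal (vol (Gcong a))"
    using X by simp
  then have "ennreal (X\<^sup>2 / 32) \<le> ennreal (vol (Gcong a))"
    using hypvol_thinbox[of X] X by (simp add: order_trans)
  moreover have "vol (Gcong a) \<ge> 0" by (simp add: vol_def)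
  ultimately have "X\<^sup>2 / 32 \<le> vol (Gcong a)" by (simp add: ennreal_le_iff)
  then show "vol (Gcong a) \<ge> (cmod a) ^ 4 / 2048"
    by (simp add: X_def power_divide flip: power_mult)
qed

lemma compact_arith_Gcong:
  assumes y: "y \<in> Gam" "trace y = a" and a: "cmod a \<ge> 4"
  shows "compact_arith_manifold_group (Gcong a)"
proof -
  have aZ: "a \<in> Zi" "a \<noteq> 0" using y GamD Ord_trace a by auto
  obtain F where F: "F \<subseteq> Gam" "\<And>x. x \<in> Gam \<Longrightarrow> \<exists>f\<in>F. adj f ** x \<in> Gcong a"
    "\<And>f f'. f \<in> F \<Longrightarrow> f' \<in> F \<Longrightarrow> adj f ** f' \<in> Gcong a \<Longrightarrow> f = f'"
    using coset_representatives by metis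
  have fin: "finite F" using incongruent_card(1)[OF incongruent_coset_representatives[OF F(1,3)] aZ] .
  obtain C where C: "\<And>p. p \<in> H3 \<Longrightarrow> \<exists>\<gamma>\<in>Gam. hnorm (act \<gamma> p) \<le> C" using Gam_cocompact by blast
  have "cocompact (Gcong a)"
    unfolding cocompact_def
    using compact_translates_K[OF fin F(1), of C] translates_K_cover[OF F(1,2) C] by blast
  then show ?thesis
    unfolding compact_arith_manifold_group_def
    using arithmetic_Gcong[OF aZ] torsion_free_Gcong[OF y a] by blast
qed

subsection \<open>Index of the congruence subgroups\<close>

lemma fiber_pigeonhole:
  assumes "finite S" "S \<noteq> {}"
  obtains x where "x \<in> S" "card S \<le> card (f ` S) * card {x' \<in> S. f x' = f x}"
proof -
  let ?k = "\<lambda>x. card {x' \<in> S. f x' = f x}"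
  have "Max (?k ` S) \<in> ?k ` S" using assms by (intro Max_in) auto
  then obtain x where x: "x \<in> S" "?k x = Max (?k ` S)" by auto
  have "card S = (\<Sum>c\<in>f ` S. card {x' \<in> S. f x' = c})"
    using sum.image_gen[OF assms(1), of "\<lambda>_. 1::nat" f] by simp
  also have "\<dots> \<le> (\<Sum>c\<in>f ` S. ?k x)"
  proof (rule sum_mono)
    fix c assume "c \<in> f ` S"
    then obtain x' where "x' \<in> S" "c = f x'" by auto
    then show "card {x' \<in> S. f x' = c} \<le> ?k x" using assms(1) by (simp add: x(2))
  qed
  finally show thesis using that x(1) by simp
qed

text \<open>A nonzero multiple of a has modulus at least |a|, but differences in a square grid of
  side |a| / 32 are too small for that. The 8 is 4 * 2: in the index bound traces are controlled
  only after multiplication by 4, and the trace of y + i contributes 2 i modulo a.\<close>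

lemma scalars_separated_by_8:
  assumes a: "a \<noteq> 0"
  obtains T where "finite T" "T \<subseteq> Zi" "real (card T) \<ge> (cmod a)\<^sup>2 / 1024"
    "\<And>t t' z. t \<in> T \<Longrightarrow> t' \<in> T \<Longrightarrow> z \<in> Zi \<Longrightarrow> 8 * (t - t') = a * z \<Longrightarrow> t = t'"
proof -
  define r where "r = cmod a / 32"
  have r: "r > 0" using a by (simp add: r_def)
  define N where "N = nat (\<lceil>r\<rceil> - 1)"
  have N: "real N < r" "real N + 1 \<ge> r" using r unfolding N_def by linarith+
  define T where "T = (\<lambda>(k, l). Complex (of_nat k) (of_nat l)) ` ({..N} \<times> {..N})"
  show thesis
  proof
    show "finite T" by (simp add: T_def)
    show "T \<subseteq> Zi" by (auto simp: T_def Zi_def)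
    have "inj_on (\<lambda>(k, l). Complex (of_nat k) (of_nat l)) ({..N} \<times> {..N})"
      by (auto simp: inj_on_def)
    then have "card T = (N + 1)\<^sup>2"
      by (simp add: T_def card_image card_cartesian_product power2_eq_square)
    moreover have "r\<^sup>2 \<le> (real N + 1)\<^sup>2" using N r by (intro power_mono) auto
    ultimately show "real (card T) \<ge> (cmod a)\<^sup>2 / 1024" by (simp add: r_def power_divide add.commute)
    show "t = t'" if tt: "t \<in> T" "t' \<in> T" "z \<in> Zi" "8 * (t - t') = a * z" for t t' z
    proof (rule ccontr)
      assume "t \<noteq> t'"
      then have "z \<noteq> 0" using tt(4) by auto
      then have "cmod z \<ge> 1" using Zi_norm_ge_1 tt(3) by blast
      then have "cmod a * 1 \<le> cmod a * cmod z" by (intro mult_left_mono) auto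
      also have "\<dots> = 8 * cmod (t - t')" using arg_cong[OF tt(4), of cmod] by (simp only: norm_mult norm_numeral)
      also have "cmod (t - t') \<le> 2 * real N"
      proof -
        obtain k l where kl: "t = Complex (of_nat k) (of_nat l)" "k \<le> N" "l \<le> N" using tt(1) by (auto simp: T_def)
        obtain k' l' where kl': "t' = Complex (of_nat k') (of_nat l')" "k' \<le> N" "l' \<le> N" using tt(2) by (auto simp: T_def)
        have "\<bar>Re (t - t')\<bar> \<le> real N" "\<bar>Im (t - t')\<bar> \<le> real N" using kl kl' by auto
        then show ?thesis using cmod_le[of "t - t'"] by linarith
      qed
      finally show False using N(1) r by (simp add: r_def)
    qed
  qed
qed

lemma cmat_mult_assoc:
  fixes x y z :: cmat
  shows "x ** y ** z = x ** (y ** z)"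
  by (simp add: matrix_mul_assoc)

lemma qcong_trace:
  assumes "qcong a m n"
  obtains z where "z \<in> Zi" "trace m - trace n = a * z"
proof -
  obtain q where "q \<in> Ord" "m = n + mat a ** q" using assms by (auto simp: qcong_def)
  then show thesis using that[of "trace q"] Ord_trace by (simp add: trace_add trace_scale)
qed

text \<open>An element \<open>y\<close> of norm 1 and trace \<open>a\<close> satisfies \<open>y\<^sup>2 = -1\<close> modulo \<open>a\<close>, so \<open>y - \<i>\<close> and \<open>y + \<i>\<close>
  are zero divisors that split the order modulo \<open>a\<close>. The elements \<open>x\<close> are counted
  by the values of \<open>x (y - \<i>)\<close>; within a fibre the trace is almost determined, which leaves
  room for the scalars \<open>t\<close> in the map \<open>(c, x, t) \<mapsto> c + (x\<^sub>0\<^sup>-\<^sup>1 x - 1) + t (y + \<i>)\<close>.\<close>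
lemma incongruent_card_Gam:
  assumes y: "y \<in> Gam" "trace y = a" and a: "a \<in> Zi" "a \<noteq> 0"
    and S: "S \<subseteq> Gam" "incongruent a S"
  shows "real (card S) \<le> 9 ^ 4 * 1024 * cmod a ^ 6"
proof (cases "S = {}")
  case False
  have fin: "finite S" using incongruent_card(1)[OF S(2) a] .
  have yO: "y \<in> Ord" "det y = 1" using y GamD by auto
  define v w where "v = y - mat \<i>" "w = y + mat \<i>"
  note vw = this
  have vwO: "v \<in> Ord" "w \<in> Ord" using yO by (auto simp: vw intro!: Ord_closed)
  have wv: "w ** v = mat a ** y"
  proof -
    have "w ** v = y ** y + mat 1" by (simp add: vw cmat_eq_iff algebra_simps)
    then show ?thesis by (simp add: cayley_hamilton[OF yO(2)] y(2))
  qed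
  have "det w = det y + \<i> * trace y - 1"
    by (simp add: vw det_cmat trace_cmat algebra_simps)
  then have det_w: "det w = \<i> * a" by (simp add: yO(2) y(2))
  have tr_w: "trace w = a + 2 * \<i>" by (simp add: vw trace_add trace_mat y(2))
  define cl where "cl m = {m' \<in> Ord. qcong a m m'}" for m
  have cl: "cl m = cl m' \<longleftrightarrow> qcong a m m'" if "m \<in> Ord" "m' \<in> Ord" for m m'
    using that qcong_sym qcong_trans unfolding cl_def by (smt (verit) Collect_cong mem_Collect_eq qcong_refl)
  define \<phi> where "\<phi> x = cl (x ** v)" for x
  have SO: "x \<in> Ord" "adj x \<in> Ord" "det x = 1" if "x \<in> S" for x using that S(1) GamD Gam_adj by blast+
  have \<phi>: "\<phi> x = \<phi> x' \<longleftrightarrow> qcong a (x ** v) (x' ** v)" if "x \<in> S" "x' \<in> S" for x x'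
    unfolding \<phi>_def by (rule cl) (simp_all add: Ord_mult SO(1) that vwO)
  obtain x0 where x0: "x0 \<in> S" "card S \<le> card (\<phi> ` S) * card {x' \<in> S. \<phi> x' = \<phi> x0}"
    by (rule fiber_pigeonhole[OF fin False, of \<phi>])
  let ?E = "{x' \<in> S. \<phi> x' = \<phi> x0}"
  define \<mu> where "\<mu> x = adj x0 ** x - mat 1" for x
  have \<mu>O: "\<mu> x \<in> Ord" if "x \<in> S" for x
    unfolding \<mu>_def using SO[OF that] SO[OF x0(1)] by (intro Ord_closed) auto
  have \<mu>v: "qcong a (\<mu> x ** v) 0" if x: "x \<in> ?E" for x
  proof -
    have "qcong a (x ** v) (x0 ** v)" using x \<phi> x0(1) by auto
    then have "qcong a (adj x0 ** (x ** v)) (adj x0 ** (x0 ** v))"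
      by (rule qcong_mult_left[OF SO(2)[OF x0(1)]])
    moreover have "adj x0 ** (x0 ** v) = v" using SO(3)[OF x0(1)] by (simp add: adj_cancel)
    ultimately have "qcong a (adj x0 ** (x ** v) + (- v)) (v + (- v))"
      by (metis qcong_add qcong_refl)
    moreover have "\<mu> x ** v = adj x0 ** (x ** v) + (- v)"
      by (simp add: \<mu>_def cmat_distrib matrix_mul_assoc)
    ultimately show ?thesis by simp
  qed
  \<comment> \<open>Since w - v = 2 i and m v vanishes modulo a, 2 i m is congruent to m w. Taking
    norms, -4 det m is congruent to det m det w, and det w = i a. Finally 1 + m has norm 1, so trace
    m = - det m.\<close>
  have tr4: "\<exists>z\<in>Zi. 4 * trace (\<mu> x) = a * z" if x: "x \<in> ?E" for x
  proof -
    define m where "m = \<mu> x"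
    have mO: "m \<in> Ord" using \<mu>O x by (simp add: m_def)
    have "det (mat 1 + m) = 1" using SO x x0(1) by (simp add: m_def \<mu>_def det_mul)
    then have tm: "trace m = - det m" by (simp add: det_cmat trace_cmat algebra_simps add_eq_0_iff)
    obtain q where q: "q \<in> Ord" "m ** v = mat a ** q" using \<mu>v[OF x] by (auto simp: qcong_def m_def)
    have "mat (2 * \<i>) ** m = m ** w + mat a ** (- q)"
    proof -
      have "mat (2 * \<i>) ** m = m ** w - m ** v" by (simp add: vw cmat_eq_iff algebra_simps)
      then show ?thesis by (simp add: q(2))
    qed
    then have "det (mat (2 * \<i>) ** m) = det (m ** w) + a * trace (m ** w ** adj (- q)) + a\<^sup>2 * det (- q)"
      by (simp only: det_add_scale)
    moreover have "det (mat (2 * \<i>) ** m) = - 4 * det m"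
      unfolding det_scale by (simp add: power2_eq_square)
    ultimately have "- 4 * det m = a * (\<i> * det m + trace (m ** w ** adj (- q)) + a * det (- q))"
      by (simp add: det_mul det_w power2_eq_square algebra_simps)
    then have "4 * trace m = a * (\<i> * det m + trace (m ** w ** adj (- q)) + a * det (- q))" using tm by simp
    moreover have "\<i> * det m + trace (m ** w ** adj (- q)) + a * det (- q) \<in> Zi"
      using a mO q(1) vwO by (intro Zi_closed Ord_det Ord_trace Ord_closed)
    ultimately show ?thesis unfolding m_def by blast
  qed
  obtain T where T: "finite T" "T \<subseteq> Zi" "real (card T) \<ge> (cmod a)\<^sup>2 / 1024"
    "\<And>t t' z. t \<in> T \<Longrightarrow> t' \<in> T \<Longrightarrow> z \<in> Zi \<Longrightarrow> 8 * (t - t') = a * z \<Longrightarrow> t = t'"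
    using scalars_separated_by_8[OF a(2)] by metis
  define \<psi> where "\<psi> = inv_into S \<phi>"
  have \<psi>: "\<psi> c \<in> S" "\<phi> (\<psi> c) = c" if "c \<in> \<phi> ` S" for c
    using that by (auto simp: \<psi>_def inv_into_into f_inv_into_f)
  \<comment> \<open>If \<open>g\<close> is injective modulo a, the domain has at most 9^4 |a|^8
    elements; it contains about |a|^2 scalars t, and dividing by their number leaves |a|^6.\<close>
  define g where "g = (\<lambda>(c, x, t). \<psi> c + (\<mu> x + mat t ** w))"
  let ?P = "(\<phi> ` S) \<times> ?E \<times> T"
  have gO: "g \<tau> \<in> Ord" if in_P: "\<tau> \<in> ?P" for \<tau>
  proof -
    obtain c x t where \<tau>: "\<tau> = (c, x, t)" "c \<in> \<phi> ` S" "x \<in> ?E" "t \<in> T" using in_P by auto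
    then have "\<psi> c \<in> Ord" "\<mu> x \<in> Ord" "t \<in> Zi" using \<psi>(1) SO(1) \<mu>O T(2) by auto
    then show ?thesis unfolding \<tau>(1) g_def using vwO by (auto intro!: Ord_closed)
  qed
  have g_inj: "\<tau> = \<tau>'" if in_P: "\<tau> \<in> ?P" "\<tau>' \<in> ?P" and gg: "qcong a (g \<tau>) (g \<tau>')" for \<tau> \<tau>'
  proof -
    obtain c x t where \<tau>: "\<tau> = (c, x, t)" "c \<in> \<phi> ` S" "x \<in> ?E" "t \<in> T" using in_P(1) by auto
    obtain c' x' t' where \<tau>': "\<tau>' = (c', x', t')" "c' \<in> \<phi> ` S" "x' \<in> ?E" "t' \<in> T" using in_P(2) by auto
    \<comment> \<open>Right multiplication by v annihilates both \<open>\<mu> x\<close> and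
      \<open>mat t ** w\<close> modulo a, so the residue of the value of \<open>g\<close> determines
      c.\<close>
    have gv: "qcong a (g (c, x, t) ** v) (\<psi> c ** v)" if "x \<in> ?E" "t \<in> T" for c x t
    proof -
      have tO: "mat t ** y \<in> Ord" using that(2) T(2) yO(1) by (intro Ord_closed) auto
      have "mat t ** w ** v = mat t ** (w ** v)" by (rule matrix_mul_assoc[symmetric])
      also have "\<dots> = 0 + mat a ** (mat t ** y)" unfolding wv mat_mult_left_commute[of "mat t" a y] by simp
      finally have "qcong a (mat t ** w ** v) 0" using tO unfolding qcong_def by blast
      from qcong_add[OF qcong_refl[of a "\<psi> c ** v"] qcong_add[OF \<mu>v[OF that(1)] this]]
      show ?thesis by (simp add: g_def cmat_distrib matrix_mul_assoc)
    qed
    have "qcong a (g \<tau> ** v) (g \<tau>' ** v)" by (rule qcong_mult_right[OF vwO(1) gg])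
    then have "qcong a (\<psi> c ** v) (\<psi> c' ** v)"
      unfolding \<tau>(1) \<tau>'(1)
      using qcong_trans[OF qcong_sym[OF gv[OF \<tau>(3,4)]] qcong_trans[OF _ gv[OF \<tau>'(3,4)]]] by blast
    then have c: "c = c'" using \<phi>[OF \<psi>(1) \<psi>(1)] \<psi>(2) \<tau>(2) \<tau>'(2) by metis
    have "qcong a (g \<tau> + (- \<psi> c)) (g \<tau>' + (- \<psi> c))" by (rule qcong_add[OF gg qcong_refl])
    then have q: "qcong a (\<mu> x + mat t ** w) (\<mu> x' + mat t' ** w)"
      unfolding \<tau>(1) \<tau>'(1) g_def c by simp
    obtain z where z: "z \<in> Zi" "trace (\<mu> x + mat t ** w) - trace (\<mu> x' + mat t' ** w) = a * z"
      using qcong_trace[OF q] .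
    obtain z1 where z1: "z1 \<in> Zi" "4 * trace (\<mu> x) = a * z1" using tr4[OF \<tau>(3)] by blast
    obtain z2 where z2: "z2 \<in> Zi" "4 * trace (\<mu> x') = a * z2" using tr4[OF \<tau>'(3)] by blast
    have e: "trace (\<mu> x) + t * (a + 2 * \<i>) - (trace (\<mu> x') + t' * (a + 2 * \<i>)) = a * z"
      using z(2) by (simp add: trace_add trace_scale tr_w)
    \<comment> \<open>Once c is known, four times the trace recovers t: the contributions of
      \<open>\<mu> x\<close> vanish modulo a, and 4 t trace w is congruent to 8 i t.\<close>
    have "8 * (t - t') = a * (- \<i> * (4 * z - z1 + z2 - 4 * (t - t')))"
    proof -
      have "4 * trace (\<mu> x) - 4 * trace (\<mu> x') + 4 * (t - t') * a + 8 * \<i> * (t - t') = 4 * (a * z)"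
        unfolding e[symmetric] by (simp add: algebra_simps)
      then have "8 * \<i> * (t - t') = a * (4 * z - z1 + z2 - 4 * (t - t'))"
        unfolding z1(2) z2(2) by (simp add: algebra_simps)
      then have "- \<i> * (8 * \<i> * (t - t')) = - \<i> * (a * (4 * z - z1 + z2 - 4 * (t - t')))" by simp
      then show ?thesis by (simp add: algebra_simps)
    qed
    moreover have "- \<i> * (4 * z - z1 + z2 - 4 * (t - t')) \<in> Zi"
      using z z1 z2 T(2) \<tau>(4) \<tau>'(4) by (intro Zi_closed) auto
    ultimately have t: "t = t'" using T(4)[OF \<tau>(4) \<tau>'(4)] by blast
    have "qcong a (\<mu> x + mat t ** w + (mat 1 - mat t ** w)) (\<mu> x' + mat t ** w + (mat 1 - mat t ** w))"
      using qcong_add[OF q[unfolded t] qcong_refl] unfolding t .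
    then have "qcong a (adj x0 ** x) (adj x0 ** x')" by (simp add: \<mu>_def)
    then have "qcong a (x0 ** (adj x0 ** x)) (x0 ** (adj x0 ** x'))"
      by (rule qcong_mult_left[OF SO(1)[OF x0(1)]])
    then have "qcong a x x'" using SO(3)[OF x0(1)] by (simp add: adj_cancel)
    then have "x = x'" using S(2) \<tau>(3) \<tau>'(3) by (auto simp: incongruent_def)
    then show ?thesis using \<tau>(1) \<tau>'(1) c t by simp
  qed
  have "inj_on g ?P"
  proof (rule inj_onI)
    fix \<tau> \<tau>' assume in_P: "\<tau> \<in> ?P" "\<tau>' \<in> ?P" and "g \<tau> = g \<tau>'"
    then have "qcong a (g \<tau>) (g \<tau>')" by simp
    then show "\<tau> = \<tau>'" by (rule g_inj[OF in_P])
  qed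
  then have cg: "card (g ` ?P) = card (\<phi> ` S) * (card ?E * card T)"
    by (simp only: card_image card_cartesian_product)
  have "incongruent a (g ` ?P)"
    unfolding incongruent_def
  proof (intro conjI ballI impI)
    show "g ` ?P \<subseteq> Ord" using gO by (rule image_subsetI)
    fix m m' assume m: "m \<in> g ` ?P" "m' \<in> g ` ?P" "qcong a m m'"
    obtain \<tau> where \<tau>: "m = g \<tau>" "\<tau> \<in> ?P" using m(1) by (rule imageE)
    obtain \<tau>' where \<tau>': "m' = g \<tau>'" "\<tau>' \<in> ?P" using m(2) by (rule imageE)
    show "m = m'" using g_inj[OF \<tau>(2) \<tau>'(2)] m(3) unfolding \<tau>(1) \<tau>'(1) by blast
  qed
  from incongruent_card(2)[OF this a]
  have "real (card (\<phi> ` S) * (card ?E * card T)) \<le> 9 ^ 4 * cmod a ^ 8" unfolding cg .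
  moreover have "real (card S) * real (card T) \<le> real (card (\<phi> ` S) * (card ?E * card T))"
    using mult_right_mono[OF x0(2), of "card T"] by (simp add: mult.assoc flip: of_nat_mult)
  moreover have "real (card S) * ((cmod a)\<^sup>2 / 1024) \<le> real (card S) * real (card T)"
    using T(3) by (intro mult_left_mono) auto
  ultimately have "real (card S) * ((cmod a)\<^sup>2 / 1024) \<le> 9 ^ 4 * cmod a ^ 8" by linarith
  also have "\<dots> = (9 ^ 4 * 1024 * cmod a ^ 6) * ((cmod a)\<^sup>2 / 1024)" by (simp flip: power_add)
  finally show ?thesis by (rule mult_right_le_imp_le) (use a(2) in simp)
qed simp

subsection \<open>Elements with a common trace\<close>

text \<open>Any \<gamma> that carries a point of the box into \<open>Kset C\<close> satisfies
  |\<gamma>|^2 <= C * 2 X = R^2. So translates of \<open>Kset C\<close> by the inverses of elements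
  of norm at most R cover a box of volume of order R^4.\<close>

lemma Gam_lattice_count:
  obtains c R0 where "c > 0" "\<And>R. R \<ge> R0 \<Longrightarrow> c * R ^ 4 \<le> real (card {\<gamma> \<in> Gam. norm \<gamma> \<le> R})"
proof -
  obtain C where C: "C \<ge> 2" "\<And>p. p \<in> H3 \<Longrightarrow> \<exists>\<gamma>\<in>Gam. hnorm (act \<gamma> p) \<le> C" using Gam_cocompact by blast
  define V where "V = enn2real (hypvol (Kset C))"
  have V: "hypvol (Kset C) = ennreal V" "V \<ge> 0" using hypvol_Kset_finite[of C] by (simp_all add: V_def)
  have main: "1 / (128 * C\<^sup>2 * (V + 1)) * R ^ 4 \<le> real (card {\<gamma> \<in> Gam. norm \<gamma> \<le> R})" if R: "R \<ge> 4 * C" for R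
  proof -
    let ?F = "{\<gamma> \<in> Gam. norm \<gamma> \<le> R}"
    define X where "X = R\<^sup>2 / (2 * C)"
    have R0: "R \<ge> 0" using R C by linarith
    have "(4 * C) * (4 * C) \<le> R * R" using R C R0 by (intro mult_mono) auto
    moreover have "2 * C \<le> C * C" using C by (intro mult_right_mono) auto
    ultimately have "4 * (2 * C) \<le> R\<^sup>2" unfolding power2_eq_square using C by linarith
    then have X: "X \<ge> 4" using C by (simp add: X_def le_divide_eq)
    have XR: "C * (2 * X) = R\<^sup>2" using C by (simp add: X_def)
    have "thinbox X \<subseteq> translates_K ?F C"
    proof
      fix p assume p: "p \<in> thinbox X"
      then have pH: "p \<in> H3" using thinbox_H3[of X] X by auto
      then have s: "snd p > 0" by (simp add: H3_def)
      have "(cmod (fst p))\<^sup>2 \<le> (1/4)\<^sup>2 + (1/4)\<^sup>2"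
        unfolding cmod_power2 using p by (intro add_mono; simp add: thinbox_iff abs_le_square_iff[symmetric])
      moreover have "snd p \<le> 1/2"
      proof -
        have "2 / X \<le> 1/2" using X by (simp add: field_simps)
        then show ?thesis using p by (simp add: thinbox_iff)
      qed
      then have "(snd p)\<^sup>2 \<le> (1/2)\<^sup>2" using s by (intro power_mono) auto
      ultimately have "(cmod (fst p))\<^sup>2 + (snd p)\<^sup>2 + 1 \<le> 2" by (simp add: power2_eq_square)
      moreover have "1 / X \<le> snd p" using p by (simp add: thinbox_iff)
      then have "1 \<le> snd p * X" using X by (simp add: field_simps)
      ultimately have hp: "hnorm p \<le> 2 * X"
        unfolding hnorm_def pos_divide_le_eq[OF s] by (simp add: mult.commute mult.left_commute)
      obtain \<gamma> where g: "\<gamma> \<in> Gam" "hnorm (act \<gamma> p) \<le> C" using C(2)[OF pH] by blast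
      have dg: "det \<gamma> = 1" using g GamD by blast
      have "norm \<gamma> \<le> R"
      proof -
        have "\<gamma> = (\<gamma> ** hmat p) ** adj (hmat p)" using adj_cancel(4)[OF det_hmat[OF pH]] by simp
        then have "norm \<gamma> \<le> norm (\<gamma> ** hmat p) * norm (hmat p)"
          using norm_mult_cmat[of "\<gamma> ** hmat p" "adj (hmat p)"] by simp
        then have "(norm \<gamma>)\<^sup>2 \<le> (norm (\<gamma> ** hmat p) * norm (hmat p))\<^sup>2" by (intro power_mono) auto
        also have "\<dots> = hnorm (act \<gamma> p) * hnorm p"
          using hnorm_act[OF dg pH] hnorm_hmat[OF pH] by (simp add: power_mult_distrib)
        also have "\<dots> \<le> C * (2 * X)" using g(2) hp C s by (intro mult_mono) (auto simp: hnorm_def)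
        finally show ?thesis unfolding XR by (rule power2_le_imp_le[OF _ R0])
      qed
      then have "\<gamma> \<in> ?F" using g by simp
      moreover have "act \<gamma> p \<in> Kset C" using g act_in_H3[OF dg pH] by (simp add: Kset_def)
      moreover have "p = act (adj \<gamma>) (act \<gamma> p)" using act_adj_cancel(1)[OF dg pH] by simp
      ultimately show "p \<in> translates_K ?F C" unfolding translates_K_def by blast
    qed
    then have "hypvol (thinbox X) \<le> of_nat (card ?F) * hypvol (Kset C)"
      by (intro hypvol_covered finite_Gam_ball) auto
    then have "ennreal (X\<^sup>2 / 32) \<le> of_nat (card ?F) * ennreal V"
      using order_trans[OF hypvol_thinbox[of X]] X unfolding V(1) by simp
    then have "ennreal (X\<^sup>2 / 32) \<le> ennreal (real (card ?F) * V)"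
      by (simp add: ennreal_mult V ennreal_of_nat_eq_real_of_nat)
    then have "X\<^sup>2 / 32 \<le> real (card ?F) * V" using V by (simp add: ennreal_le_iff)
    also have "\<dots> \<le> real (card ?F) * (V + 1)" by (simp add: algebra_simps)
    finally have "X\<^sup>2 / 32 / (V + 1) \<le> real (card ?F)"
      by (subst pos_divide_le_eq) (use V in auto)
    moreover have "X\<^sup>2 / 32 / (V + 1) = 1 / (128 * C\<^sup>2 * (V + 1)) * R ^ 4"
      by (simp add: X_def power_divide power_mult_distrib flip: power_mult)
    ultimately show ?thesis by simp
  qed
  show thesis by (rule that[OF _ main]) (use C V in auto)
qed

text \<open>For large a, the norm bound keeps the axis of y within a distance of the base point
  bounded in terms of \<open>C\<close>; this later limits how many y can belong to one conjugacy
  class.\<close>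

definition trace_class :: "real \<Rightarrow> complex \<Rightarrow> cmat set" where
  "trace_class C a = {y \<in> Gam. trace y = a \<and> norm y \<le> C * cmod a}"

lemma finite_trace_class: "finite (trace_class C a)"
  by (rule finite_subset[OF _ finite_Gam_ball[of "C * cmod a"]]) (auto simp: trace_class_def)

lemma norm_trace_le: "cmod (trace (m::cmat)) \<le> 2 * norm m"
  using norm_entry_le[of m 1 1] norm_entry_le[of m 2 2] norm_triangle_ineq[of "m$1$1" "m$2$2"]
  by (simp add: trace_cmat)

text \<open>Four elements of \<open>Gam\<close> that span all matrices, so that one of the four traces is comparable
  to the norm. The first three come from Pell equations.\<close>
definition spanning_set :: "cmat set" where
  "spanning_set = {qmat 1 0 0 0, qmat 3 1 0 0, qmat 9 0 2 0, qmat 27 9 6 2}"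

lemma spanning_set_Gam: "spanning_set \<subseteq> Gam"
  by (auto simp: spanning_set_def Gam_def det_qmat)

lemma norm_qmat_le: "norm (qmat x0 x1 x2 x3) \<le> 200 * (cmod x0 + cmod x1 + cmod x2 + cmod x3)"
proof -
  let ?T = "cmod x0 + cmod x1 + cmod x2 + cmod x3"
  have r8: "cmod r8 \<le> 3" by (simp add: r8_def real_le_lsqrt)
  have pm: "cmod (u + r8 * v) \<le> cmod u + 3 * cmod v" "cmod (u - r8 * v) \<le> cmod u + 3 * cmod v" for u v
  proof -
    have "cmod (r8 * v) \<le> 3 * cmod v" unfolding norm_mult using r8 by (intro mult_right_mono) auto
    then show "cmod (u + r8 * v) \<le> cmod u + 3 * cmod v" "cmod (u - r8 * v) \<le> cmod u + 3 * cmod v"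
      using norm_triangle_ineq[of u "r8 * v"] norm_triangle_ineq4[of u "r8 * v"] by linarith+
  qed
  have aux: "b \<le> 60 * (k + l + m + n)" "20 * d \<le> 60 * (k + l + m + n)" "e \<le> 60 * (k + l + m + n)"
    if "b \<le> k + 3 * l" "d \<le> m + 3 * n" "e \<le> m + 3 * n" "0 \<le> k" "0 \<le> l" "0 \<le> m" "0 \<le> n"
    for b d e k l m n :: real
    using that by simp_all
  have "20 * cmod (x2 + r8 * x3) \<le> 60 * ?T"
    by (rule aux(2)[OF pm(1) pm(1) pm(2)]) simp_all
  then have "cmod (20 * (x2 + r8 * x3)) \<le> 60 * ?T" by (simp only: norm_mult norm_numeral)
  moreover have "cmod (x0 + r8 * x1) \<le> 60 * ?T"
    by (rule aux(1)[OF pm(1) pm(1) pm(2)]) simp_all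
  moreover have "cmod (x0 - r8 * x1) \<le> 60 * ?T"
    by (rule aux(1)[OF pm(2) pm(1) pm(2)]) simp_all
  moreover have "cmod (x2 - r8 * x3) \<le> 60 * ?T"
    by (rule aux(3)[OF pm(1) pm(1) pm(2)]) simp_all
  ultimately have "(norm (qmat x0 x1 x2 x3))\<^sup>2 \<le> (60 * ?T)\<^sup>2 + (60 * ?T)\<^sup>2 + (60 * ?T)\<^sup>2 + (60 * ?T)\<^sup>2"
    unfolding norm_cmat_sq qmat_def mk_sel by (intro add_mono power_mono) auto
  also have "\<dots> = (120 * ?T)\<^sup>2" by (simp only: power_mult_distrib) simp
  finally have "norm (qmat x0 x1 x2 x3) \<le> 120 * ?T" by (rule power2_le_imp_le) simp
  then show ?thesis by (rule order_trans) (rule mult_right_mono, simp_all)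
qed

text \<open>The four traces depend on the coordinates of g in triangular form, so the coordinates,
  and with them the norm, are bounded by the largest trace.\<close>

lemma spanning_set_trace:
  assumes "g \<in> Ord"
  shows "\<exists>s\<in>spanning_set. norm g \<le> 800 * cmod (trace (g ** s))"
proof -
  obtain x0 x1 x2 x3 where x: "g = qmat x0 x1 x2 x3" using assms by (rule OrdE)
  define t0 t1 t2 t3 where "t0 = trace (g ** qmat 1 0 0 0)" "t1 = trace (g ** qmat 3 1 0 0)"
    "t2 = trace (g ** qmat 9 0 2 0)" "t3 = trace (g ** qmat 27 9 6 2)"
  note t = this
  define M where "M = max (max (cmod t0) (cmod t1)) (max (cmod t2) (cmod t3))"
  have M: "cmod t0 \<le> M" "cmod t1 \<le> M" "cmod t2 \<le> M" "cmod t3 \<le> M" by (simp_all add: M_def)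
  have tx: "t0 = 2 * x0" "t1 = 6 * x0 + 16 * x1" "t2 = 18 * x0 + 80 * x2" "t3 = 54 * x0 + 144 * x1 + 240 * x2 - 640 * x3"
    by (simp_all add: t x qmat_mult trace_qmat algebra_simps)
  have s1: "2 * x0 = t0" and s2: "16 * x1 = t1 - 3 * t0" and s3: "80 * x2 = t2 - 9 * t0"
    and s4: "640 * x3 = 54 * x0 + 144 * x1 + 240 * x2 - t3"
    by (simp_all add: tx algebra_simps)
  have n: "cmod (u - v) \<le> cmod u + cmod v" "cmod (u + v) \<le> cmod u + cmod v" for u v :: complex
    by (rule norm_triangle_ineq4, rule norm_triangle_ineq)
  have b0: "2 * cmod x0 \<le> M" using M arg_cong[OF s1, of cmod] by (simp add: norm_mult)
  have b1: "16 * cmod x1 \<le> 4 * M"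
    using M arg_cong[OF s2, of cmod] n(1)[of t1 "3 * t0"] by (simp add: norm_mult)
  have b2: "80 * cmod x2 \<le> 10 * M"
    using M arg_cong[OF s3, of cmod] n(1)[of t2 "9 * t0"] by (simp add: norm_mult)
  have b3: "640 * cmod x3 \<le> 54 * cmod x0 + 144 * cmod x1 + 240 * cmod x2 + M"
    using M arg_cong[OF s4, of cmod] n(1)[of "54 * x0 + 144 * x1 + 240 * x2" t3] n(2)[of "54 * x0 + 144 * x1" "240 * x2"]
      n(2)[of "54 * x0" "144 * x1"] by (simp add: norm_mult)
  have "cmod x0 + cmod x1 + cmod x2 + cmod x3 \<le> 2 * M" using b0 b1 b2 b3 norm_ge_zero[of x0] by linarith
  then have "norm g \<le> 400 * M" using norm_qmat_le[of x0 x1 x2 x3] by (simp add: x)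
  moreover have "M \<ge> 0" using M(1) norm_ge_zero[of t0] by linarith
  ultimately have le: "norm g \<le> 800 * M" by linarith
  have "M = cmod t0 \<or> M = cmod t1 \<or> M = cmod t2 \<or> M = cmod t3" by (auto simp: M_def max_def)
  then show ?thesis using le unfolding t spanning_set_def by auto
qed

text \<open>Otherwise all large traces are rare. Every \<gamma> equals y s^-1 with s in the spanning
  set and y of norm comparable to its trace, so summing over the O(R^2) traces would give fewer
  elements of norm at most R than the lattice count provides.\<close>

lemma rich_trace_exists:
  obtains c C where "c > 0" "C \<ge> 1"
    "\<And>A0. \<exists>a. cmod a \<ge> A0 \<and> real (card (trace_class C a)) \<ge> c * (cmod a)\<^sup>2"
proof -
  obtain c1 R0 where c1: "c1 > 0" "\<And>R. R \<ge> R0 \<Longrightarrow> c1 * R ^ 4 \<le> real (card {\<gamma> \<in> Gam. norm \<gamma> \<le> R})"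
    using Gam_lattice_count by blast
  define D where "D = 1 + (\<Sum>s\<in>spanning_set. norm s)"
  have fs: "finite spanning_set" "card spanning_set \<le> 4"
    by (simp_all add: spanning_set_def card_insert_if)
  have D: "norm s \<le> D" if "s \<in> spanning_set" for s
    using member_le_sum[OF that, of norm] fs(1) by (simp add: D_def)
  have D1: "D \<ge> 1" by (simp add: D_def sum_nonneg)
  define C where "C = 800 * D"
  \<comment> \<open>There are 4 choices of s, at most 9 (2 D R)^2 traces, and under the contrary
    assumption at most c (2 D R)^2 elements for each; with this c the product is c1 R^4 / 2, half of
    the lattice count.\<close>
  define c where "c = c1 / (1152 * D ^ 4)"
  have c: "c > 0" using c1 D1 by (simp add: c_def)
  have main: "\<exists>a. cmod a \<ge> A0 \<and> real (card (trace_class C a)) \<ge> c * (cmod a)\<^sup>2" for A0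
  proof (rule ccontr)
    assume "\<not> ?thesis"
    then have small: "real (card (trace_class C a)) \<le> c * (cmod a)\<^sup>2" if "cmod a \<ge> A0" for a
      using that by force
    \<comment> \<open>Elements whose trace lies below the threshold \<open>A0\<close>: a fixed
      finite set, negligible as R grows.\<close>
    define E where "E = {y \<in> Gam. norm y \<le> C * A0}"
    have fE: "finite E" by (simp add: E_def finite_Gam_ball)
    have bound: "c1 * R ^ 4 \<le> 8 * real (card E)" if R: "R \<ge> R0" "R \<ge> 1" for R
    proof -
      let ?N = "{\<gamma> \<in> Gam. norm \<gamma> \<le> R}"
      let ?Z = "{a \<in> Zi. cmod a \<le> 2 * D * R}"
      let ?W = "E \<union> (\<Union>a\<in>{a \<in> ?Z. cmod a \<ge> A0}. trace_class C a)"
      have DR: "2 * D * R \<ge> 1" using mult_mono[OF D1 R(2)] D1 by simp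
      have fZ: "finite {a \<in> ?Z. cmod a \<ge> A0}" by (rule finite_subset[OF _ finite_Zi_ball]) auto
      have fW: "finite ?W" using fE fZ by (auto simp: finite_trace_class)
      have "?N \<subseteq> (\<Union>s\<in>spanning_set. (\<lambda>y. y ** adj s) ` ?W)"
      proof
        fix \<gamma> assume g: "\<gamma> \<in> ?N"
        then obtain s where s: "s \<in> spanning_set" "norm \<gamma> \<le> 800 * cmod (trace (\<gamma> ** s))"
          using spanning_set_trace GamD by blast
        let ?y = "\<gamma> ** s" and ?a = "trace (\<gamma> ** s)"
        have sG: "s \<in> Gam" "det s = 1" using s(1) spanning_set_Gam GamD by auto
        have yG: "?y \<in> Gam" using g sG Gam_mult by blast
        have ny: "norm ?y \<le> norm \<gamma> * D"
          using norm_mult_cmat[of \<gamma> s] mult_left_mono[OF D[OF s(1)] norm_ge_zero[of \<gamma>]] by linarith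
        also have "\<dots> \<le> (800 * cmod ?a) * D" using s(2) D1 by (intro mult_right_mono) auto
        finally have nC: "norm ?y \<le> C * cmod ?a" by (simp add: C_def mult_ac)
        have "norm \<gamma> * D \<le> R * D" using g D1 by (intro mult_right_mono) auto
        then have aR: "cmod ?a \<le> 2 * D * R" using norm_trace_le[of ?y] ny by (simp add: mult_ac)
        have "?y \<in> ?W"
        proof (cases "cmod ?a \<ge> A0")
          case True
          have "?a \<in> Zi" using yG GamD Ord_trace by blast
          then show ?thesis using True aR yG nC by (auto simp: trace_class_def)
        next
          case False
          have "C * cmod ?a \<le> C * A0" using False D1 by (intro mult_left_mono) (auto simp: C_def)
          then show ?thesis using nC yG by (simp add: E_def)
        qed
        moreover have "\<gamma> = ?y ** adj s" using sG by (simp add: adj_cancel)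
        ultimately show "\<gamma> \<in> (\<Union>s\<in>spanning_set. (\<lambda>y. y ** adj s) ` ?W)" using s(1) by blast
      qed
      then have "card ?N \<le> card (\<Union>s\<in>spanning_set. (\<lambda>y. y ** adj s) ` ?W)"
        using fs(1) fW by (intro card_mono) auto
      also have "\<dots> \<le> (\<Sum>s\<in>spanning_set. card ((\<lambda>y. y ** adj s) ` ?W))" by (rule card_UN_le[OF fs(1)])
      also have "\<dots> \<le> (\<Sum>s\<in>spanning_set. card ?W)" by (intro sum_mono card_image_le fW)
      also have "\<dots> \<le> 4 * card ?W" using fs(2) by simp
      finally have N4: "real (card ?N) \<le> 4 * real (card ?W)" by simp
      have "card ?W \<le> card E + card (\<Union>a\<in>{a \<in> ?Z. cmod a \<ge> A0}. trace_class C a)" by (rule card_Un_le)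
      also have "card (\<Union>a\<in>{a \<in> ?Z. cmod a \<ge> A0}. trace_class C a) \<le> (\<Sum>a\<in>{a \<in> ?Z. cmod a \<ge> A0}. card (trace_class C a))"
        by (rule card_UN_le[OF fZ])
      finally have "real (card ?W) \<le> real (card E) + (\<Sum>a\<in>{a \<in> ?Z. cmod a \<ge> A0}. real (card (trace_class C a)))"
        by (simp flip: of_nat_sum of_nat_add)
      also have "(\<Sum>a\<in>{a \<in> ?Z. cmod a \<ge> A0}. real (card (trace_class C a))) \<le> (\<Sum>a\<in>{a \<in> ?Z. cmod a \<ge> A0}. c * (2 * D * R)\<^sup>2)"
      proof (rule sum_mono)
        fix a assume "a \<in> {a \<in> ?Z. cmod a \<ge> A0}"
        then have "cmod a \<ge> A0" "cmod a \<le> 2 * D * R" by auto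
        then show "real (card (trace_class C a)) \<le> c * (2 * D * R)\<^sup>2"
          using small[of a] mult_left_mono[OF power_mono[of "cmod a" "2 * D * R" 2], of c] c
          by (simp del: power_mult_distrib) (erule order_trans, simp)
      qed
      also have "\<dots> = real (card {a \<in> ?Z. cmod a \<ge> A0}) * (c * (2 * D * R)\<^sup>2)" by simp
      also have "\<dots> \<le> (9 * (2 * D * R)\<^sup>2) * (c * (2 * D * R)\<^sup>2)"
      proof (rule mult_right_mono)
        have "card {a \<in> ?Z. cmod a \<ge> A0} \<le> card ?Z" by (rule card_mono) (auto simp: finite_Zi_ball)
        then show "real (card {a \<in> ?Z. cmod a \<ge> A0}) \<le> 9 * (2 * D * R)\<^sup>2" using card_Zi_ball[OF DR] by simp
      qed (use c in simp)
      also have "\<dots> = c1 * R ^ 4 / 8"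
        using D1 by (simp add: c_def power_mult_distrib field_simps flip: power_add)
      finally have "real (card ?N) \<le> 4 * real (card E) + c1 * R ^ 4 / 2" using N4 by simp
      then show ?thesis using c1(2)[OF R(1)] by simp
    qed
    define R where "R = max R0 (1 + 8 * real (card E) / c1)"
    have "8 * real (card E) / c1 \<ge> 0" using c1(1) by simp
    then have R: "R \<ge> R0" "R \<ge> 1" "R > 8 * real (card E) / c1" unfolding R_def by linarith+
    have "R * 1 \<le> R * R ^ 3" using R(2) by (intro mult_left_mono one_le_power) auto
    then have "R \<le> R ^ 4" by (simp add: power_numeral_reduce)
    then have "8 * real (card E) / c1 < R ^ 4" using R(3) by linarith
    then have "8 * real (card E) < c1 * R ^ 4" using c1 by (simp add: divide_less_eq mult.commute)
    then show False using bound[OF R(1,2)] by linarith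
  qed
  show thesis by (rule that[OF c _ main]) (use D1 in \<open>simp add: C_def\<close>)
qed

subsection \<open>Translation lengths\<close>

lemma eigenvalues_exist:
  fixes t :: complex
  obtains l m where "l + m = t" "l * m = 1" "cmod l \<ge> 1" "(l - m)\<^sup>2 = t\<^sup>2 - 4"
proof -
  define r where "r = csqrt (t\<^sup>2 - 4)"
  have r: "r\<^sup>2 = t\<^sup>2 - 4" by (simp add: r_def)
  define l m where "l = (t + r) / 2" "m = (t - r) / 2"
  note lm = this
  have s: "l + m = t" by (simp add: lm field_simps)
  have "l * m = (t\<^sup>2 - r\<^sup>2) / 4" by (simp add: lm power2_eq_square algebra_simps)
  then have p: "l * m = 1" by (simp add: r)
  have d: "(l - m)\<^sup>2 = t\<^sup>2 - 4" "(m - l)\<^sup>2 = t\<^sup>2 - 4" using r by (simp_all add: lm field_simps)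
  have n: "cmod l * cmod m = 1" using arg_cong[OF p, of cmod] by (simp add: norm_mult)
  show thesis
  proof (cases "cmod l \<ge> 1")
    case True
    then show thesis using that s p d by blast
  next
    case False
    then have "cmod l * cmod m \<le> 1 * cmod m" by (intro mult_right_mono) auto
    then have "cmod m \<ge> 1" using n by simp
    then show thesis using that[of m l] s p d by (simp add: ac_simps)
  qed
qed

lemma diagonalize_aux:
  fixes g q :: cmat
  assumes "g ** q = q ** mk l 0 0 m" "det q \<noteq> 0"
  obtains Q where "det Q = 1" "g = Q ** mk l 0 0 m ** adj Q"
proof
  define c where "c = 1 / csqrt (det q)"
  have c: "c\<^sup>2 * det q = 1" using assms(2) by (simp add: c_def power_divide)
  let ?Q = "mat c ** q"
  show d: "det ?Q = 1" by (simp add: det_scale c)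
  have "g ** ?Q = ?Q ** mk l 0 0 m"
    using assms(1) mat_mult_left_commute[of g c q] by (simp flip: matrix_mul_assoc)
  then have "?Q ** mk l 0 0 m ** adj ?Q = g ** ?Q ** adj ?Q" by simp
  also have "\<dots> = g" by (rule adj_cancel(4)[OF d])
  finally show "g = ?Q ** mk l 0 0 m ** adj ?Q" by simp
qed

lemma diagonalize:
  fixes g :: cmat
  assumes "det g = 1" "l + m = trace g" "l * m = 1" "l \<noteq> m"
  obtains Q where "det Q = 1" "g = Q ** mk l 0 0 m ** adj Q"
proof -
  define a b c d where "a = g$1$1" "b = g$1$2" "c = g$2$1" "d = g$2$2"
  note abcd = this
  have g: "g = mk a b c d" by (simp add: cmat_eq_iff abcd)
  have det: "a * d - b * c = 1" and tr: "l + m = a + d"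
    using assms by (simp_all add: det_cmat trace_cmat abcd)
  have rl: "l * l = (a + d) * l - (a * d - b * c)" and rm: "m * m = (a + d) * m - (a * d - b * c)"
    unfolding det tr[symmetric] using assms(3) by (simp_all add: algebra_simps)
  consider "c \<noteq> 0" | "b \<noteq> 0" | "b = 0" "c = 0" by blast
  then show thesis
  proof cases
    case 1
    have "g ** mk (l - d) (m - d) c c = mk (l - d) (m - d) c c ** mk l 0 0 m"
      using rl rm by (simp add: cmat_eq_iff g algebra_simps)
    moreover have "det (mk (l - d) (m - d) c c) \<noteq> 0" using 1 assms(4) by (simp add: det_cmat algebra_simps)
    ultimately show thesis using that by (rule diagonalize_aux)
  next
    case 2
    have "g ** mk b b (l - a) (m - a) = mk b b (l - a) (m - a) ** mk l 0 0 m"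
      using rl rm by (simp add: cmat_eq_iff g algebra_simps)
    moreover have "det (mk b b (l - a) (m - a)) \<noteq> 0" using 2 assms(4) by (simp add: det_cmat algebra_simps)
    ultimately show thesis using that by (rule diagonalize_aux)
  next
    case 3
    have "(l - a) * (l - d) = 0" using rl 3 by (simp add: algebra_simps)
    moreover have "m = a + d - l" using tr by (simp add: algebra_simps)
    ultimately consider "l = a" "m = d" | "l = d" "m = a" by auto
    then show thesis
    proof cases
      case 1
      then show thesis using 3 that[of "mat 1"] by (simp add: g)
    next
      case 2
      then show thesis using 3 that[of "mk 0 (-1) 1 0"] by (simp add: g cmat_eq_iff det_cmat)
    qed
  qed
qed

lemma norm_diag_sq:
  assumes "l + m = t" "(l - m)\<^sup>2 = t\<^sup>2 - 4"
  shows "(norm (mk l 0 0 m))\<^sup>2 = fl t / 2"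
proof -
  have "(cmod (l + m))\<^sup>2 + (cmod (l - m))\<^sup>2 = 2 * (cmod l)\<^sup>2 + 2 * (cmod m)\<^sup>2"
    unfolding cmod_power2 by (simp add: power2_eq_square algebra_simps)
  moreover have "(cmod (l - m))\<^sup>2 = cmod (t\<^sup>2 - 4)" using assms(2) by (metis norm_power)
  ultimately show ?thesis using assms(1) by (simp add: norm_cmat_sq fl_def)
qed

lemma fl_ge_4: "fl t \<ge> 4"
proof -
  have "cmod (t\<^sup>2 - (t\<^sup>2 - 4)) \<le> cmod (t\<^sup>2) + cmod (t\<^sup>2 - 4)" by (rule norm_triangle_ineq4)
  then show ?thesis by (simp add: fl_def norm_power)
qed

lemma base_in_H3: "(0, 1) \<in> H3"
  by (simp add: H3_def)

lemma geod_len_ge: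
  assumes "\<kappa> \<ge> 1" "\<And>p. p \<in> H3 \<Longrightarrow> ch p (act g p) \<ge> \<kappa>"
  shows "geod_len g \<ge> arcosh \<kappa>"
  unfolding geod_len_def
proof (rule cInf_greatest)
  show "{hdist p (act g p) |p. p \<in> H3} \<noteq> {}" using base_in_H3 by blast
  fix x assume "x \<in> {hdist p (act g p) |p. p \<in> H3}"
  then obtain p where p: "p \<in> H3" "x = arcosh (ch p (act g p))" by (auto simp: hdist_ch)
  have "\<kappa> \<le> ch p (act g p)" using assms(2)[OF p(1)] .
  then show "arcosh \<kappa> \<le> x" using assms(1) p(2)
    by (metis arcosh_real_strict_mono order_le_less)
qed

text \<open>The lower bound for displacements is attained on the axis: at the image of the base
  point under the diagonalising matrix \<open>Q\<close>, the element is seen as a diagonal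
  matrix.\<close>

lemma geod_len_eq:
  assumes "det g = 1" "(trace g)\<^sup>2 \<noteq> 4"
  shows "geod_len g = arcosh (fl (trace g) / 4)"
proof -
  obtain l m where lm: "l + m = trace g" "l * m = 1" "cmod l \<ge> 1" "(l - m)\<^sup>2 = (trace g)\<^sup>2 - 4"
    by (rule eigenvalues_exist)
  have "l \<noteq> m" using lm(4) assms(2) by auto
  obtain Q where Q: "det Q = 1" "g = Q ** mk l 0 0 m ** adj Q"
    by (rule diagonalize[OF assms(1) lm(1,2) \<open>l \<noteq> m\<close>])
  define p where "p = act Q (0, 1)"
  have pH: "p \<in> H3" using Q base_in_H3 by (simp add: p_def act_in_H3)
  have "Herm (0, 1) = mat 1" by (simp add: Herm_def cmat_eq_iff)
  then have "Herm p = Q ** ctr Q" using Herm_act[OF Q(1) base_in_H3] by (simp add: p_def)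
  then have "ch p (act g p) = (norm (adj Q ** g ** Q))\<^sup>2 / 2" using ch_act_of_Herm assms(1) pH by blast
  also have "adj Q ** g ** Q = mk l 0 0 m"
    unfolding Q(2) using Q(1) by (simp add: matrix_mul_assoc mult_adj) (simp add: mult_adj flip: matrix_mul_assoc)
  finally have "ch p (act g p) = fl (trace g) / 4" using norm_diag_sq[OF lm(1,4)] by simp
  then have eq: "hdist p (act g p) = arcosh (fl (trace g) / 4)" by (simp only: hdist_ch)
  have "bdd_below {hdist p (act g p) |p. p \<in> H3}"
  proof (rule bdd_belowI[of _ 0])
    fix x assume "x \<in> {hdist p (act g p) |p. p \<in> H3}"
    then obtain p where "p \<in> H3" "x = arcosh (ch p (act g p))" by (auto simp: hdist_ch)
    then show "0 \<le> x" using ch_ge_1[of p "act g p"] act_in_H3 assms(1) by simp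
  qed
  moreover have "arcosh (fl (trace g) / 4) \<in> {hdist p (act g p) |p. p \<in> H3}"
    unfolding eq[symmetric] using pH by blast
  ultimately have "geod_len g \<le> arcosh (fl (trace g) / 4)"
    unfolding geod_len_def by (intro cInf_lower)
  moreover have "arcosh (fl (trace g) / 4) \<le> geod_len g"
    using fl_ge_4[of "trace g"] ch_act_ge[OF assms(1)] by (intro geod_len_ge) (auto simp: fl_def)
  ultimately show ?thesis by simp
qed

subsection \<open>Counting shortest geodesics\<close>

lemma square_in_Gcong:
  assumes "y \<in> Gam" "trace y = a"
  shows "y ** y \<in> Gcong a"
proof -
  have "y ** y = - mat 1 + mat a ** y" using cayley_hamilton[of y] assms GamD by simp
  then have "qcong a (y ** y) (- mat 1)" using assms GamD by (auto simp: qcong_def)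
  then show ?thesis using assms by (simp add: Gcong_def Gam_mult)
qed

lemma trace_square: "y \<in> Gam \<Longrightarrow> trace (y ** y) = (trace y)\<^sup>2 - 2"
  using cayley_hamilton[of y] GamD by (simp add: trace_sub trace_scale trace_mat power2_eq_square)

lemma trace_conj': "det h = 1 \<Longrightarrow> trace (h ** g ** adj h) = trace (g::cmat)"
  using trace_conj[of "adj h" g] by simp

context
  fixes a :: complex and y1 :: cmat
  assumes y1: "y1 \<in> Gam" "trace y1 = a" and a13: "cmod a \<ge> 13"
begin

lemma a_big: "cmod a \<ge> 4" "a \<noteq> 0" "cmod (a\<^sup>2 - 2) \<ge> 3" "a\<^sup>2 - 2 \<noteq> 0" "(a\<^sup>2 - 2)\<^sup>2 \<noteq> 4"
proof -
  show "cmod a \<ge> 4" "a \<noteq> 0" using a13 by auto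
  have "(cmod a)\<^sup>2 \<ge> 13\<^sup>2" using a13 by (intro power_mono) auto
  then show 3: "cmod (a\<^sup>2 - 2) \<ge> 3" using norm_triangle_ineq2[of "a\<^sup>2" 2] by (simp add: norm_power)
  then show "a\<^sup>2 - 2 \<noteq> 0" by auto
  show "(a\<^sup>2 - 2)\<^sup>2 \<noteq> 4"
  proof
    assume "(a\<^sup>2 - 2)\<^sup>2 = 4"
    then have "(cmod (a\<^sup>2 - 2))\<^sup>2 = 4" by (metis norm_numeral norm_power)
    moreover have "3\<^sup>2 \<le> (cmod (a\<^sup>2 - 2))\<^sup>2" using 3 by (intro power_mono) auto
    ultimately show False by simp
  qed
qed

lemma short_element:
  assumes "x \<in> Gcong a" "trace x = a\<^sup>2 - 2"
  shows "nontrivial_elt x" "geod_len x = arcosh (fl (a\<^sup>2 - 2) / 4)"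
proof -
  show "nontrivial_elt x"
    using a_big(5) assms(2) by (auto simp: nontrivial_elt_def trace_mat)
  show "geod_len x = arcosh (fl (a\<^sup>2 - 2) / 4)"
    using geod_len_eq[of x] assms Gcong_Gam GamD a_big(5) by metis
qed

lemma systole_Gcong: "systole (Gcong a) = arcosh (fl (a\<^sup>2 - 2) / 4)"
  unfolding systole_def
proof (rule cInf_eq_minimum)
  have "y1 ** y1 \<in> Gcong a" "trace (y1 ** y1) = a\<^sup>2 - 2"
    using square_in_Gcong[OF y1] trace_square[OF y1(1)] y1(2) by simp_all
  then show "arcosh (fl (a\<^sup>2 - 2) / 4) \<in> {geod_len g |g. g \<in> Gcong a \<and> nontrivial_elt g}"
    using short_element by force
  fix x assume "x \<in> {geod_len g |g. g \<in> Gcong a \<and> nontrivial_elt g}"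
  then show "arcosh (fl (a\<^sup>2 - 2) / 4) \<le> x"
    using displaces_Gcong[OF y1 a_big(1)] by (auto simp: displaces_def intro!: geod_len_ge)
qed

lemma conj_class_Gcong:
  "conj_class (Gcong a) g = {s *\<^sub>R (d ** g ** adj d) | d s. d \<in> Gcong a \<and> (s = 1 \<or> s = -1)}"
proof -
  have "matrix_inv d = adj d" if "d \<in> Gcong a" for d
    using matrix_inv_eq_adj Gcong_Gam GamD that by blast
  then show ?thesis unfolding conj_class_def by (intro Collect_cong ex_cong1) auto
qed

lemma conj_class_conj:
  assumes d: "d \<in> Gcong a"
  shows "conj_class (Gcong a) (d ** g ** adj d) = conj_class (Gcong a) g"
proof
  have sub: "conj_class (Gcong a) (d ** g ** adj d) \<subseteq> conj_class (Gcong a) g" if d: "d \<in> Gcong a" for d g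
  proof
    fix x assume "x \<in> conj_class (Gcong a) (d ** g ** adj d)"
    then obtain e s where e: "e \<in> Gcong a" "s = 1 \<or> s = -1" "x = s *\<^sub>R (e ** (d ** g ** adj d) ** adj e)"
      unfolding conj_class_Gcong by blast
    then have "x = s *\<^sub>R ((e ** d) ** g ** adj (e ** d))" by (simp add: adj_mult matrix_mul_assoc)
    then show "x \<in> conj_class (Gcong a) g" unfolding conj_class_Gcong using Gcong_mult[OF e(1) d] e(2) by blast
  qed
  show "conj_class (Gcong a) (d ** g ** adj d) \<subseteq> conj_class (Gcong a) g" by (rule sub[OF d])
  have dd: "det d = 1" using d Gcong_Gam GamD by blast
  have "adj d ** (d ** g ** adj d) ** adj (adj d) = g"
    using dd by (simp add: matrix_mul_assoc mult_adj) (simp add: mult_adj flip: matrix_mul_assoc)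
  then show "conj_class (Gcong a) g \<subseteq> conj_class (Gcong a) (d ** g ** adj d)"
    using sub[OF Gcong_adj[OF d], of "d ** g ** adj d"] by simp
qed

definition short_classes :: "cmat set set" where
  "short_classes = {conj_class (Gcong a) g | g. g \<in> Gcong a \<and> nontrivial_elt g \<and> geod_len g = systole (Gcong a)}"

text \<open>\<open>Kiss\<close> is a \<open>card\<close>, which is 0 for infinite sets, so a lower
  bound for it needs finiteness. Every shortest class contains an element of bounded norm: conjugate
  a point of nearly minimal displacement into the compact covering set.\<close>

lemma finite_short_classes: "finite short_classes"
proof -
  let ?\<kappa> = "fl (a\<^sup>2 - 2) / 4"
  obtain F where F: "F \<subseteq> Gam" "\<And>x. x \<in> Gam \<Longrightarrow> \<exists>f\<in>F. adj f ** x \<in> Gcong a"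
    "\<And>f f'. f \<in> F \<Longrightarrow> f' \<in> F \<Longrightarrow> adj f ** f' \<in> Gcong a \<Longrightarrow> f = f'"
    using coset_representatives by metis
  have "a \<in> Zi" using y1 GamD Ord_trace by auto
  then have fin: "finite F" using incongruent_card(1)[OF incongruent_coset_representatives[OF F(1,3)]] a_big(2) by blast
  obtain C where C: "C \<ge> 2" "\<And>p. p \<in> H3 \<Longrightarrow> \<exists>\<gamma>\<in>Gam. hnorm (act \<gamma> p) \<le> C"
    using Gam_cocompact by blast
  define N where "N = (\<Sum>f\<in>F. norm f)"
  have N: "norm f \<le> N" if "f \<in> F" for f
    unfolding N_def using that fin by (intro member_le_sum) auto
  define L where "L = N * sqrt C"
  define B where "B = L * sqrt (2 * (?\<kappa> + 1)) * L"
  have "short_classes \<subseteq> conj_class (Gcong a) ` {x \<in> Gam. norm x \<le> B}"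
  proof
    fix X assume "X \<in> short_classes"
    then obtain g where g: "X = conj_class (Gcong a) g" "g \<in> Gcong a" "geod_len g = arcosh ?\<kappa>"
      unfolding short_classes_def systole_Gcong by blast
    have dg: "det g = 1" using g Gcong_Gam GamD by blast
    have k1: "?\<kappa> \<ge> 1" using fl_ge_4[of "a\<^sup>2 - 2"] by simp
    \<comment> \<open>The infimum need not be attained at a known point; the slack 1 provides a
      point with displacement below arcosh (\<kappa> + 1).\<close>
    then have "Inf {hdist p (act g p) |p. p \<in> H3} < arcosh (?\<kappa> + 1)"
      using g(3) arcosh_real_strict_mono[of ?\<kappa> "?\<kappa> + 1"] by (simp add: geod_len_def)
    moreover have "{hdist p (act g p) |p. p \<in> H3} \<noteq> {}" using base_in_H3 by blast
    ultimately have "\<exists>x\<in>{hdist p (act g p) |p. p \<in> H3}. x < arcosh (?\<kappa> + 1)"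
      by (rule cInf_lessD[rotated])
    then obtain p where p: "p \<in> H3" "arcosh (ch p (act g p)) < arcosh (?\<kappa> + 1)"
      unfolding hdist_ch by blast
    then have ch: "ch p (act g p) < ?\<kappa> + 1"
      using k1 ch_ge_1[OF p(1) act_in_H3[OF dg p(1)]] arcosh_less_iff_real[of "ch p (act g p)" "?\<kappa> + 1"] by linarith
    let ?X = "adj (hmat p) ** g ** hmat p"
    have "(norm ?X)\<^sup>2 \<le> 2 * (?\<kappa> + 1)" using ch ch_act[OF dg p(1)] by simp
    then have nX: "norm ?X \<le> sqrt (2 * (?\<kappa> + 1))" by (simp add: real_le_rsqrt)
    obtain \<gamma> where \<gamma>: "\<gamma> \<in> Gam" "hnorm (act \<gamma> p) \<le> C" using C(2)[OF p(1)] by blast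
    obtain f where f: "f \<in> F" "adj f ** \<gamma> \<in> Gcong a" using F(2)[OF \<gamma>(1)] by blast
    define d where "d = adj f ** \<gamma>"
    have d: "d \<in> Gcong a" "det d = 1" using f(2) Gcong_Gam GamD by (auto simp: d_def)
    have "(norm (\<gamma> ** hmat p))\<^sup>2 \<le> C" using \<gamma> hnorm_act[OF GamD(2)[OF \<gamma>(1)] p(1)] by simp
    then have "norm (\<gamma> ** hmat p) \<le> sqrt C" by (simp add: real_le_rsqrt)
    then have "norm f * norm (\<gamma> ** hmat p) \<le> N * sqrt C"
      using N[OF f(1)] order_trans[OF norm_ge_zero N[OF f(1)]] by (intro mult_mono) auto
    then have nh: "norm (d ** hmat p) \<le> L"
      using norm_mult_cmat[of "adj f" "\<gamma> ** hmat p"] by (simp add: d_def L_def matrix_mul_assoc)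
    have "d ** g ** adj d = (d ** hmat p) ** ?X ** adj (d ** hmat p)"
      using mult_adj[of "hmat p"] det_hmat[OF p(1)]
      by (simp add: adj_mult) (simp add: matrix_mul_assoc, simp add: mult_adj flip: matrix_mul_assoc)
    then have "norm (d ** g ** adj d) \<le> norm (d ** hmat p) * norm ?X * norm (d ** hmat p)"
      using norm_mult_cmat[of "(d ** hmat p) ** ?X" "adj (d ** hmat p)"]
        mult_right_mono[OF norm_mult_cmat[of "d ** hmat p" ?X] norm_ge_zero[of "d ** hmat p"]] by simp
    also have "\<dots> \<le> B"
      unfolding B_def using nh nX order_trans[OF norm_ge_zero nh] k1
      by (intro mult_mono mult_nonneg_nonneg) auto
    finally have "d ** g ** adj d \<in> {x \<in> Gam. norm x \<le> B}"
      using Gcong_conj[OF g(2), of d] d Gcong_Gam by blast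
    moreover have "X = conj_class (Gcong a) (d ** g ** adj d)" using conj_class_conj[OF d(1)] g(1) by simp
    ultimately show "X \<in> conj_class (Gcong a) ` {x \<in> Gam. norm x \<le> B}" by blast
  qed
  then show ?thesis by (rule finite_subset) (simp add: finite_Gam_ball)
qed

lemma Kiss_eq: "Kiss (Gcong a) = card short_classes"
  by (simp add: Kiss_def short_classes_def)

lemma conj_class_self: "g \<in> conj_class (Gcong a) g"
  unfolding conj_class_Gcong
  by (rule CollectI, rule exI[of _ "mat 1"], rule exI[of _ 1]) (simp add: Gcong_one)

text \<open>Two shortest elements \<open>f y\<^sup>2 f\<^sup>-\<^sup>1\<close> and \<open>f\<^sub>0 y\<^sub>0\<^sup>2 f\<^sub>0\<^sup>-\<^sup>1\<close> of the same class are related by an element \<open>h\<close>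
  that conjugates \<open>y\<close> to \<open>y\<^sub>0\<close>; it is unique up to powers of \<open>y\<^sub>0\<^sup>2\<close>.\<close>
definition linked :: "cmat \<Rightarrow> cmat \<Rightarrow> cmat \<Rightarrow> cmat \<Rightarrow> cmat \<Rightarrow> bool" where
  "linked f0 y0 h f y \<longleftrightarrow> h \<in> Gam \<and> y0 = h ** y ** adj h \<and> f0 ** h ** adj f \<in> Gcong a"

lemma linked_exists:
  assumes f: "f \<in> Gam" "f0 \<in> Gam" and y: "y \<in> Gam" "trace y = a" "y0 \<in> Gam" "trace y0 = a"
    and cc: "conj_class (Gcong a) (f ** (y ** y) ** adj f) = conj_class (Gcong a) (f0 ** (y0 ** y0) ** adj f0)"
  shows "\<exists>h. linked f0 y0 h f y"
proof -
  have "f ** (y ** y) ** adj f \<in> conj_class (Gcong a) (f0 ** (y0 ** y0) ** adj f0)"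
    using conj_class_self[of "f ** (y ** y) ** adj f"] cc by simp
  then obtain d s where d: "d \<in> Gcong a" "s = 1 \<or> s = -1"
    "f ** (y ** y) ** adj f = s *\<^sub>R (d ** (f0 ** (y0 ** y0) ** adj f0) ** adj d)"
    unfolding conj_class_Gcong by blast
  have det: "det f = 1" "det f0 = 1" "det d = 1" "det y = 1" "det y0 = 1" using f y d Gcong_Gam GamD by blast+
  have "trace (f ** (y ** y) ** adj f) = a\<^sup>2 - 2" using det trace_square y by (simp add: trace_conj')
  moreover have "trace (d ** (f0 ** (y0 ** y0) ** adj f0) ** adj d) = a\<^sup>2 - 2"
    using det trace_square y by (simp add: trace_conj')
  moreover have "trace (- 1 *\<^sub>R x) = - trace x" for x :: cmat by simp
  \<comment> \<open>Both squares have the same nonzero trace a^2 - 2, which rules out the sign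
    -1.\<close>
  ultimately have "s \<noteq> -1" using d(3) a_big(4) by (metis eq_neg_iff_add_eq_0 mult_2 mult_eq_0_iff zero_neq_numeral)
  then have e: "f ** (y ** y) ** adj f = d ** (f0 ** (y0 ** y0) ** adj f0) ** adj d" using d by auto
  define h where "h = adj f0 ** adj d ** f"
  have hG: "h \<in> Gam" unfolding h_def using f d Gcong_Gam by (intro Gam_closed) auto
  then have dh: "det h = 1" using GamD by blast
  have "h ** (y ** y) ** adj h = adj f0 ** adj d ** (f ** (y ** y) ** adj f) ** d ** f0"
    by (simp add: h_def adj_mult cmat_mult_assoc)
  also have "\<dots> = y0 ** y0" unfolding e using det by (simp add: cmat_mult_assoc adj_cancel mult_adj)
  finally have hy: "h ** (y ** y) ** adj h = y0 ** y0" .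
  \<comment> \<open>An element of trace a is recovered linearly from its square, so a conjugation
    matching the squares matches y with y0 as well.\<close>
  have sq: "y ** y = mat a ** y - mat 1" "y0 ** y0 = mat a ** y0 - mat 1"
    using cayley_hamilton det y by auto
  have "h ** (mat a ** y) ** adj h - h ** adj h = mat a ** y0 - mat 1"
    using hy unfolding sq by (simp add: cmat_distrib)
  then have "mat a ** (h ** y ** adj h) = mat a ** y0"
    using dh mat_mult_left_commute[of h a y] by (simp add: mult_adj cmat_mult_assoc)
  then have "y0 = h ** y ** adj h" using mat_cancel[OF a_big(2)] by metis
  moreover have "f0 ** h ** adj f = adj d" using det by (simp add: h_def cmat_mult_assoc adj_cancel mult_adj)
  ultimately have "linked f0 y0 h f y" using hG Gcong_adj[OF d(1)] by (simp add: linked_def)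
  then show ?thesis by blast
qed

text \<open>Makes the map from pairs (f, y) to h injective when f runs through coset
  representatives, so that a fibre can be counted by elements of \<open>Gam\<close>.\<close>

lemma linked_determines:
  assumes f: "f \<in> Gam" "f' \<in> Gam" "f0 \<in> Gam" and L: "linked f0 y0 h f y" "linked f0 y0 h f' y'"
  shows "y = y'" "adj f' ** f \<in> Gcong a"
proof -
  have dh: "det h = 1" and df: "det f = 1" "det f' = 1" "det f0 = 1" using f L GamD by (auto simp: linked_def)
  have "h ** y ** adj h = h ** y' ** adj h" using L by (simp add: linked_def)
  then have "adj h ** (h ** y ** adj h) ** h = adj h ** (h ** y' ** adj h) ** h" by simp
  then show "y = y'" using dh by (simp add: cmat_mult_assoc adj_cancel mult_adj)
  have "adj (f0 ** h ** adj f) ** (f0 ** h ** adj f') \<in> Gcong a"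
    by (rule Gcong_mult[OF Gcong_adj]) (use L in \<open>simp_all add: linked_def\<close>)
  then have "f ** adj f' \<in> Gcong a" using dh df by (simp add: adj_mult cmat_mult_assoc adj_cancel)
  from Gcong_conj[OF this Gam_adj[OF f(1)]] show "adj f' ** f \<in> Gcong a"
    using df by (simp add: cmat_mult_assoc adj_cancel)
qed

text \<open>The square of y0 commutes with y0 and lies in the normal subgroup
  \<open>Gcong a\<close>. Hence h can be moved along the axis of y0 in whole periods.\<close>

lemma linked_shift:
  assumes f0: "f0 \<in> Gam" and y0: "y0 \<in> Gam" "trace y0 = a" and L: "linked f0 y0 h f y"
  shows "linked f0 y0 (y0 ** y0 ** h) f y" "linked f0 y0 (adj (y0 ** y0) ** h) f y"
proof -
  have d: "det y0 = 1" "det f0 = 1" "det (y0 ** y0) = 1" using f0 y0 GamD by (auto simp: det_mul)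
  have shift: "linked f0 y0 (z ** h) f y"
    if z: "z \<in> Gcong a" "z ** y0 ** adj z = y0" for z
  proof -
    have h: "h \<in> Gam" "y0 = h ** y ** adj h" "f0 ** h ** adj f \<in> Gcong a" using L by (auto simp: linked_def)
    have "z ** h \<in> Gam" using z(1) h(1) Gcong_Gam Gam_mult by blast
    moreover have "z ** h ** y ** adj (z ** h) = z ** (h ** y ** adj h) ** adj z"
      by (simp add: adj_mult cmat_mult_assoc)
    then have "y0 = z ** h ** y ** adj (z ** h)" using z(2) h(2) by simp
    moreover have "f0 ** (z ** h) ** adj f = (f0 ** z ** adj f0) ** (f0 ** h ** adj f)"
      using d by (simp add: cmat_mult_assoc adj_cancel)
    then have "f0 ** (z ** h) ** adj f \<in> Gcong a" using Gcong_mult[OF Gcong_conj[OF z(1) f0] h(3)] by simp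
    ultimately show ?thesis by (simp add: linked_def)
  qed
  have Z: "y0 ** y0 \<in> Gcong a" by (rule square_in_Gcong[OF y0])
  show "linked f0 y0 (y0 ** y0 ** h) f y"
    by (rule shift[OF Z]) (use d in \<open>simp add: adj_mult cmat_mult_assoc adj_cancel mult_adj\<close>)
  show "linked f0 y0 (adj (y0 ** y0) ** h) f y"
    by (rule shift[OF Gcong_adj[OF Z]]) (use d in \<open>simp add: adj_mult cmat_mult_assoc adj_cancel mult_adj\<close>)
qed

end

section \<open>Orbit points near an axis\<close>

definition row1 :: "cmat \<Rightarrow> real" where
  "row1 q = (cmod (q$1$1))\<^sup>2 + (cmod (q$1$2))\<^sup>2"

definition row2 :: "cmat \<Rightarrow> real" where
  "row2 q = (cmod (q$2$1))\<^sup>2 + (cmod (q$2$2))\<^sup>2"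

lemma row_nonneg [simp]: "0 \<le> row1 q" "0 \<le> row2 q"
  by (simp_all add: row1_def row2_def)

lemma row1_pos:
  assumes "det q = 1"
  shows "row1 q > 0"
proof (rule ccontr)
  assume "\<not> ?thesis"
  then have "row1 q = 0" using row_nonneg(1)[of q] by linarith
  then have "q$1$1 = 0" "q$1$2 = 0" by (simp_all add: row1_def add_nonneg_eq_0_iff)
  then show False using assms by (simp add: det_cmat)
qed

text \<open>\<open>row1 q * row2 q\<close> measures the distance of the point \<open>q\<^sup>-\<^sup>1 j\<close> from the axis of the diagonal
  matrix, and \<open>ln (row1 q)\<close> the position of its foot point.\<close>
lemma rows_bounded_near_axis:
  assumes det: "det q = 1" and n: "norm (adj q ** mk l 0 0 m ** q) \<le> C * A" and A: "A > 0" "cmod (l - m) \<ge> A / 2"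
    and C: "C \<ge> 1"
  shows "row1 q * row2 q \<le> 4 * (1 + 2 * C)\<^sup>2"
proof -
  define p r s t where "p = q$1$1" "r = q$1$2" "s = q$2$1" "t = q$2$2"
  note prst = this
  have d: "p * t - r * s = 1" using det by (simp add: det_cmat prst)
  have e12: "(adj q ** mk l 0 0 m ** q)$1$2 = (l - m) * (r * t)"
    and e21: "(adj q ** mk l 0 0 m ** q)$2$1 = - ((l - m) * (p * s))"
    by (simp_all add: prst algebra_simps)
  have small: "cmod z \<le> 2 * C" if "cmod ((l - m) * z) \<le> C * A" for z
  proof -
    have "A / 2 * cmod z \<le> cmod (l - m) * cmod z" using A by (intro mult_right_mono) auto
    then have "A / 2 * cmod z \<le> C * A" using that by (simp add: norm_mult)
    then have "A * cmod z \<le> A * (2 * C)" by (simp add: mult_ac)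
    then show ?thesis using A(1) by simp
  qed
  have rt: "cmod (r * t) \<le> 2 * C"
    using norm_entry_le[of "adj q ** mk l 0 0 m ** q" 1 2] n unfolding e12 by (intro small) linarith
  have ps: "cmod (p * s) \<le> 2 * C"
    using norm_entry_le[of "adj q ** mk l 0 0 m ** q" 2 1] n unfolding e21 norm_minus_cancel by (intro small) linarith
  have pt: "cmod (p * t) \<le> 1 + cmod (r * s)" "cmod (r * s) \<le> 1 + cmod (p * t)"
  proof -
    have "p * t = 1 + r * s" "r * s = p * t - 1" using d by (simp_all add: algebra_simps)
    then show "cmod (p * t) \<le> 1 + cmod (r * s)" "cmod (r * s) \<le> 1 + cmod (p * t)"
      using norm_triangle_ineq[of 1 "r * s"] norm_triangle_ineq4[of "p * t" 1] by simp_all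
  qed
  \<comment> \<open>The off-diagonal entries of the conjugated matrix bound p s and r t. The
    products p t and r s differ by 1 and multiply to (p s)(r t), so they are bounded too.\<close>
  have prod: "cmod (p * t) * cmod (r * s) \<le> (2 * C) * (2 * C)"
  proof -
    have "cmod (p * t) * cmod (r * s) = cmod (p * s) * cmod (r * t)" by (simp add: norm_mult)
    also have "\<dots> \<le> (2 * C) * (2 * C)" using ps rt C by (intro mult_mono) auto
    finally show ?thesis .
  qed
  have "cmod (p * t) \<le> 2 * C \<or> cmod (r * s) \<le> 2 * C"
  proof (rule ccontr)
    assume "\<not> ?thesis"
    then have "(2 * C) * (2 * C) < cmod (p * t) * cmod (r * s)" using C by (intro mult_strict_mono) auto
    then show False using prod by linarith
  qed
  then have b: "cmod (p * t) \<le> 1 + 2 * C" "cmod (r * s) \<le> 1 + 2 * C" "cmod (p * s) \<le> 1 + 2 * C" "cmod (r * t) \<le> 1 + 2 * C"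
    using pt rt ps by auto
  have "row1 q * row2 q = (cmod (p * s))\<^sup>2 + (cmod (p * t))\<^sup>2 + (cmod (r * s))\<^sup>2 + (cmod (r * t))\<^sup>2"
    by (simp add: row1_def row2_def prst norm_mult power_mult_distrib algebra_simps)
  also have "\<dots> \<le> (1 + 2 * C)\<^sup>2 + (1 + 2 * C)\<^sup>2 + (1 + 2 * C)\<^sup>2 + (1 + 2 * C)\<^sup>2"
    by (intro add_mono power_mono b) auto
  finally show ?thesis by simp
qed

text \<open>Two points close to the axis whose feet are close to each other differ by a bounded
  matrix: every entry of the quotient pairs a first row with a second row.\<close>

lemma norm_adj_mult_rows:
  assumes "row1 q \<le> 2 * row1 q'" "row1 q' \<le> 2 * row1 q" "row1 q * row2 q \<le> K" "row1 q' * row2 q' \<le> K"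
  shows "(norm (adj q ** q'))\<^sup>2 \<le> 32 * K"
proof -
  have sq: "(cmod (x * y - z * w))\<^sup>2 \<le> 8 * K"
    if "(cmod x)\<^sup>2 \<le> row2 q" "(cmod y)\<^sup>2 \<le> row1 q'" "(cmod z)\<^sup>2 \<le> row1 q" "(cmod w)\<^sup>2 \<le> row2 q'" for x y z w
  proof -
    have "(cmod (x * y))\<^sup>2 \<le> row2 q * row1 q'" unfolding norm_mult power_mult_distrib
      using that by (intro mult_mono) auto
    also have "\<dots> \<le> row2 q * (2 * row1 q)" using assms(2) by (intro mult_left_mono) auto
    finally have xy: "(cmod (x * y))\<^sup>2 \<le> 2 * K" using assms(3) by (simp add: mult_ac)
    have "(cmod (z * w))\<^sup>2 \<le> row1 q * row2 q'" unfolding norm_mult power_mult_distrib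
      using that by (intro mult_mono) auto
    also have "\<dots> \<le> (2 * row1 q') * row2 q'" using assms(1) by (intro mult_right_mono) auto
    finally have zw: "(cmod (z * w))\<^sup>2 \<le> 2 * K" using assms(4) by (simp add: mult_ac)
    have "(cmod (x * y - z * w))\<^sup>2 \<le> (cmod (x * y) + cmod (z * w))\<^sup>2"
      by (intro power_mono norm_triangle_ineq4) auto
    also have "\<dots> \<le> 2 * (cmod (x * y))\<^sup>2 + 2 * (cmod (z * w))\<^sup>2"
      using sum_squares_bound[of "cmod (x * y)" "cmod (z * w)"] by (simp add: power2_sum)
    finally show ?thesis using xy zw by linarith
  qed
  have e: "(adj q ** q')$1$1 = q$2$2 * q'$1$1 - q$1$2 * q'$2$1" "(adj q ** q')$1$2 = q$2$2 * q'$1$2 - q$1$2 * q'$2$2"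
    "(adj q ** q')$2$1 = - (q$2$1 * q'$1$1 - q$1$1 * q'$2$1)" "(adj q ** q')$2$2 = - (q$2$1 * q'$1$2 - q$1$1 * q'$2$2)"
    by simp_all
  have "(norm (adj q ** q'))\<^sup>2 \<le> 8 * K + 8 * K + 8 * K + 8 * K"
    unfolding norm_cmat_sq e norm_minus_cancel
    by (intro add_mono sq) (simp_all add: row1_def row2_def)
  then show ?thesis by simp
qed

text \<open>Moves the foot point into a fundamental period of the axis: multiply by q until the
  value is at least 1, then divide while it is at least q.\<close>

lemma real_normalize_by_steps:
  fixes u :: "'a \<Rightarrow> real"
  assumes q: "q > 1" and up: "\<And>h. P h \<Longrightarrow> \<exists>h'. P h' \<and> u h' = q * u h"
    and down: "\<And>h. P h \<Longrightarrow> \<exists>h'. P h' \<and> u h' = u h / q"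
    and h: "P h" "u h > 0"
  shows "\<exists>h'. P h' \<and> 1 \<le> u h' \<and> u h' < q"
proof -
  have ups: "\<exists>h'. P h' \<and> u h' = q ^ n * u h" for n
  proof (induction n)
    case 0
    then show ?case using h by auto
  next
    case (Suc n)
    then obtain h' where "P h'" "u h' = q ^ n * u h" by blast
    then show ?case using up[of h'] by auto
  qed
  obtain n where n: "1 / u h < q ^ n" using real_arch_pow[OF q] by blast
  obtain h1 where h1: "P h1" "u h1 = q ^ n * u h" using ups by blast
  have "1 \<le> u h1" using n h(2) by (simp add: h1 divide_less_eq)
  obtain k where "u h1 < q ^ k" using real_arch_pow[OF q] by blast
  then show ?thesis using h1(1) \<open>1 \<le> u h1\<close>
  proof (induction k arbitrary: h1)
    case 0
    then show ?case by simp
  next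
    case (Suc k)
    show ?case
    proof (cases "u h1 < q")
      case True
      then show ?thesis using Suc.prems by blast
    next
      case False
      obtain h2 where h2: "P h2" "u h2 = u h1 / q" using down[OF Suc.prems(2)] by blast
      have "u h2 < q ^ k" "1 \<le> u h2"
        using Suc.prems(1) False q by (simp_all add: h2 divide_less_eq le_divide_eq mult.commute)
      then show ?thesis using Suc.IH h2(1) by blast
    qed
  qed
qed

text \<open>The orbit points near a geodesic segment of length \<open>L\<close> number \<open>O(L)\<close>: cut the segment
  into pieces of bounded length.\<close>
lemma card_near_axis:
  assumes Q: "det Q = 1" and l: "cmod l > 1" and H: "H \<subseteq> Gam"
    and near: "\<And>h. h \<in> H \<Longrightarrow> 1 \<le> row1 (adj Q ** h) \<and> row1 (adj Q ** h) < cmod l ^ 4"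
    and K: "\<And>h. h \<in> H \<Longrightarrow> row1 (adj Q ** h) * row2 (adj Q ** h) \<le> 4 * (1 + 2 * C)\<^sup>2"
    and C: "C \<ge> 1"
  shows "finite H" "real (card H) \<le> real (card {\<gamma> \<in> Gam. norm \<gamma> \<le> 12 * (1 + 2 * C)}) * (4 * log 2 (cmod l) + 1)"
proof -
  let ?N = "{\<gamma> \<in> Gam. norm \<gamma> \<le> 12 * (1 + 2 * C)}"
  \<comment> \<open>Dyadic pieces of the axis; on one piece the values of \<open>row1\<close> agree
    up to a factor 2.\<close>
  define idx where "idx h = \<lfloor>log 2 (row1 (adj Q ** h))\<rfloor>" for h
  let ?I = "{0..\<lfloor>4 * log 2 (cmod l)\<rfloor>}"
  have idx: "idx h \<in> ?I" if "h \<in> H" for h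
  proof -
    have "0 \<le> log 2 (row1 (adj Q ** h))" using near[OF that] by simp
    moreover have "log 2 (row1 (adj Q ** h)) \<le> log 2 (cmod l ^ 4)"
      by (subst log_le_cancel_iff) (use near[OF that] in linarith)+
    then have "log 2 (row1 (adj Q ** h)) \<le> 4 * log 2 (cmod l)" using l by (simp add: log_nat_power)
    ultimately show ?thesis unfolding idx_def by (auto intro: floor_mono)
  qed
  have piece: "finite {h \<in> H. idx h = i} \<and> card {h \<in> H. idx h = i} \<le> card ?N" for i
  proof (cases "{h \<in> H. idx h = i} = {}")
    case True
    then show ?thesis by (simp only: card.empty finite.emptyI zero_le simp_thms)
  next
    case False
    then obtain h0 where h0: "h0 \<in> H" "idx h0 = i" by blast
    have d0: "det h0 = 1" using h0 H GamD by blast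
    have sub: "{h \<in> H. idx h = i} \<subseteq> (\<lambda>\<gamma>. h0 ** \<gamma>) ` ?N"
    proof
      fix h assume "h \<in> {h \<in> H. idx h = i}"
      then have h: "h \<in> H" "idx h = i" by auto
      let ?u = "row1 (adj Q ** h)" and ?w = "row1 (adj Q ** h0)"
      have pos: "?u \<ge> 1" "?w \<ge> 1" using near h(1) h0(1) by auto
      have "\<lfloor>log 2 ?u\<rfloor> = \<lfloor>log 2 ?w\<rfloor>" using h h0 by (simp add: idx_def)
      then have "log 2 ?u \<le> 1 + log 2 ?w" "log 2 ?w \<le> 1 + log 2 ?u" by linarith+
      then have "log 2 ?u \<le> log 2 (2 * ?w)" "log 2 ?w \<le> log 2 (2 * ?u)" using pos by (simp_all add: log_mult)
      then have u: "?u \<le> 2 * ?w" "?w \<le> 2 * ?u" using pos by simp_all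
      have "(norm (adj (adj Q ** h0) ** (adj Q ** h)))\<^sup>2 \<le> 32 * (4 * (1 + 2 * C)\<^sup>2)"
        by (rule norm_adj_mult_rows[OF u(2,1) K[OF h0(1)] K[OF h(1)]])
      \<comment> \<open>32 * 4 = 128 is at most 144, which is where the radius 12 (1 + 2 C) comes
        from.\<close>
      also have "\<dots> \<le> (12 * (1 + 2 * C))\<^sup>2" unfolding power_mult_distrib by simp
      finally have "norm (adj (adj Q ** h0) ** (adj Q ** h)) \<le> 12 * (1 + 2 * C)"
        by (rule power2_le_imp_le) (use C in simp)
      moreover have "adj (adj Q ** h0) ** (adj Q ** h) = adj h0 ** h"
        using Q by (simp add: adj_mult cmat_mult_assoc adj_cancel)
      ultimately have "adj h0 ** h \<in> ?N"
        using Gam_mult[OF Gam_adj[OF subsetD[OF H h0(1)]] subsetD[OF H h(1)]] by simp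
      moreover have "h = h0 ** (adj h0 ** h)" using d0 by (simp add: adj_cancel)
      ultimately show "h \<in> (\<lambda>\<gamma>. h0 ** \<gamma>) ` ?N" by blast
    qed
    have "card {h \<in> H. idx h = i} \<le> card ?N"
      by (rule surj_card_le[OF finite_Gam_ball sub])
    then show ?thesis using finite_subset[OF sub] finite_Gam_ball by simp
  qed
  have HU: "H = (\<Union>i\<in>?I. {h \<in> H. idx h = i})" using idx by blast
  show "finite H" by (subst HU) (use piece in blast)
  have "card H \<le> (\<Sum>i\<in>?I. card {h \<in> H. idx h = i})"
    using card_UN_le[of ?I "\<lambda>i. {h \<in> H. idx h = i}"] HU by simp
  also have "\<dots> \<le> (\<Sum>i\<in>?I. card ?N)" using piece by (intro sum_mono) blast
  finally have "real (card H) \<le> real (card ?N) * real (card ?I)" by (simp add: mult.commute flip: of_nat_mult)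
  also have "real (card ?I) \<le> 4 * log 2 (cmod l) + 1"
  proof -
    have "log 2 (cmod l) > 0" by (subst zero_less_log_cancel_iff) (use l in linarith)+
    then show ?thesis by (simp add: of_nat_nat)
  qed
  finally show "real (card H) \<le> real (card ?N) * (4 * log 2 (cmod l) + 1)"
    by (simp add: mult_left_mono)
qed

lemma row1_diag: "row1 (mk x 0 0 y ** q) = (cmod x)\<^sup>2 * row1 q"
  by (simp add: row1_def norm_mult power_mult_distrib distrib_left)

text \<open>Each pair of the fibre is assigned a linking element h whose foot lies in one period of
  the axis of y0. The bound on the norm of y keeps h near that axis, and h determines the pair, so
  the fibre is at most the number of orbit points near one period.\<close>

lemma short_class_fibre:
  assumes a13: "cmod a \<ge> 13" and C: "C \<ge> 1" and f0: "f0 \<in> Gam" and y0: "y0 \<in> trace_class C a"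
    and F: "F \<subseteq> Gam" "\<And>f f'. f \<in> F \<Longrightarrow> f' \<in> F \<Longrightarrow> adj f ** f' \<in> Gcong a \<Longrightarrow> f = f'"
  shows "real (card {(f, y) \<in> F \<times> trace_class C a.
      conj_class (Gcong a) (f ** (y ** y) ** adj f) = conj_class (Gcong a) (f0 ** (y0 ** y0) ** adj f0)})
    \<le> real (card {\<gamma> \<in> Gam. norm \<gamma> \<le> 12 * (1 + 2 * C)}) * (17 * ln (cmod a))"
proof -
  let ?Fib = "{(f, y) \<in> F \<times> trace_class C a.
      conj_class (Gcong a) (f ** (y ** y) ** adj f) = conj_class (Gcong a) (f0 ** (y0 ** y0) ** adj f0)}"
  have y0': "y0 \<in> Gam" "trace y0 = a" "det y0 = 1" using y0 GamD by (auto simp: trace_class_def)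
  obtain l m where lm: "l + m = a" "l * m = 1" "cmod l \<ge> 1" "(l - m)\<^sup>2 = a\<^sup>2 - 4"
    by (rule eigenvalues_exist)
  have nlm: "cmod l * cmod m = 1" using arg_cong[OF lm(2), of cmod] by (simp add: norm_mult)
  have "1 * cmod m \<le> cmod l * cmod m" using lm(3) by (intro mult_right_mono) auto
  then have m1: "cmod m \<le> 1" using nlm by simp
  have l_lo: "cmod l \<ge> 12" using norm_triangle_ineq[of l m] lm(1) m1 a13 by simp
  have "l = a - m" by (simp flip: lm(1))
  then have l_hi: "cmod l \<le> cmod a + 1" using norm_triangle_ineq4[of a m] m1 by simp
  have A2: "(cmod a)\<^sup>2 \<ge> 13\<^sup>2" using a13 by (intro power_mono) auto
  have lmA: "cmod (l - m) \<ge> cmod a / 2"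
  proof (rule power2_le_imp_le)
    have "(cmod (l - m))\<^sup>2 = cmod (a\<^sup>2 - 4)" using lm(4) by (metis norm_power)
    also have "\<dots> \<ge> (cmod a)\<^sup>2 - 4" using norm_triangle_ineq2[of "a\<^sup>2" 4] by (simp add: norm_power)
    finally have "(cmod (l - m))\<^sup>2 \<ge> (cmod a)\<^sup>2 - 4" .
    then show "(cmod a / 2)\<^sup>2 \<le> (cmod (l - m))\<^sup>2" using A2 by (simp add: power_divide)
  qed simp
  have "l \<noteq> m" using lmA a13 by auto
  obtain Q where Q: "det Q = 1" "y0 = Q ** mk l 0 0 m ** adj Q"
    by (rule diagonalize[of y0 l m]) (use y0' lm \<open>l \<noteq> m\<close> in auto)
  let ?u = "\<lambda>h. row1 (adj Q ** h)" and ?v = "\<lambda>h. row2 (adj Q ** h)"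
  have sq: "adj Q ** (y0 ** y0 ** h) = mk (l * l) 0 0 (m * m) ** (adj Q ** h)" for h :: cmat
  proof -
    have "mk l 0 0 m ** mk l 0 0 m = mk (l * l) 0 0 (m * m)" by (simp add: cmat_eq_iff)
    moreover have "adj Q ** (y0 ** y0 ** h) = (mk l 0 0 m ** mk l 0 0 m) ** (adj Q ** h)"
      unfolding Q(2) by (simp only: cmat_mult_assoc adj_cancel(1,2)[OF Q(1)])
    ultimately show ?thesis by simp
  qed
  have sq': "adj Q ** (adj (y0 ** y0) ** h) = mk (m * m) 0 0 (l * l) ** (adj Q ** h)" for h :: cmat
  proof -
    have "adj (mk l 0 0 m) ** adj (mk l 0 0 m) = mk (m * m) 0 0 (l * l)" by (simp add: cmat_eq_iff)
    moreover have "adj Q ** (adj (y0 ** y0) ** h) = (adj (mk l 0 0 m) ** adj (mk l 0 0 m)) ** (adj Q ** h)"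
      unfolding Q(2) by (simp only: adj_mult adj_adj cmat_mult_assoc adj_cancel(1,2)[OF Q(1)])
    ultimately show ?thesis by simp
  qed
  \<comment> \<open>The square of y0 acts as diag(l^2, m^2), which multiplies \<open>row1\<close> by
    |l|^4: this is one period of the axis.\<close>
  define q4 where "q4 = cmod l ^ 4"
  have q4: "q4 > 1" unfolding q4_def using l_lo by (intro one_less_power) auto
  have u_up: "?u (y0 ** y0 ** h) = q4 * ?u h" for h
    unfolding sq row1_diag by (simp add: q4_def norm_mult power2_eq_square power4_eq_xxxx mult.assoc)
  have m4: "(cmod (m * m))\<^sup>2 = 1 / q4"
  proof -
    have "(cmod (m * m))\<^sup>2 * q4 = (cmod l * cmod m) ^ 4"
      by (simp add: q4_def norm_mult power_mult_distrib power_numeral_reduce)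
    then show ?thesis using nlm q4 by (simp add: field_simps)
  qed
  have u_down: "?u (adj (y0 ** y0) ** h) = ?u h / q4" for h
    unfolding sq' row1_diag m4 by simp
  let ?L = "linked a f0 y0"
  have tc: "y \<in> Gam" "trace y = a" "norm y \<le> C * cmod a" if "y \<in> trace_class C a" for y
    using that by (auto simp: trace_class_def)
  have norm_ex: "\<exists>h. ?L h f y \<and> 1 \<le> ?u h \<and> ?u h < q4" if fy: "(f, y) \<in> ?Fib" for f y
  proof -
    have "f \<in> Gam" "y \<in> trace_class C a" using fy F(1) by auto
    then obtain h where h: "?L h f y"
      using linked_exists[OF y0'(1,2) a13, of f f0 y y0] f0 tc[of y] y0' fy by auto
    have "det (adj Q ** h) = 1" using h Q GamD by (auto simp: linked_def[OF y0'(1,2) a13] det_mul)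
    then have "?u h > 0" by (rule row1_pos)
    show ?thesis
    proof (rule real_normalize_by_steps[where P = "\<lambda>h. ?L h f y" and u = ?u, OF q4 _ _ h \<open>?u h > 0\<close>])
      fix h assume "?L h f y"
      from linked_shift[OF y0'(1,2) a13 f0 y0'(1,2) this]
      show "\<exists>h'. ?L h' f y \<and> ?u h' = q4 * ?u h" "\<exists>h'. ?L h' f y \<and> ?u h' = ?u h / q4"
        using u_up u_down by blast+
    qed
  qed
  define \<eta> where "\<eta> = (\<lambda>(f, y). SOME h. ?L h f y \<and> 1 \<le> ?u h \<and> ?u h < q4)"
  have \<eta>: "?L (\<eta> (f, y)) f y" "1 \<le> ?u (\<eta> (f, y))" "?u (\<eta> (f, y)) < q4" if "(f, y) \<in> ?Fib" for f y
    using someI_ex[OF norm_ex[OF that]] unfolding \<eta>_def by auto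
  have inj: "inj_on \<eta> ?Fib"
  proof (rule inj_onI)
    fix x x' assume x: "x \<in> ?Fib" "x' \<in> ?Fib" "\<eta> x = \<eta> x'"
    obtain f y where fy: "x = (f, y)" by (cases x)
    obtain f' y' where fy': "x' = (f', y')" by (cases x')
    have G: "f \<in> F" "f' \<in> F" "f \<in> Gam" "f' \<in> Gam" using x F(1) fy fy' by auto
    have L: "?L (\<eta> x) f y" using \<eta>(1)[OF x(1)[unfolded fy]] unfolding fy .
    have L': "?L (\<eta> x) f' y'" using \<eta>(1)[OF x(2)[unfolded fy']] unfolding x(3) fy' .
    show "x = x'"
      using linked_determines[OF y0'(1,2) a13 G(3,4) f0 L L'] F(2)[OF G(2,1)] fy fy' by simp
  qed
  let ?H = "\<eta> ` ?Fib"
  have HG: "?H \<subseteq> Gam" using \<eta>(1) by (auto simp: linked_def[OF y0'(1,2) a13])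
  have near: "1 \<le> ?u h \<and> ?u h < cmod l ^ 4" if h: "h \<in> ?H" for h
  proof -
    obtain f y where "(f, y) \<in> ?Fib" "h = \<eta> (f, y)" using h by auto
    then show ?thesis using \<eta>(2,3)[of f y] unfolding q4_def by blast
  qed
  have axis: "?u h * ?v h \<le> 4 * (1 + 2 * C)\<^sup>2" if hH: "h \<in> ?H" for h
  proof -
    obtain f y where fy: "(f, y) \<in> ?Fib" "h = \<eta> (f, y)" using hH by auto
    have L: "?L h f y" using \<eta>(1)[OF fy(1)] fy(2) by simp
    then have h: "h \<in> Gam" "det h = 1" "y0 = h ** y ** adj h" using GamD by (auto simp: linked_def[OF y0'(1,2) a13])
    have "adj (adj Q ** h) ** mk l 0 0 m ** (adj Q ** h) = adj h ** y0 ** h"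
      unfolding Q(2) by (simp add: adj_mult cmat_mult_assoc)
    also have "\<dots> = y" unfolding h(3) using h(2) by (simp add: cmat_mult_assoc adj_cancel mult_adj)
    finally have e: "adj (adj Q ** h) ** mk l 0 0 m ** (adj Q ** h) = y" .
    have "det (adj Q ** h) = 1" using h Q by (simp add: det_mul)
    then show ?thesis
    proof (rule rows_bounded_near_axis[where l = l and m = m and A = "cmod a"])
      show "norm (adj (adj Q ** h) ** mk l 0 0 m ** (adj Q ** h)) \<le> C * cmod a"
        unfolding e using tc(3) fy(1) by auto
    qed (use a13 lmA C in auto)
  qed
  have l1: "cmod l > 1" using l_lo by simp
  have "real (card ?Fib) = real (card ?H)" using card_image[OF inj] by simp
  also have "\<dots> \<le> real (card {\<gamma> \<in> Gam. norm \<gamma> \<le> 12 * (1 + 2 * C)}) * (4 * log 2 (cmod l) + 1)"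
    by (rule card_near_axis(2)[OF Q(1) l1 HG near axis C])
  also have "\<dots> \<le> real (card {\<gamma> \<in> Gam. norm \<gamma> \<le> 12 * (1 + 2 * C)}) * (17 * ln (cmod a))"
  proof (rule mult_left_mono)
    have "13 * cmod a \<le> cmod a * cmod a" using a13 by (intro mult_right_mono) auto
    then have "cmod l \<le> cmod a * cmod a" using l_hi a13 by linarith
    then have "ln (cmod l) \<le> ln (cmod a * cmod a)" using l1 by (subst ln_le_cancel_iff) auto
    also have "\<dots> = 2 * ln (cmod a)" using a13 by (simp add: ln_mult)
    finally have ll: "ln (cmod l) \<le> 2 * ln (cmod a)" .
    have "exp 1 \<le> cmod a" using exp_le a13 by linarith
    then have la: "1 \<le> ln (cmod a)" using ln_ge_iff[of "cmod a" 1] a13 by linarith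
    have l2: "ln 2 \<ge> (1/2::real)" using ln2_ge_two_thirds by simp
    have "log 2 (cmod l) * ln 2 = ln (cmod l)" by (simp add: log_def)
    moreover have "log 2 (cmod l) * (1/2) \<le> log 2 (cmod l) * ln 2"
    proof (rule mult_left_mono[OF l2])
      show "0 \<le> log 2 (cmod l)" by (subst zero_le_log_cancel_iff) (use l1 in linarith)+
    qed
    \<comment> \<open>Combined with 1 <= ln |a|, this bounds 4 log |l| + 1 by (4 * 4 + 1) ln |a|,
      hence the constant 17.\<close>
    ultimately have "log 2 (cmod l) \<le> 4 * ln (cmod a)" using ll by linarith
    then show "4 * log 2 (cmod l) + 1 \<le> 17 * ln (cmod a)" using la by linarith
  qed simp
  finally show ?thesis .
qed

text \<open>Pigeonhole: conjugated squares map the pairs to shortest classes, some fibre has at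
  least average size, and every fibre is bounded by \<open>short_class_fibre\<close>.\<close>

lemma Kiss_lower:
  assumes a13: "cmod a \<ge> 13" and C: "C \<ge> 1" and ne: "trace_class C a \<noteq> {}"
    and F: "F \<subseteq> Gam" "finite F" "F \<noteq> {}" "\<And>f f'. f \<in> F \<Longrightarrow> f' \<in> F \<Longrightarrow> adj f ** f' \<in> Gcong a \<Longrightarrow> f = f'"
  shows "real (card F) * real (card (trace_class C a)) \<le>
    real (Kiss (Gcong a)) * (real (card {\<gamma> \<in> Gam. norm \<gamma> \<le> 12 * (1 + 2 * C)}) * (17 * ln (cmod a)))"
proof -
  let ?S = "F \<times> trace_class C a"
  let ?N = "real (card {\<gamma> \<in> Gam. norm \<gamma> \<le> 12 * (1 + 2 * C)}) * (17 * ln (cmod a))"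
  define \<Phi> where "\<Phi> = (\<lambda>(f, y). conj_class (Gcong a) (f ** (y ** y) ** adj f))"
  obtain y1 where "y1 \<in> trace_class C a" using ne by blast
  then have y1: "y1 \<in> Gam" "trace y1 = a" by (auto simp: trace_class_def)
  have fin: "finite ?S" "?S \<noteq> {}" using F ne by (auto simp: finite_trace_class)
  obtain x where x: "x \<in> ?S" "card ?S \<le> card (\<Phi> ` ?S) * card {x' \<in> ?S. \<Phi> x' = \<Phi> x}"
    by (rule fiber_pigeonhole[OF fin, of \<Phi>])
  obtain f0 y0 where fy0: "x = (f0, y0)" by (cases x)
  have 0: "f0 \<in> Gam" "y0 \<in> trace_class C a" using x fy0 F(1) by auto
  have "{x' \<in> ?S. \<Phi> x' = \<Phi> x} = {(f, y) \<in> ?S.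
      conj_class (Gcong a) (f ** (y ** y) ** adj f) = conj_class (Gcong a) (f0 ** (y0 ** y0) ** adj f0)}"
    by (auto simp: \<Phi>_def fy0)
  then have fib: "real (card {x' \<in> ?S. \<Phi> x' = \<Phi> x}) \<le> ?N"
    using short_class_fibre[OF a13 C 0 F(1,4)] by (simp only:)
  have "\<Phi> ` ?S \<subseteq> short_classes a"
  proof
    fix X assume "X \<in> \<Phi> ` ?S"
    then obtain f y where fy: "f \<in> F" "y \<in> Gam" "trace y = a" "X = conj_class (Gcong a) (f ** (y ** y) ** adj f)"
      by (auto simp: \<Phi>_def trace_class_def)
    let ?g = "f ** (y ** y) ** adj f"
    have fG: "f \<in> Gam" "det f = 1" using fy(1) F(1) GamD by auto
    have g: "?g \<in> Gcong a" by (rule Gcong_conj[OF square_in_Gcong[OF fy(2,3)] fG(1)])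
    have t: "trace ?g = a\<^sup>2 - 2" using fG(2) trace_square[OF fy(2)] fy(3) by (simp add: trace_conj')
    show "X \<in> short_classes a"
      unfolding short_classes_def[OF y1 a13] systole_Gcong[OF y1 a13]
      using g short_element[OF y1 a13 g t] fy(4) by blast
  qed
  then have "card (\<Phi> ` ?S) \<le> Kiss (Gcong a)"
    unfolding Kiss_eq[OF y1 a13] by (rule card_mono[OF finite_short_classes[OF y1 a13]])
  then have "card (\<Phi> ` ?S) * card {x' \<in> ?S. \<Phi> x' = \<Phi> x} \<le> Kiss (Gcong a) * card {x' \<in> ?S. \<Phi> x' = \<Phi> x}"
    by (rule mult_right_mono) simp
  then have "card ?S \<le> Kiss (Gcong a) * card {x' \<in> ?S. \<Phi> x' = \<Phi> x}" using x(2) by linarith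
  then have "real (card ?S) \<le> real (Kiss (Gcong a)) * real (card {x' \<in> ?S. \<Phi> x' = \<Phi> x})"
    by (simp only: of_nat_le_iff flip: of_nat_mult)
  also have "\<dots> \<le> real (Kiss (Gcong a)) * ?N" using fib by (intro mult_left_mono) auto
  finally show ?thesis by (simp add: card_cartesian_product)
qed

lemma Kiss_vol_bounds:
  obtains c K where "c > 0" "K > 0"
    "\<And>A0. \<exists>a. cmod a \<ge> A0 \<and> compact_arith_manifold_group (Gcong a) \<and>
       vol (Gcong a) \<ge> cmod a ^ 4 / 2048 \<and> vol (Gcong a) \<le> K * cmod a ^ 6 \<and>
       c * vol (Gcong a) * (cmod a)\<^sup>2 \<le> real (Kiss (Gcong a)) * ln (cmod a)"
proof -
  obtain c C where cC: "c > 0" "C \<ge> 1"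
    "\<And>A0. \<exists>a. cmod a \<ge> A0 \<and> real (card (trace_class C a)) \<ge> c * (cmod a)\<^sup>2"
    using rich_trace_exists by blast
  obtain D where D: "D \<ge> 2" "\<And>p. p \<in> H3 \<Longrightarrow> \<exists>\<gamma>\<in>Gam. hnorm (act \<gamma> p) \<le> D"
    using Gam_cocompact by blast
  \<comment> \<open>The summand 1 here and in \<open>N\<close> guarantees positive
    denominators.\<close>
  define V where "V = enn2real (hypvol (Kset D)) + 1"
  define N where "N = real (card {\<gamma> \<in> Gam. norm \<gamma> \<le> 12 * (1 + 2 * C)}) + 1"
  have V: "V > 0" by (simp add: V_def add_nonneg_pos)
  have N: "N > 0" by (simp add: N_def add_nonneg_pos)
  define c' where "c' = c / (V * N * 17)"
  define K where "K = V * (9 ^ 4 * 1024)"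
  have main: "\<exists>a. cmod a \<ge> A0 \<and> compact_arith_manifold_group (Gcong a) \<and>
       vol (Gcong a) \<ge> cmod a ^ 4 / 2048 \<and> vol (Gcong a) \<le> K * cmod a ^ 6 \<and>
       c' * vol (Gcong a) * (cmod a)\<^sup>2 \<le> real (Kiss (Gcong a)) * ln (cmod a)" for A0
  proof -
    obtain a where a: "cmod a \<ge> max 13 A0" "real (card (trace_class C a)) \<ge> c * (cmod a)\<^sup>2" using cC(3) by blast
    have a13: "cmod a \<ge> 13" "cmod a \<ge> A0" "cmod a \<ge> 4" "a \<noteq> 0" using a(1) by auto
    have "c * (cmod a)\<^sup>2 > 0" using cC(1) a13 by simp
    then have "real (card (trace_class C a)) > 0" using a(2) by linarith
    then have ne: "trace_class C a \<noteq> {}" by auto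
    then obtain y where y: "y \<in> Gam" "trace y = a" by (auto simp: trace_class_def)
    have aZ: "a \<in> Zi" using y GamD Ord_trace by auto
    obtain F where F: "F \<subseteq> Gam" "\<And>x. x \<in> Gam \<Longrightarrow> \<exists>f\<in>F. adj f ** x \<in> Gcong a"
      "\<And>f f'. f \<in> F \<Longrightarrow> f' \<in> F \<Longrightarrow> adj f ** f' \<in> Gcong a \<Longrightarrow> f = f'"
      using coset_representatives by metis
    have inc: "incongruent a F" by (rule incongruent_coset_representatives[OF F(1,3)])
    have fin: "finite F" by (rule incongruent_card(1)[OF inc aZ a13(4)])
    have Fne: "F \<noteq> {}" using F(2)[OF Gam_one] by blast
    have Fc: "real (card F) \<le> 9 ^ 4 * 1024 * cmod a ^ 6"
      by (rule incongruent_card_Gam[OF y aZ a13(4) F(1) inc])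
    have "vol (Gcong a) \<le> card F * enn2real (hypvol (Kset D))"
      by (rule vol_Gcong_bounds(1)[OF y a13(3) F(1) fin F(2) D(2)])
    also have "\<dots> \<le> card F * V" by (intro mult_left_mono) (auto simp: V_def)
    finally have vF: "vol (Gcong a) \<le> card F * V" .
    also have "\<dots> \<le> (9 ^ 4 * 1024 * cmod a ^ 6) * V" using Fc V by (intro mult_right_mono) auto
    finally have vol_hi: "vol (Gcong a) \<le> K * cmod a ^ 6" by (simp add: K_def mult_ac)
    have vol_lo: "vol (Gcong a) \<ge> cmod a ^ 4 / 2048"
      by (rule vol_Gcong_bounds(2)[OF y a13(3) F(1) fin F(2) D(2)])
    have "ln (cmod a) \<ge> 0" using a13 by simp
    have "c * vol (Gcong a) * (cmod a)\<^sup>2 \<le> c * (card F * V) * (cmod a)\<^sup>2"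
      using vF cC(1) by (intro mult_right_mono mult_left_mono) auto
    also have "\<dots> = V * (real (card F) * (c * (cmod a)\<^sup>2))" by (simp add: mult_ac)
    also have "\<dots> \<le> V * (real (card F) * real (card (trace_class C a)))"
      using a(2) V by (intro mult_left_mono) auto
    also have "\<dots> \<le> V * (real (Kiss (Gcong a)) * (real (card {\<gamma> \<in> Gam. norm \<gamma> \<le> 12 * (1 + 2 * C)}) * (17 * ln (cmod a))))"
      using Kiss_lower[OF a13(1) cC(2) ne F(1) fin Fne F(3)] V by (intro mult_left_mono) auto
    also have "\<dots> \<le> V * (real (Kiss (Gcong a)) * (N * (17 * ln (cmod a))))"
      using V \<open>ln (cmod a) \<ge> 0\<close> by (intro mult_left_mono mult_right_mono) (auto simp: N_def)
    also have "\<dots> = (real (Kiss (Gcong a)) * ln (cmod a)) * (V * N * 17)" by (simp add: mult_ac)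
    finally have "c * vol (Gcong a) * (cmod a)\<^sup>2 / (V * N * 17) \<le> real (Kiss (Gcong a)) * ln (cmod a)"
      using V N by (subst pos_divide_le_eq) auto
    then have "c' * vol (Gcong a) * (cmod a)\<^sup>2 \<le> real (Kiss (Gcong a)) * ln (cmod a)"
      by (simp add: c'_def)
    then show ?thesis using vol_hi vol_lo a13(2) compact_arith_Gcong[OF y a13(3)] by blast
  qed
  show thesis by (rule that[OF _ _ main]) (use cC V N in \<open>simp_all add: c'_def K_def\<close>)
qed

theorem theoremD:
  shows "\<exists>C::real. C > 0 \<and> (\<exists>M :: nat \<Rightarrow> cmat set.
           (\<forall>j. compact_arith_manifold_group (M j)) \<and>
           filterlim (\<lambda>j. vol (M j)) at_top sequentially \<and>
           (\<forall>j. real (Kiss (M j)) \<ge> C * vol (M j) powr (4/3) / ln (vol (M j))))"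
proof -
  obtain c K where cK: "c > 0" "K > 0"
    "\<And>A0. \<exists>a. cmod a \<ge> A0 \<and> compact_arith_manifold_group (Gcong a) \<and>
       vol (Gcong a) \<ge> cmod a ^ 4 / 2048 \<and> vol (Gcong a) \<le> K * cmod a ^ 6 \<and>
       c * vol (Gcong a) * (cmod a)\<^sup>2 \<le> real (Kiss (Gcong a)) * ln (cmod a)"
    using Kiss_vol_bounds by blast
  obtain a where a: "\<And>j::nat. cmod (a j) \<ge> real j + 13" "\<And>j. compact_arith_manifold_group (Gcong (a j))"
    "\<And>j. vol (Gcong (a j)) \<ge> cmod (a j) ^ 4 / 2048" "\<And>j. vol (Gcong (a j)) \<le> K * cmod (a j) ^ 6"
    "\<And>j. c * vol (Gcong (a j)) * (cmod (a j))\<^sup>2 \<le> real (Kiss (Gcong (a j))) * ln (cmod (a j))"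
    using choice[OF allI[OF cK(3)], of "\<lambda>j::nat. real j + 13"] by blast
  have vol_ge: "vol (Gcong (a j)) \<ge> cmod (a j)" for j
  proof -
    have "13 \<le> cmod (a j)" using a(1)[of j] by linarith
    \<comment> \<open>13 is the least integer whose cube reaches 2048, which turns the bound |a|^4 /
      2048 into |a|.\<close>
    then have "13 ^ 3 \<le> cmod (a j) ^ 3" by (intro power_mono) auto
    then have "2048 * cmod (a j) \<le> cmod (a j) ^ 3 * cmod (a j)" by (intro mult_right_mono) auto
    then have "cmod (a j) \<le> cmod (a j) ^ 4 / 2048" by (simp add: power_numeral_reduce mult_ac)
    then show ?thesis using a(3)[of j] by linarith
  qed
  define C where "C = c / K powr (1/3)"
  have kiss: "real (Kiss (Gcong (a j))) \<ge> C * vol (Gcong (a j)) powr (4/3) / ln (vol (Gcong (a j)))" for j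
  proof -
    define A v where "A = cmod (a j)" "v = vol (Gcong (a j))"
    note Av = this
    have A: "A \<ge> 13" "v \<ge> A" using a(1)[of j] vol_ge[of j] by (simp_all add: Av)
    have v: "v > 0" "ln A \<le> ln v" "ln v > 0" using A by simp_all
    \<comment> \<open>Taking cube roots gives A^2 >= (v / K)^(1/3), the source of the additional
      exponent 1/3; the bound A <= v then replaces ln A by ln v.\<close>
    have "v / K \<le> A ^ 6" using a(4)[of j] cK(2) by (simp add: Av divide_le_eq mult.commute)
    then have "(v / K) powr (1/3) \<le> (A ^ 6) powr (1/3)" using v cK(2) by (intro powr_mono2) auto
    also have "(A ^ 6) powr (1/3) = A\<^sup>2"
    proof -
      have "(A ^ 6) powr (1/3) = (A powr real 6) powr (1/3)" using A by (subst powr_realpow) auto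
      also have "\<dots> = A powr real 2" by (simp only: powr_powr) simp
      also have "\<dots> = A\<^sup>2" using A by (subst powr_realpow) auto
      finally show ?thesis .
    qed
    finally have "v powr (1/3) / K powr (1/3) \<le> A\<^sup>2" using v cK(2) by (simp add: powr_divide)
    then have "c * v * (v powr (1/3) / K powr (1/3)) \<le> c * v * A\<^sup>2" using v cK(1) by (intro mult_left_mono) auto
    also have "\<dots> \<le> real (Kiss (Gcong (a j))) * ln A" using a(5)[of j] by (simp add: Av)
    also have "\<dots> \<le> real (Kiss (Gcong (a j))) * ln v" using v by (intro mult_left_mono) auto
    finally have le: "c * v * (v powr (1/3) / K powr (1/3)) / ln v \<le> real (Kiss (Gcong (a j)))"
      by (subst pos_divide_le_eq[OF v(3)])
    have "v * v powr (1/3) = v powr (4/3)" using v powr_add[of v 1 "1/3"] by simp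
    then have e: "c * v * (v powr (1/3) / K powr (1/3)) = C * v powr (4/3)" by (simp add: C_def)
    show ?thesis using le unfolding e by (simp only: Av)
  qed
  have C: "C > 0" using cK by (simp add: C_def)
  have lim: "filterlim (\<lambda>j. vol (Gcong (a j))) at_top sequentially"
  proof (rule filterlim_at_top_mono[OF filterlim_real_sequentially], rule always_eventually, rule allI)
    fix j
    show "real j \<le> vol (Gcong (a j))" using a(1)[of j] vol_ge[of j] by linarith
  qed
  show ?thesis
    by (intro exI[of _ C] exI[of _ "\<lambda>j. Gcong (a j)"] conjI allI) (rule C a(2) lim kiss)+
qed

end
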